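(* (Maschke Theorem for Hopf algebroids.) Let $\mathcal{A}=(\mathcal{A}_L,\mathcal{A}_R,S)$ be a Hopf algebroid over a commutative ring $k$, with $\mathcal{A}_L=(A,L,s_L,t_L,\gamma_L,\pi_L)$ and $\mathcal{A}_R=(A,R,s_R,t_R,\gamma_R,\pi_R)$. The following assertions are equivalent: 1.a) The extension $s_R:R\to A$ is separable, i.e. the multiplication map $A^R\otimes {}_RA\to A$ splits as an $A$-$A$ bimodule epimorphism. 1.b) The extension $t_R:R^{op}\to A$ is separable, i.e. the multiplication map ${}^RA\otimes A_R\to A$ splits as an $A$-$A$ bimodule epimorphism. 1.c) The extension $s_L:L\to A$ is separable, i.e. the multiplication map $A^L\otimes {}_LA\to A$ splits as an $A$-$A$ bimodule epimorphism. 1.d) The extension $t_L:L^{op}\to A$ is separable, i.e. the multiplication map ${}^LA\otimes A_L\to A$ splits as an $A$-$A$ bimodule epimorphism. 2.a) The extension $s_R:R\to A$ is right semi-simple, i.e. any right $A$-module is $(A,R)$-projective. 2.b) The extension $t_R:R^{op}\to A$ is right semi-simple, i.e. any right $A$-module is $(A,R^{op})$-projective. 2.c) The extension $s_L:L\to A$ is left semi-simple, i.e. any left $A$-module is $(A,L)$-projective. 2.d) The extension $t_L:L^{op}\to A$ is left semi-simple, i.e. any left $A$-module is $(A,L^{op})$-projective. 3.a) There exists a normalized left integral in $\mathcal{A}$, i.e. an element $\ell\in\mathcal{L}(\mathcal{A})$ such that $\pi_L(\ell)=1_L$. 3.b) There exists a normalized right integral in $\mathcal{A}$, i.e. an element $\wp\in\mathcal{R}(\mathcal{A})$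 such that $\pi_R(\wp)=1_R$. 4.a) The epimorphism $\pi_R:A\to R$ splits as a right $A$-module map. 4.b) The epimorphism $\pi_L:A\to L$ splits as a left $A$-module map.
   Context: Algebras are associative unital algebras over a commutative ring $k$. **Left bialgebroid.** A left bialgebroid $(A,L,s,t,\gamma,\pi)$ consists of $k$-algebras $A$ (total) and $L$ (base), algebra homomorphisms $s:L\to A$ and $t:L^{op}\to A$ with commuting ranges, and an $L$-coring structure (coassociative coproduct $\gamma:A\to A\otimes_L A$ and counit $\pi:A\to L$, both $L$-$L$ bimodule maps) on the $L$-$L$ bimodule $A$ with actions $l\cdot a\cdot l'=s(l)t(l')a$. Writing $\gamma(a)=a_{(1)}\otimes a_{(2)}$, it is required that $a_{(1)}t(l)\otimes a_{(2)}=a_{(1)}\otimes a_{(2)}s(l)$, $\gamma(1)=1\otimes 1$, $\gamma(aa')=\gamma(a)\gamma(a')$, $\pi(1)=1$, $\pi(a\,s(\pi(a')))=\pi(aa')=\pi(a\,t(\pi(a')))$. **Right bialgebroid.** $(A,R,s,t,\gamma,\pi)$ is a right bialgebroid if $(A^{op},R,t,s,\gamma,\pi)$ is a left bialgebroid. Explicitly: $s:R\to A$, $t:R^{op}\to A$ are algebra maps with commuting ranges; $(A,\gamma,\pi)$ is an $R$-coring for the bimodule $r\cdot a\cdot r'=a\,s(r')t(r)$; and, with $\gamma(a)=a^{(1)}\otimes a^{(2)}$: $s(r)a^{(1)}\otimes a^{(2)}=a^{(1)}\otimes t(r)a^{(2)}$, $\gamma(1)=1\otimes1$, $\gamma(aa')=\gamma(a)\gamma(a')$,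 $\pi(1)=1$, $\pi(s(\pi(a))a')=\pi(aa')=\pi(t(\pi(a))a')$. **Module notation.** For $B\in\{L,R\}$ with $s=s_B,t=t_B$: ${}_BA$ is $A$ with left action $b\cdot a=s(b)a$; $A_B$ has right action $a\cdot b=t(b)a$; $A^B$ has right action $a\cdot b=a\,s(b)$; ${}^BA$ has left action $b\cdot a=a\,t(b)$. In a tensor product the displayed module structures are the ones balanced over $B$ (or $B^{op}$), e.g. $A_L\otimes{}_LA$ has $t_L(l)a\otimes b=a\otimes s_L(l)b$, $A^R\otimes{}^RA$ has $as_R(r)\otimes b=a\otimes bt_R(r)$, and ${}^LA\otimes A_L$ has $at_L(l)\otimes b=a\otimes t_L(l)b$. **Hopf algebroid.** $\mathcal{A}=(\mathcal{A}_L,\mathcal{A}_R,S)$ consists of a left bialgebroid $\mathcal{A}_L=(A,L,s_L,t_L,\gamma_L,\pi_L)$ and a right bialgebroid $\mathcal{A}_R=(A,R,s_R,t_R,\gamma_R,\pi_R)$ on the same total algebra $A$ and a $k$-linear map $S:A\to A$ (antipode, not assumed bijective) such that (i) $s_L\pi_Lt_R=t_R$, $t_L\pi_Ls_R=s_R$, $s_R\pi_Rt_L=t_L$, $t_R\pi_Rs_L=s_L$; (ii) $(\gamma_L\otimes{}^RA)\gamma_R=(A_L\otimes\gamma_R)\gamma_L$ as maps $A\to A_L\otimes{}_LA^R\otimes{}^RA$, and $(\gamma_R\otimes{}_LA)\gamma_L=(A^R\otimes\gamma_L)\gamma_R$ as maps $A\to A^R\otimes{}^RA_L\otimes{}_LA$;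 (iii) $S(t_L(l')\,a\,t_L(l))=s_L(l)S(a)s_L(l')$ and $S(t_R(r')\,a\,t_R(r))=s_R(r)S(a)s_R(r')$; (iv) $S(a_{(1)})a_{(2)}=s_R\pi_R(a)$ and $a^{(1)}S(a^{(2)})=s_L\pi_L(a)$, where $\gamma_L(a)=a_{(1)}\otimes a_{(2)}$ and $\gamma_R(a)=a^{(1)}\otimes a^{(2)}$. **Integrals in $\mathcal{A}$.** $\mathcal{L}(\mathcal{A})=\{\ell\in A\mid a\ell=s_L(\pi_L(a))\,\ell\ \ \forall a\in A\}$ (left integrals); $\mathcal{R}(\mathcal{A})=\{\wp\in A\mid \wp a=\wp\,s_R(\pi_R(a))\ \ \forall a\in A\}$ (right integrals). **Relative projectivity.** For an algebra map $B\to A$, an $A$-module $M$ is $(A,B)$-projective if every epimorphism of $A$-modules onto $M$ which splits as a $B$-module map splits as an $A$-module map. **Module structures on the bases.** $R$ is a right $A$-module via $r\cdot a=\pi_R(s_R(r)a)$, and $L$ is a left $A$-module via $a\cdot l=\pi_L(a\,s_L(l))$; with these, $\pi_R$ and $\pi_L$ are $A$-module maps. The $A$-$A$ bimodule structure on $A\otimes A$ (over any base) is by left multiplication in the first and right multiplication in the second factor. *)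

theory Defs
  imports "HOL-Algebra.Module" "HOL-Algebra.Free_Abelian_Groups"
begin

section \<open>Algebras and modules over noncommutative rings\<close>

text \<open>
  The library locales \<open>algebra\<close> and \<open>module\<close> are restricted to commutative rings, hence the
  noncommutative versions below. As everywhere in HOL-Algebra, structures live on carrier sets, the
  zero ring is a ring, and the fields \<open>mult\<close> and \<open>one\<close> of a record representing a module carry no
  meaning.
\<close>

locale k_algebra = module K A + ring A for K (structure) and A (structure) +
  assumes smult_mult_left:
      "\<lbrakk>c \<in> carrier K; x \<in> carrier A; y \<in> carrier A\<rbrakk>
        \<Longrightarrow> (c \<odot>\<^bsub>A\<^esub> x) \<otimes>\<^bsub>A\<^esub> y = c \<odot>\<^bsub>A\<^esub> (x \<otimes>\<^bsub>A\<^esub> y)"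
    and smult_mult_right:
      "\<lbrakk>c \<in> carrier K; x \<in> carrier A; y \<in> carrier A\<rbrakk>
        \<Longrightarrow> x \<otimes>\<^bsub>A\<^esub> (c \<odot>\<^bsub>A\<^esub> y) = c \<odot>\<^bsub>A\<^esub> (x \<otimes>\<^bsub>A\<^esub> y)"

definition opposite :: "('a, 'x) ring_scheme \<Rightarrow> ('a, 'x) ring_scheme"
  where "opposite A = A\<lparr>monoid.mult := \<lambda>x y. y \<otimes>\<^bsub>A\<^esub> x\<rparr>"

locale left_module = A?: ring A + M?: abelian_group M
  for A :: "('a, 'x) ring_scheme" and M :: "('a, 'm, 'y) module_scheme" +
  assumes act_closed: "\<lbrakk>a \<in> carrier A; x \<in> carrier M\<rbrakk> \<Longrightarrow> a \<odot>\<^bsub>M\<^esub> x \<in> carrier M"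
    and act_add_left: "\<lbrakk>a \<in> carrier A; b \<in> carrier A; x \<in> carrier M\<rbrakk>
      \<Longrightarrow> (a \<oplus>\<^bsub>A\<^esub> b) \<odot>\<^bsub>M\<^esub> x = a \<odot>\<^bsub>M\<^esub> x \<oplus>\<^bsub>M\<^esub> b \<odot>\<^bsub>M\<^esub> x"
    and act_add_right: "\<lbrakk>a \<in> carrier A; x \<in> carrier M; y \<in> carrier M\<rbrakk>
      \<Longrightarrow> a \<odot>\<^bsub>M\<^esub> (x \<oplus>\<^bsub>M\<^esub> y) = a \<odot>\<^bsub>M\<^esub> x \<oplus>\<^bsub>M\<^esub> a \<odot>\<^bsub>M\<^esub> y"
    and act_assoc: "\<lbrakk>a \<in> carrier A; b \<in> carrier A; x \<in> carrier M\<rbrakk>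
      \<Longrightarrow> (a \<otimes>\<^bsub>A\<^esub> b) \<odot>\<^bsub>M\<^esub> x = a \<odot>\<^bsub>M\<^esub> (b \<odot>\<^bsub>M\<^esub> x)"
    and act_one: "x \<in> carrier M \<Longrightarrow> \<one>\<^bsub>A\<^esub> \<odot>\<^bsub>M\<^esub> x = x"

text \<open>
  A right \<open>A\<close>-module is a left \<open>opposite A\<close>-module; then \<open>a \<odot>\<^bsub>M\<^esub> x\<close> is the right action \<open>x \<cdot> a\<close>.
\<close>

definition linear_maps ::
    "('a, 'x) ring_scheme \<Rightarrow> ('a, 'm, 'y) module_scheme \<Rightarrow> ('a, 'n, 'z) module_scheme \<Rightarrow> ('m \<Rightarrow> 'n) set"
  where "linear_maps A M N = {f \<in> hom (add_monoid M) (add_monoid N).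
    \<forall>a\<in>carrier A. \<forall>x\<in>carrier M. f (a \<odot>\<^bsub>M\<^esub> x) = a \<odot>\<^bsub>N\<^esub> f x}"

definition algebra_homs ::
    "('k, 'x) ring_scheme \<Rightarrow> ('k, 'a, 'y) module_scheme \<Rightarrow> ('k, 'b, 'z) module_scheme \<Rightarrow> ('a \<Rightarrow> 'b) set"
  where "algebra_homs K A B = ring_hom A B \<inter> linear_maps K A B"

definition with_action :: "('m, 'y) ring_scheme \<Rightarrow> ('a \<Rightarrow> 'm \<Rightarrow> 'm) \<Rightarrow> ('a, 'm) module"
  where "with_action M act = \<lparr>carrier = carrier M, monoid.mult = monoid.mult M, one = one M,
    ring.zero = ring.zero M, add = add M, smult = act\<rparr>"

definition regular_module :: "('a, 'x) ring_scheme \<Rightarrow> ('a, 'a) module"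
  where "regular_module A = with_action A (\<lambda>a x. a \<otimes>\<^bsub>A\<^esub> x)"

definition restrict_scalars ::
    "('b \<Rightarrow> 'a) \<Rightarrow> ('a, 'm, 'y) module_scheme \<Rightarrow> ('b, 'm) module"
  where "restrict_scalars \<iota> M = with_action M (\<lambda>b x. \<iota> b \<odot>\<^bsub>M\<^esub> x)"

section \<open>Tensor products\<close>

definition presented_group :: "'x set \<Rightarrow> ('x \<Rightarrow>\<^sub>0 int) set \<Rightarrow> ('x \<Rightarrow>\<^sub>0 int) set monoid"
  where "presented_group X rels =
    free_Abelian_group X Mod generate (free_Abelian_group X) rels"

text \<open>
  The unit of a quotient group is the normal subgroup factored out, so \<open>tensor T x\<close> is the coset of
  the generator \<open>x\<close> in \<open>T = presented_group X rels\<close>; for a tensor product \<open>T\<close> this is the pure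
  tensor with entries \<open>x = (u, v)\<close> or \<open>x = (u, v, w)\<close>.
\<close>

definition tensor :: "('x \<Rightarrow>\<^sub>0 int) set monoid \<Rightarrow> 'x \<Rightarrow> ('x \<Rightarrow>\<^sub>0 int) set"
  where "tensor T x = (\<lambda>c. c + frag_of x) ` \<one>\<^bsub>T\<^esub>"

text \<open>
  The homomorphism from a presented group to the abelian group \<open>G\<close> that sends the class of each
  generator \<open>x\<close> to \<open>f x\<close>. It is meaningful only if \<open>f\<close> respects the relations, since otherwise the
  image of a coset need not be a singleton.
\<close>

definition lift :: "('c, 'z) monoid_scheme \<Rightarrow> ('x \<Rightarrow> 'c) \<Rightarrow> ('x \<Rightarrow>\<^sub>0 int) set \<Rightarrow> 'c"
  where "lift G f X = the_elem
    ((\<lambda>c. finprod G (\<lambda>x. f x [^]\<^bsub>G\<^esub> Poly_Mapping.lookup c x) (Poly_Mapping.keys c)) ` X)"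

text \<open>
  The tensor product of abelian groups \<open>M\<close> and \<open>N\<close>, balanced over \<open>B\<close>:
  \<open>\<rho> b x \<otimes> y = x \<otimes> \<sigma> b y\<close> for \<open>b \<in> B\<close>.
\<close>

definition tensor_product ::
    "('m, 'x) ring_scheme \<Rightarrow> ('n, 'y) ring_scheme \<Rightarrow>
     'b set \<Rightarrow> ('b \<Rightarrow> 'm \<Rightarrow> 'm) \<Rightarrow> ('b \<Rightarrow> 'n \<Rightarrow> 'n) \<Rightarrow> ('m \<times> 'n \<Rightarrow>\<^sub>0 int) set monoid"
  where "tensor_product M N B \<rho> \<sigma> = presented_group (carrier M \<times> carrier N)
    ({frag_of (x \<oplus>\<^bsub>M\<^esub> x', y) - frag_of (x, y) - frag_of (x', y) | x x' y.
        x \<in> carrier M \<and> x' \<in> carrier M \<and> y \<in> carrier N} \<union>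
     {frag_of (x, y \<oplus>\<^bsub>N\<^esub> y') - frag_of (x, y) - frag_of (x, y') | x y y'.
        x \<in> carrier M \<and> y \<in> carrier N \<and> y' \<in> carrier N} \<union>
     {frag_of (\<rho> b x, y) - frag_of (x, \<sigma> b y) | b x y.
        b \<in> B \<and> x \<in> carrier M \<and> y \<in> carrier N})"

text \<open>
  The threefold tensor product of \<open>M\<close>, \<open>N\<close> and \<open>P\<close>, balanced over \<open>B\<close> between \<open>M\<close> and \<open>N\<close> and over
  \<open>C\<close> between \<open>N\<close> and \<open>P\<close>. Using it in place of the two iterated tensor products makes the
  associativity isomorphism an identification.
\<close>

definition tensor_product3 ::
    "('m, 'x) ring_scheme \<Rightarrow> ('n, 'y) ring_scheme \<Rightarrow> ('p, 'z) ring_scheme \<Rightarrow>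
     'b set \<Rightarrow> ('b \<Rightarrow> 'm \<Rightarrow> 'm) \<Rightarrow> ('b \<Rightarrow> 'n \<Rightarrow> 'n) \<Rightarrow>
     'c set \<Rightarrow> ('c \<Rightarrow> 'n \<Rightarrow> 'n) \<Rightarrow> ('c \<Rightarrow> 'p \<Rightarrow> 'p) \<Rightarrow>
     ('m \<times> 'n \<times> 'p \<Rightarrow>\<^sub>0 int) set monoid"
  where "tensor_product3 M N P B \<rho> \<sigma> C \<rho>' \<sigma>' =
    presented_group (carrier M \<times> carrier N \<times> carrier P)
    ({frag_of (x \<oplus>\<^bsub>M\<^esub> x', y, z) - frag_of (x, y, z) - frag_of (x', y, z) | x x' y z.
        x \<in> carrier M \<and> x' \<in> carrier M \<and> y \<in> carrier N \<and> z \<in> carrier P} \<union>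
     {frag_of (x, y \<oplus>\<^bsub>N\<^esub> y', z) - frag_of (x, y, z) - frag_of (x, y', z) | x y y' z.
        x \<in> carrier M \<and> y \<in> carrier N \<and> y' \<in> carrier N \<and> z \<in> carrier P} \<union>
     {frag_of (x, y, z \<oplus>\<^bsub>P\<^esub> z') - frag_of (x, y, z) - frag_of (x, y, z') | x y z z'.
        x \<in> carrier M \<and> y \<in> carrier N \<and> z \<in> carrier P \<and> z' \<in> carrier P} \<union>
     {frag_of (\<rho> b x, y, z) - frag_of (x, \<sigma> b y, z) | b x y z.
        b \<in> B \<and> x \<in> carrier M \<and> y \<in> carrier N \<and> z \<in> carrier P} \<union>
     {frag_of (x, \<rho>' c y, z) - frag_of (x, y, \<sigma>' c z) | c x y z.
        c \<in> C \<and> x \<in> carrier M \<and> y \<in> carrier N \<and> z \<in> carrier P})"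

text \<open>
  For additive \<open>\<gamma> : A \<rightarrow> A \<otimes> A\<close>, the maps \<open>\<gamma> \<otimes> A\<close> and \<open>A \<otimes> \<gamma>\<close> from a tensor square of \<open>A\<close> to the
  threefold tensor product \<open>T\<close>.
\<close>

definition apply_left ::
    "('a \<times> 'a \<times> 'a \<Rightarrow>\<^sub>0 int) set monoid \<Rightarrow> ('a \<Rightarrow> ('a \<times> 'a \<Rightarrow>\<^sub>0 int) set) \<Rightarrow>
     ('a \<times> 'a \<Rightarrow>\<^sub>0 int) set \<Rightarrow> ('a \<times> 'a \<times> 'a \<Rightarrow>\<^sub>0 int) set"
  where "apply_left T \<gamma> = lift T (\<lambda>(x, y). lift T (\<lambda>(u, v). tensor T (u, v, y)) (\<gamma> x))"

definition apply_right ::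
    "('a \<times> 'a \<times> 'a \<Rightarrow>\<^sub>0 int) set monoid \<Rightarrow> ('a \<Rightarrow> ('a \<times> 'a \<Rightarrow>\<^sub>0 int) set) \<Rightarrow>
     ('a \<times> 'a \<Rightarrow>\<^sub>0 int) set \<Rightarrow> ('a \<times> 'a \<times> 'a \<Rightarrow>\<^sub>0 int) set"
  where "apply_right T \<gamma> = lift T (\<lambda>(x, y). lift T (\<lambda>(u, v). tensor T (x, u, v)) (\<gamma> y))"

section \<open>Bialgebroids\<close>

text \<open>\<open>A\<^sub>L \<otimes> \<^sub>LA\<close>, with \<open>t(l)a \<otimes> b = a \<otimes> s(l)b\<close>, and its threefold analogue.\<close>

definition bialgebroid_tensor ::
    "('a, 'x) ring_scheme \<Rightarrow> ('l, 'y) ring_scheme \<Rightarrow> ('l \<Rightarrow> 'a) \<Rightarrow> ('l \<Rightarrow> 'a) \<Rightarrow>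
     ('a \<times> 'a \<Rightarrow>\<^sub>0 int) set monoid"
  where "bialgebroid_tensor A L s t =
    tensor_product A A (carrier L) (\<lambda>l x. t l \<otimes>\<^bsub>A\<^esub> x) (\<lambda>l y. s l \<otimes>\<^bsub>A\<^esub> y)"

definition bialgebroid_tensor3 ::
    "('a, 'x) ring_scheme \<Rightarrow> ('l, 'y) ring_scheme \<Rightarrow> ('l \<Rightarrow> 'a) \<Rightarrow> ('l \<Rightarrow> 'a) \<Rightarrow>
     ('a \<times> 'a \<times> 'a \<Rightarrow>\<^sub>0 int) set monoid"
  where "bialgebroid_tensor3 A L s t = tensor_product3 A A A
    (carrier L) (\<lambda>l x. t l \<otimes>\<^bsub>A\<^esub> x) (\<lambda>l y. s l \<otimes>\<^bsub>A\<^esub> y)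
    (carrier L) (\<lambda>l y. t l \<otimes>\<^bsub>A\<^esub> y) (\<lambda>l z. s l \<otimes>\<^bsub>A\<^esub> z)"

text \<open>
  The factorwise product \<open>(\<Sum> x \<otimes> y) (\<Sum> x' \<otimes> y') = \<Sum> xx' \<otimes> yy'\<close>. The order of the two lifts matters:
  right multiplication by \<open>x' \<otimes> y'\<close> is always well defined on \<open>A\<^sub>L \<otimes> \<^sub>LA\<close>, and the outer lift is
  meaningful when \<open>X\<close> satisfies \<open>\<Sum> x t(l) \<otimes> y = \<Sum> x \<otimes> y s(l)\<close>.
\<close>

definition tensor_mult ::
    "('a \<times> 'a \<Rightarrow>\<^sub>0 int) set monoid \<Rightarrow> ('a, 'x) ring_scheme \<Rightarrow>
     ('a \<times> 'a \<Rightarrow>\<^sub>0 int) set \<Rightarrow> ('a \<times> 'a \<Rightarrow>\<^sub>0 int) set \<Rightarrow> ('a \<times> 'a \<Rightarrow>\<^sub>0 int) set"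
  where "tensor_mult T A X Y = lift T
    (\<lambda>(x', y'). lift T (\<lambda>(x, y). tensor T (x \<otimes>\<^bsub>A\<^esub> x', y \<otimes>\<^bsub>A\<^esub> y')) X) Y"

locale left_bialgebroid =
  fixes K :: "('k, 'x) ring_scheme"
    and A :: "('k, 'a, 'y) module_scheme"
    and L :: "('k, 'l, 'z) module_scheme"
    and s :: "'l \<Rightarrow> 'a" and t :: "'l \<Rightarrow> 'a"
    and \<gamma> :: "'a \<Rightarrow> ('a \<times> 'a \<Rightarrow>\<^sub>0 int) set"
    and \<pi> :: "'a \<Rightarrow> 'l"
  assumes total_algebra: "k_algebra K A"
    and base_algebra: "k_algebra K L"
    and source_hom: "s \<in> algebra_homs K L A"
    and target_hom: "t \<in> algebra_homs K (opposite L) A"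
    and source_target_commute: "\<lbrakk>l \<in> carrier L; l' \<in> carrier L\<rbrakk>
      \<Longrightarrow> s l \<otimes>\<^bsub>A\<^esub> t l' = t l' \<otimes>\<^bsub>A\<^esub> s l"
    and coproduct_additive:
      "\<gamma> \<in> hom (add_monoid A) (bialgebroid_tensor A L s t)"
    and coproduct_bimodule: "\<lbrakk>l \<in> carrier L; l' \<in> carrier L; a \<in> carrier A\<rbrakk>
      \<Longrightarrow> \<gamma> (s l \<otimes>\<^bsub>A\<^esub> t l' \<otimes>\<^bsub>A\<^esub> a) =
          lift (bialgebroid_tensor A L s t)
            (\<lambda>(x, y). tensor (bialgebroid_tensor A L s t) (s l \<otimes>\<^bsub>A\<^esub> x, t l' \<otimes>\<^bsub>A\<^esub> y)) (\<gamma> a)"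
    and counit_additive: "\<pi> \<in> hom (add_monoid A) (add_monoid L)"
    and counit_bimodule: "\<lbrakk>l \<in> carrier L; l' \<in> carrier L; a \<in> carrier A\<rbrakk>
      \<Longrightarrow> \<pi> (s l \<otimes>\<^bsub>A\<^esub> t l' \<otimes>\<^bsub>A\<^esub> a) = l \<otimes>\<^bsub>L\<^esub> \<pi> a \<otimes>\<^bsub>L\<^esub> l'"
    and coassociative: "a \<in> carrier A
      \<Longrightarrow> apply_left (bialgebroid_tensor3 A L s t) \<gamma> (\<gamma> a) =
          apply_right (bialgebroid_tensor3 A L s t) \<gamma> (\<gamma> a)"
    and counit_left: "a \<in> carrier A
      \<Longrightarrow> lift (add_monoid A) (\<lambda>(x, y). s (\<pi> x) \<otimes>\<^bsub>A\<^esub> y) (\<gamma> a) = a"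
    and counit_right: "a \<in> carrier A
      \<Longrightarrow> lift (add_monoid A) (\<lambda>(x, y). t (\<pi> y) \<otimes>\<^bsub>A\<^esub> x) (\<gamma> a) = a"
    and coproduct_takeuchi: "\<lbrakk>l \<in> carrier L; a \<in> carrier A\<rbrakk>
      \<Longrightarrow> lift (bialgebroid_tensor A L s t)
            (\<lambda>(x, y). tensor (bialgebroid_tensor A L s t) (x \<otimes>\<^bsub>A\<^esub> t l, y)) (\<gamma> a) =
          lift (bialgebroid_tensor A L s t)
            (\<lambda>(x, y). tensor (bialgebroid_tensor A L s t) (x, y \<otimes>\<^bsub>A\<^esub> s l)) (\<gamma> a)"
    and coproduct_one: "\<gamma> \<one>\<^bsub>A\<^esub> = tensor (bialgebroid_tensor A L s t) (\<one>\<^bsub>A\<^esub>, \<one>\<^bsub>A\<^esub>)"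
    and coproduct_mult: "\<lbrakk>a \<in> carrier A; a' \<in> carrier A\<rbrakk>
      \<Longrightarrow> \<gamma> (a \<otimes>\<^bsub>A\<^esub> a') = tensor_mult (bialgebroid_tensor A L s t) A (\<gamma> a) (\<gamma> a')"
    and counit_one: "\<pi> \<one>\<^bsub>A\<^esub> = \<one>\<^bsub>L\<^esub>"
    and counit_source: "\<lbrakk>a \<in> carrier A; a' \<in> carrier A\<rbrakk>
      \<Longrightarrow> \<pi> (a \<otimes>\<^bsub>A\<^esub> s (\<pi> a')) = \<pi> (a \<otimes>\<^bsub>A\<^esub> a')"
    and counit_target: "\<lbrakk>a \<in> carrier A; a' \<in> carrier A\<rbrakk>
      \<Longrightarrow> \<pi> (a \<otimes>\<^bsub>A\<^esub> t (\<pi> a')) = \<pi> (a \<otimes>\<^bsub>A\<^esub> a')"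

text \<open>
  Note the exchange of source and target. The tensor square of the underlying left bialgebroid is
  \<open>A\<^sup>R \<otimes> \<^sup>RA\<close>, with \<open>a s(r) \<otimes> b = a \<otimes> b t(r)\<close>.
\<close>

definition right_bialgebroid ::
    "('k, 'x) ring_scheme \<Rightarrow> ('k, 'a, 'y) module_scheme \<Rightarrow> ('k, 'r, 'z) module_scheme \<Rightarrow>
     ('r \<Rightarrow> 'a) \<Rightarrow> ('r \<Rightarrow> 'a) \<Rightarrow> ('a \<Rightarrow> ('a \<times> 'a \<Rightarrow>\<^sub>0 int) set) \<Rightarrow> ('a \<Rightarrow> 'r) \<Rightarrow> bool"
  where "right_bialgebroid K A R s t \<gamma> \<pi> \<longleftrightarrow> left_bialgebroid K (opposite A) R t s \<gamma> \<pi>"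

section \<open>Hopf algebroids\<close>

text \<open>\<open>A\<^sub>L \<otimes> \<^sub>LA\<^sup>R \<otimes> \<^sup>RA\<close> and \<open>A\<^sup>R \<otimes> \<^sup>RA\<^sub>L \<otimes> \<^sub>LA\<close>.\<close>

definition mixed_tensor_LR ::
    "('a, 'x) ring_scheme \<Rightarrow> ('l, 'y) ring_scheme \<Rightarrow> ('l \<Rightarrow> 'a) \<Rightarrow> ('l \<Rightarrow> 'a) \<Rightarrow>
     ('r, 'z) ring_scheme \<Rightarrow> ('r \<Rightarrow> 'a) \<Rightarrow> ('r \<Rightarrow> 'a) \<Rightarrow> ('a \<times> 'a \<times> 'a \<Rightarrow>\<^sub>0 int) set monoid"
  where "mixed_tensor_LR A L s\<^sub>L t\<^sub>L R s\<^sub>R t\<^sub>R = tensor_product3 A A A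
    (carrier L) (\<lambda>l x. t\<^sub>L l \<otimes>\<^bsub>A\<^esub> x) (\<lambda>l y. s\<^sub>L l \<otimes>\<^bsub>A\<^esub> y)
    (carrier R) (\<lambda>r y. y \<otimes>\<^bsub>A\<^esub> s\<^sub>R r) (\<lambda>r z. z \<otimes>\<^bsub>A\<^esub> t\<^sub>R r)"

definition mixed_tensor_RL ::
    "('a, 'x) ring_scheme \<Rightarrow> ('l, 'y) ring_scheme \<Rightarrow> ('l \<Rightarrow> 'a) \<Rightarrow> ('l \<Rightarrow> 'a) \<Rightarrow>
     ('r, 'z) ring_scheme \<Rightarrow> ('r \<Rightarrow> 'a) \<Rightarrow> ('r \<Rightarrow> 'a) \<Rightarrow> ('a \<times> 'a \<times> 'a \<Rightarrow>\<^sub>0 int) set monoid"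
  where "mixed_tensor_RL A L s\<^sub>L t\<^sub>L R s\<^sub>R t\<^sub>R = tensor_product3 A A A
    (carrier R) (\<lambda>r x. x \<otimes>\<^bsub>A\<^esub> s\<^sub>R r) (\<lambda>r y. y \<otimes>\<^bsub>A\<^esub> t\<^sub>R r)
    (carrier L) (\<lambda>l y. t\<^sub>L l \<otimes>\<^bsub>A\<^esub> y) (\<lambda>l z. s\<^sub>L l \<otimes>\<^bsub>A\<^esub> z)"

locale hopf_algebroid =
  fixes K :: "('k, 'x) ring_scheme"
    and A :: "('k, 'a, 'y) module_scheme"
    and L :: "('k, 'l, 'z) module_scheme"
    and s\<^sub>L :: "'l \<Rightarrow> 'a" and t\<^sub>L :: "'l \<Rightarrow> 'a"
    and \<gamma>\<^sub>L :: "'a \<Rightarrow> ('a \<times> 'a \<Rightarrow>\<^sub>0 int) set" and \<pi>\<^sub>L :: "'a \<Rightarrow> 'l"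
    and R :: "('k, 'r, 'w) module_scheme"
    and s\<^sub>R :: "'r \<Rightarrow> 'a" and t\<^sub>R :: "'r \<Rightarrow> 'a"
    and \<gamma>\<^sub>R :: "'a \<Rightarrow> ('a \<times> 'a \<Rightarrow>\<^sub>0 int) set" and \<pi>\<^sub>R :: "'a \<Rightarrow> 'r"
    and S :: "'a \<Rightarrow> 'a"
  assumes left_bialgebroid: "left_bialgebroid K A L s\<^sub>L t\<^sub>L \<gamma>\<^sub>L \<pi>\<^sub>L"
    and right_bialgebroid: "right_bialgebroid K A R s\<^sub>R t\<^sub>R \<gamma>\<^sub>R \<pi>\<^sub>R"
    and antipode_linear: "S \<in> linear_maps K A A"
    and sL_piL_tR: "r \<in> carrier R \<Longrightarrow> s\<^sub>L (\<pi>\<^sub>L (t\<^sub>R r)) = t\<^sub>R r"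
    and tL_piL_sR: "r \<in> carrier R \<Longrightarrow> t\<^sub>L (\<pi>\<^sub>L (s\<^sub>R r)) = s\<^sub>R r"
    and sR_piR_tL: "l \<in> carrier L \<Longrightarrow> s\<^sub>R (\<pi>\<^sub>R (t\<^sub>L l)) = t\<^sub>L l"
    and tR_piR_sL: "l \<in> carrier L \<Longrightarrow> t\<^sub>R (\<pi>\<^sub>R (s\<^sub>L l)) = s\<^sub>L l"
    and mixed_coassociative_LR: "a \<in> carrier A
      \<Longrightarrow> apply_left (mixed_tensor_LR A L s\<^sub>L t\<^sub>L R s\<^sub>R t\<^sub>R) \<gamma>\<^sub>L (\<gamma>\<^sub>R a) =
          apply_right (mixed_tensor_LR A L s\<^sub>L t\<^sub>L R s\<^sub>R t\<^sub>R) \<gamma>\<^sub>R (\<gamma>\<^sub>L a)"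
    and mixed_coassociative_RL: "a \<in> carrier A
      \<Longrightarrow> apply_left (mixed_tensor_RL A L s\<^sub>L t\<^sub>L R s\<^sub>R t\<^sub>R) \<gamma>\<^sub>R (\<gamma>\<^sub>L a) =
          apply_right (mixed_tensor_RL A L s\<^sub>L t\<^sub>L R s\<^sub>R t\<^sub>R) \<gamma>\<^sub>L (\<gamma>\<^sub>R a)"
    and antipode_tL: "\<lbrakk>l \<in> carrier L; l' \<in> carrier L; a \<in> carrier A\<rbrakk>
      \<Longrightarrow> S (t\<^sub>L l' \<otimes>\<^bsub>A\<^esub> a \<otimes>\<^bsub>A\<^esub> t\<^sub>L l) = s\<^sub>L l \<otimes>\<^bsub>A\<^esub> S a \<otimes>\<^bsub>A\<^esub> s\<^sub>L l'"
    and antipode_tR: "\<lbrakk>r \<in> carrier R; r' \<in> carrier R; a \<in> carrier A\<rbrakk>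
      \<Longrightarrow> S (t\<^sub>R r' \<otimes>\<^bsub>A\<^esub> a \<otimes>\<^bsub>A\<^esub> t\<^sub>R r) = s\<^sub>R r \<otimes>\<^bsub>A\<^esub> S a \<otimes>\<^bsub>A\<^esub> s\<^sub>R r'"
    and antipode_left: "a \<in> carrier A
      \<Longrightarrow> lift (add_monoid A) (\<lambda>(x, y). S x \<otimes>\<^bsub>A\<^esub> y) (\<gamma>\<^sub>L a) = s\<^sub>R (\<pi>\<^sub>R a)"
    and antipode_right: "a \<in> carrier A
      \<Longrightarrow> lift (add_monoid A) (\<lambda>(x, y). x \<otimes>\<^bsub>A\<^esub> S y) (\<gamma>\<^sub>R a) = s\<^sub>L (\<pi>\<^sub>L a)"

definition left_integrals :: "('a, 'x) ring_scheme \<Rightarrow> ('l \<Rightarrow> 'a) \<Rightarrow> ('a \<Rightarrow> 'l) \<Rightarrow> 'a set"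
  where "left_integrals A s\<^sub>L \<pi>\<^sub>L =
    {i \<in> carrier A. \<forall>a\<in>carrier A. a \<otimes>\<^bsub>A\<^esub> i = s\<^sub>L (\<pi>\<^sub>L a) \<otimes>\<^bsub>A\<^esub> i}"

definition right_integrals :: "('a, 'x) ring_scheme \<Rightarrow> ('r \<Rightarrow> 'a) \<Rightarrow> ('a \<Rightarrow> 'r) \<Rightarrow> 'a set"
  where "right_integrals A s\<^sub>R \<pi>\<^sub>R =
    {p \<in> carrier A. \<forall>a\<in>carrier A. p \<otimes>\<^bsub>A\<^esub> a = p \<otimes>\<^bsub>A\<^esub> s\<^sub>R (\<pi>\<^sub>R a)}"

text \<open>\<open>L\<close> with \<open>a \<cdot> l = \<pi>\<^sub>L(a s\<^sub>L(l))\<close>, and \<open>R\<close> with \<open>r \<cdot> a = \<pi>\<^sub>R(s\<^sub>R(r) a)\<close>.\<close>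

definition left_base_module ::
    "('a, 'x) ring_scheme \<Rightarrow> ('l, 'y) ring_scheme \<Rightarrow> ('l \<Rightarrow> 'a) \<Rightarrow> ('a \<Rightarrow> 'l) \<Rightarrow> ('a, 'l) module"
  where "left_base_module A L s\<^sub>L \<pi>\<^sub>L = with_action L (\<lambda>a l. \<pi>\<^sub>L (a \<otimes>\<^bsub>A\<^esub> s\<^sub>L l))"

definition right_base_module ::
    "('a, 'x) ring_scheme \<Rightarrow> ('r, 'y) ring_scheme \<Rightarrow> ('r \<Rightarrow> 'a) \<Rightarrow> ('a \<Rightarrow> 'r) \<Rightarrow> ('a, 'r) module"
  where "right_base_module A R s\<^sub>R \<pi>\<^sub>R = with_action R (\<lambda>a r. \<pi>\<^sub>R (s\<^sub>R r \<otimes>\<^bsub>A\<^esub> a))"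

section \<open>Separable and semi-simple extensions\<close>

text \<open>\<open>A \<otimes>\<^sub>B A\<close> for an algebra map \<open>\<iota> : B \<rightarrow> A\<close>, with \<open>a \<iota>(b) \<otimes> a' = a \<otimes> \<iota>(b) a'\<close>.\<close>

definition extension_tensor ::
    "('b, 'x) ring_scheme \<Rightarrow> ('a, 'y) ring_scheme \<Rightarrow> ('b \<Rightarrow> 'a) \<Rightarrow> ('a \<times> 'a \<Rightarrow>\<^sub>0 int) set monoid"
  where "extension_tensor B A \<iota> =
    tensor_product A A (carrier B) (\<lambda>b x. x \<otimes>\<^bsub>A\<^esub> \<iota> b) (\<lambda>b y. \<iota> b \<otimes>\<^bsub>A\<^esub> y)"

definition separable_extension ::
    "('b, 'x) ring_scheme \<Rightarrow> ('a, 'y) ring_scheme \<Rightarrow> ('b \<Rightarrow> 'a) \<Rightarrow> bool"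
  where "separable_extension B A \<iota> \<longleftrightarrow>
    (\<exists>\<sigma> \<in> hom (add_monoid A) (extension_tensor B A \<iota>).
      (\<forall>a\<in>carrier A. \<forall>x\<in>carrier A. \<forall>a'\<in>carrier A.
        \<sigma> (a \<otimes>\<^bsub>A\<^esub> x \<otimes>\<^bsub>A\<^esub> a') =
        lift (extension_tensor B A \<iota>)
          (\<lambda>(u, v). tensor (extension_tensor B A \<iota>) (a \<otimes>\<^bsub>A\<^esub> u, v \<otimes>\<^bsub>A\<^esub> a')) (\<sigma> x)) \<and>
      (\<forall>x\<in>carrier A. lift (add_monoid A) (\<lambda>(u, v). u \<otimes>\<^bsub>A\<^esub> v) (\<sigma> x) = x))"

definition splits_over ::
    "('a, 'x) ring_scheme \<Rightarrow> ('a, 'n, 'y) module_scheme \<Rightarrow> ('a, 'm, 'z) module_scheme \<Rightarrow>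
     ('n \<Rightarrow> 'm) \<Rightarrow> bool"
  where "splits_over A N M f \<longleftrightarrow> (\<exists>g \<in> linear_maps A M N. \<forall>x\<in>carrier M. f (g x) = x)"

text \<open>
  HOL cannot quantify over types inside a formula, so both the modules \<open>M\<close> and the sources \<open>N\<close> of
  the epimorphisms onto them range over all modules with carrier a subset of one type \<open>'m\<close>, the
  universe. A universe of the form \<open>'a + 'u\<close>, with \<open>'a\<close> the type of the algebra \<open>A\<close> and \<open>'u\<close> an
  arbitrary type, contains a copy of \<open>A\<close> and of every module with carrier in \<open>'u\<close>.
\<close>

definition relatively_projective ::
    "('b, 'x) ring_scheme \<Rightarrow> ('a, 'y) ring_scheme \<Rightarrow> ('b \<Rightarrow> 'a) \<Rightarrow> ('a, 'm) module \<Rightarrow> bool"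
  where "relatively_projective B A \<iota> M \<longleftrightarrow>
    (\<forall>(N :: ('a, 'm) module) f.
      left_module A N \<longrightarrow> f \<in> linear_maps A N M \<longrightarrow> f ` carrier N = carrier M \<longrightarrow>
      splits_over B (restrict_scalars \<iota> N) (restrict_scalars \<iota> M) f \<longrightarrow>
      splits_over A N M f)"

definition left_semisimple_extension ::
    "'m itself \<Rightarrow> ('b, 'x) ring_scheme \<Rightarrow> ('a, 'y) ring_scheme \<Rightarrow> ('b \<Rightarrow> 'a) \<Rightarrow> bool"
  where "left_semisimple_extension _ B A \<iota> \<longleftrightarrow>
    (\<forall>M :: ('a, 'm) module. left_module A M \<longrightarrow> relatively_projective B A \<iota> M)"

text \<open>Right modules over \<open>B \<rightarrow> A\<close> are left modules over \<open>opposite B \<rightarrow> opposite A\<close>.\<close>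

definition right_semisimple_extension ::
    "'m itself \<Rightarrow> ('b, 'x) ring_scheme \<Rightarrow> ('a, 'y) ring_scheme \<Rightarrow> ('b \<Rightarrow> 'a) \<Rightarrow> bool"
  where "right_semisimple_extension _ B A \<iota> \<longleftrightarrow>
    left_semisimple_extension TYPE('m) (opposite B) (opposite A) \<iota>"

end

theory Submission
  imports Defs
begin

text \<open>
  A left integral \<open>i\<close> with \<open>\<pi>\<^sub>L i = 1\<close> gives the separability idempotent \<open>i\<^sup>(\<^sup>1\<^sup>) \<otimes> S(i\<^sup>(\<^sup>2\<^sup>))\<close> of
  \<open>s\<^sub>R : R \<rightarrow> A\<close>. Its centrality rests on \<open>S(b\<^sub>(\<^sub>1\<^sub>) y) b\<^sub>(\<^sub>2\<^sub>) = S(y) s\<^sub>R(\<pi>\<^sub>R b)\<close>, which follows from mixed coassociativity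
  and needs neither bijectivity nor antimultiplicativity of \<open>S\<close>. The mirror image of the argument turns a
  normalized right integral into a separability idempotent of \<open>s\<^sub>L : L \<rightarrow> A\<close>. Since \<open>s\<^sub>L, t\<^sub>R\<close> have the same
  range, and so do \<open>t\<^sub>L, s\<^sub>R\<close>, this covers all four extensions. Separable extensions are semisimple on both
  sides, the counits are epimorphisms split by the source and target maps, and an \<open>A\<close>-linear splitting of
  a counit is determined by a normalized integral, its value at 1.
\<close>

section \<open>Sums over lists\<close>

text \<open>Sweedler notation cannot be taken literally here: tensors are cosets, and
  \<open>lift\<close> returns a meaningful value only for maps that respect the relators. Since
  every tensor is a sum of pure tensors, a list of pairs stands for it; lists allow repetitions and
  need no coefficients, because a sign can be moved into a factor. The lists chosen for coproducts
  do not depend additively on the element, so each axiom becomes an equality of represented tensors,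
  and a computation evaluates both sides under a suitable balanced map. Choosing that map and
  verifying its balancedness is the content of most steps.

  For an ordinary Hopf algebra the identity for S(b_(1) y) b_(2) is read off from S(b_(1) y) = S(y)
  S(b_(1)). Here it comes from the argument that proves convolution inverses unique, with
  \<open>b\<close> carried along as a parameter: a coproduct over \<open>L\<close> is cancelled
  against one over \<open>R\<close>, which is why the mixed threefold products enter.\<close>

primrec list_sum :: "('c, 'z) monoid_scheme \<Rightarrow> ('x \<Rightarrow> 'c) \<Rightarrow> 'x list \<Rightarrow> 'c" where
  "list_sum G f [] = \<one>\<^bsub>G\<^esub>"
| "list_sum G f (x # xs) = f x \<otimes>\<^bsub>G\<^esub> list_sum G f xs"

lemma list_sum_cong:
  "(\<And>x. x \<in> set xs \<Longrightarrow> f x = g x) \<Longrightarrow> list_sum G f xs = list_sum G g xs"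
  by (induction xs) auto

lemma list_sum_map: "list_sum G f (map g xs) = list_sum G (\<lambda>x. f (g x)) xs"
  by (induction xs) auto

context monoid
begin

lemma list_sum_closed:
  "(\<And>x. x \<in> set xs \<Longrightarrow> f x \<in> carrier G) \<Longrightarrow> list_sum G f xs \<in> carrier G"
  by (induction xs) auto

lemma list_sum_append:
  assumes "\<And>x. x \<in> set xs \<union> set ys \<Longrightarrow> f x \<in> carrier G"
  shows "list_sum G f (xs @ ys) = list_sum G f xs \<otimes> list_sum G f ys"
  using assms by (induction xs) (auto simp: list_sum_closed m_assoc)

lemma list_sum_concat_map:
  assumes "\<And>x y. \<lbrakk>x \<in> set xs; y \<in> set (F x)\<rbrakk> \<Longrightarrow> f y \<in> carrier G"
  shows "list_sum G f (concat (map F xs)) = list_sum G (\<lambda>x. list_sum G f (F x)) xs"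
  using assms
proof (induction xs)
  case (Cons a xs)
  have "list_sum G f (F a @ concat (map F xs)) = list_sum G f (F a) \<otimes> list_sum G f (concat (map F xs))"
    by (rule list_sum_append) (use Cons.prems in auto)
  also have "list_sum G f (concat (map F xs)) = list_sum G (\<lambda>x. list_sum G f (F x)) xs"
    by (rule Cons.IH) (use Cons.prems in auto)
  finally show ?case
    by simp
qed auto

lemma list_sum_one: "(\<And>x. x \<in> set xs \<Longrightarrow> f x = \<one>) \<Longrightarrow> list_sum G f xs = \<one>"
  by (induction xs) auto

end

context comm_monoid
begin

lemma list_sum_mult:
  assumes "\<And>x. x \<in> set xs \<Longrightarrow> f x \<in> carrier G" "\<And>x. x \<in> set xs \<Longrightarrow> g x \<in> carrier G"
  shows "list_sum G (\<lambda>x. f x \<otimes> g x) xs = list_sum G f xs \<otimes> list_sum G g xs"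
  using assms by (induction xs) (auto simp: list_sum_closed m_ac)

lemma list_sum_swap:
  assumes "\<And>x y. \<lbrakk>x \<in> set xs; y \<in> set ys\<rbrakk> \<Longrightarrow> f x y \<in> carrier G"
  shows "list_sum G (\<lambda>x. list_sum G (f x) ys) xs = list_sum G (\<lambda>y. list_sum G (\<lambda>x. f x y) xs) ys"
  using assms
proof (induction xs)
  case Nil
  then show ?case by (simp add: list_sum_one)
next
  case (Cons a xs)
  then show ?case
    by (simp add: list_sum_mult list_sum_closed)
qed

end

lemma hom_list_sum:
  assumes "h \<in> hom G H" "group G" "group H" "\<And>x. x \<in> set xs \<Longrightarrow> f x \<in> carrier G"
  shows "h (list_sum G f xs) = list_sum H (\<lambda>x. h (f x)) xs"
  using assms(4)
proof (induction xs)
  case Nil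
  then show ?case
    using assms(1-3) by (simp add: hom_one)
next
  case (Cons a xs)
  then show ?case
    using hom_mult[OF assms(1)] group.is_monoid[OF assms(2)]
    by (simp add: monoid.list_sum_closed)
qed

section \<open>Presented groups\<close>

text \<open>The formula is the one inside \<open>lift\<close>, before the passage to cosets. All
  three of \<open>c\<close>, \<open>d\<close> and \<open>c + d\<close> can be evaluated over the
  union of the supports of \<open>c\<close> and \<open>d\<close>, because a key outside a support
  contributes a zeroth power.\<close>

lemma (in comm_group) finprod_extension_hom:
  assumes "f \<in> X \<rightarrow> carrier G"
  shows "(\<lambda>c::'x \<Rightarrow>\<^sub>0 int. finprod G (\<lambda>x. f x [^] Poly_Mapping.lookup c x) (Poly_Mapping.keys c))
      \<in> hom (free_Abelian_group X) G" (is "?h \<in> _")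
proof (rule homI)
  show "?h c \<in> carrier G" if "c \<in> carrier (free_Abelian_group X)" for c
    using that assms by (intro finprod_closed) auto
  have ext: "?h c = finprod G (\<lambda>x. f x [^] Poly_Mapping.lookup c x) F"
    if "Poly_Mapping.keys c \<subseteq> F" "F \<subseteq> X" "finite F" for c F
    using that assms
    by (intro finprod_mono_neutral_cong_left) (auto simp: in_keys_iff)
  fix c d
  assume "c \<in> carrier (free_Abelian_group X)" "d \<in> carrier (free_Abelian_group X)"
  then have sub: "Poly_Mapping.keys c \<union> Poly_Mapping.keys d \<subseteq> X" (is "?F \<subseteq> X")
    by auto
  have "?h (c + d) = finprod G (\<lambda>x. f x [^] Poly_Mapping.lookup (c + d) x) ?F"
    by (rule ext) (use sub keys_add[of c d] in auto)
  also have "\<dots> = finprod G (\<lambda>x. f x [^] Poly_Mapping.lookup c x \<otimes> f x [^] Poly_Mapping.lookup d x) ?F"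
    using assms sub
    by (intro finprod_cong) (auto simp: simp_implies_def Poly_Mapping.lookup_add int_pow_mult Pi_iff)
  also have "\<dots> = ?h c \<otimes> ?h d"
    using assms sub by (subst finprod_multf) (auto simp: ext[of _ ?F])
  finally show "?h (c \<otimes>\<^bsub>free_Abelian_group X\<^esub> d) = ?h c \<otimes> ?h d"
    by simp
qed

lemma (in comm_group) finprod_extension_frag_of:
  assumes "f x \<in> carrier G"
  shows "finprod G (\<lambda>y. f y [^] Poly_Mapping.lookup (frag_of x) y) (Poly_Mapping.keys (frag_of x)) = f x"
proof -
  have "finprod G (\<lambda>y. f y [^] Poly_Mapping.lookup (frag_of x) y) {x} = f x"
    using assms by (subst finprod_insert) auto
  then show ?thesis
    by (simp add: keys_frag_of)
qed

locale presentation =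
  fixes X :: "'x set" and rels :: "('x \<Rightarrow>\<^sub>0 int) set"
  assumes rels_carrier: "rels \<subseteq> carrier (free_Abelian_group X)"
begin

abbreviation (input) P where "P \<equiv> presented_group X rels"
abbreviation (input) N where "N \<equiv> generate (free_Abelian_group X) rels"

sublocale free: comm_group "free_Abelian_group X"
  by (rule abelian_free_Abelian_group)

lemma relators_normal: "N \<lhd> free_Abelian_group X"
  using free.generate_is_subgroup[OF rels_carrier] free.subgroup_imp_normal by blast

lemma comm_group_presented_group: "comm_group P"
  unfolding presented_group_def
  using free.generate_is_subgroup[OF rels_carrier] by (rule free.abelian_FactGroup)

lemma tensor_eq_coset: "tensor P x = N #>\<^bsub>free_Abelian_group X\<^esub> frag_of x"
  by (auto simp: tensor_def presented_group_def r_coset_def)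

lemma coset_hom:
  "(\<lambda>c. N #>\<^bsub>free_Abelian_group X\<^esub> c) \<in> hom (free_Abelian_group X) P"
  unfolding presented_group_def using relators_normal by (rule normal.r_coset_hom_Mod)

lemma tensor_closed: "x \<in> X \<Longrightarrow> tensor P x \<in> carrier P"
  using hom_in_carrier[OF coset_hom] by (simp add: tensor_eq_coset)

text \<open>\<open>rel\<close> speaks of an arbitrary homomorphism with the prescribed values on
  generators, so that users never meet the \<open>finprod\<close> formula. Once the canonical
  extension kills \<open>rels\<close> it is constant on cosets of the subgroup they generate; the
  image of a coset is then a singleton, as \<open>the_elem\<close> in \<open>lift\<close>
  requires.\<close>

lemma lift_properties:
  fixes G :: "('c, 'z) monoid_scheme"
  assumes "comm_group G" and f: "f \<in> X \<rightarrow> carrier G"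
    and rel: "\<And>h c. \<lbrakk>h \<in> hom (free_Abelian_group X) G; \<And>x. x \<in> X \<Longrightarrow> h (frag_of x) = f x; c \<in> rels\<rbrakk>
      \<Longrightarrow> h c = \<one>\<^bsub>G\<^esub>"
  shows lift_hom: "lift G f \<in> hom P G"
    and lift_tensor: "x \<in> X \<Longrightarrow> lift G f (tensor P x) = f x"
proof -
  interpret G: comm_group G by fact
  define h where "h c = finprod G (\<lambda>x. f x [^]\<^bsub>G\<^esub> Poly_Mapping.lookup c x) (Poly_Mapping.keys c)"
    for c :: "'x \<Rightarrow>\<^sub>0 int"
  have h: "h \<in> hom (free_Abelian_group X) G"
    using G.finprod_extension_hom[OF f] by (simp add: h_def[abs_def])
  have h_of: "h (frag_of x) = f x" if "x \<in> X" for x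
    unfolding h_def by (rule G.finprod_extension_frag_of) (use f that in auto)
  interpret h: group_hom "free_Abelian_group X" G h
    using h by unfold_locales
  have "rels \<subseteq> kernel (free_Abelian_group X) G h"
    using subsetD[OF rels_carrier] rel[OF h h_of] unfolding kernel_def by blast
  then have N: "N \<subseteq> kernel (free_Abelian_group X) G h"
    using free.generate_subgroup_incl h.subgroup_kernel by blast
  have lift_coset: "lift G f (N #>\<^bsub>free_Abelian_group X\<^esub> c) = h c"
    if "c \<in> carrier (free_Abelian_group X)" for c
  proof -
    have "h ` (N #>\<^bsub>free_Abelian_group X\<^esub> c) = (\<lambda>n. h (n + c)) ` N"
      by (auto simp: r_coset_def image_UN)
    also have "\<dots> = (\<lambda>n. h c) ` N"
    proof (rule image_cong)
      show "h (n + c) = h c" if "n \<in> N" for n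
        using h.hom_mult[of n c] h.hom_closed[of c] that \<open>c \<in> _\<close> N unfolding kernel_def by auto
    qed simp
    also have "\<dots> = {h c}"
      using generate.one[of "free_Abelian_group X" rels] by auto
    finally have "h ` (N #>\<^bsub>free_Abelian_group X\<^esub> c) = {h c}" .
    then show ?thesis
      by (simp add: lift_def h_def)
  qed
  \<comment> \<open>The homomorphism induced on the quotient agrees with \<open>lift G f\<close> on
    the carrier, and membership in \<open>hom\<close> depends only on values there.\<close>
  obtain g where g: "g \<in> hom (free_Abelian_group X Mod N) G"
    "\<And>c. c \<in> carrier (free_Abelian_group X) \<Longrightarrow> g (N #>\<^bsub>free_Abelian_group X\<^esub> c) = h c"
  proof (rule FactGroup_universal[OF h relators_normal])
    fix x y
    assume xy: "x \<in> carrier (free_Abelian_group X)" "y \<in> carrier (free_Abelian_group X)"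
      "N #>\<^bsub>free_Abelian_group X\<^esub> x = N #>\<^bsub>free_Abelian_group X\<^esub> y"
    show "h x = h y"
      using lift_coset[OF xy(1)] lift_coset[OF xy(2)] xy(3) by simp
  qed blast
  have "\<forall>C\<in>carrier P. g C = lift G f C"
    using g(2) lift_coset unfolding presented_group_def carrier_FactGroup by simp
  with g(1) show "lift G f \<in> hom P G"
    using group.hom_restrict[OF comm_group.axioms(2)[OF comm_group_presented_group]]
    unfolding presented_group_def by blast
  show "lift G f (tensor P x) = f x" if "x \<in> X"
    using that lift_coset[of "frag_of x"] h_of[OF that] by (simp add: tensor_eq_coset)
qed

text \<open>A class is an integer combination of generators, while a list has no coefficients.
  Negative ones are absorbed by \<open>neg\<close>; in a tensor product it will be (x, y) \<mapsto>
  (-x, y).\<close>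

lemma presented_group_generators:
  assumes neg: "\<And>x. x \<in> X \<Longrightarrow> neg x \<in> X \<and> tensor P (neg x) = inv\<^bsub>P\<^esub> tensor P x"
    and "C \<in> carrier P"
  shows "\<exists>xs. set xs \<subseteq> X \<and> C = list_sum P (tensor P) xs"
proof -
  interpret P: comm_group P
    by (rule comm_group_presented_group)
  interpret N: group_hom "free_Abelian_group X" P "\<lambda>c. N #>\<^bsub>free_Abelian_group X\<^esub> c"
    using coset_hom by unfold_locales
  have inv_sum: "inv\<^bsub>P\<^esub> list_sum P (tensor P) xs = list_sum P (tensor P) (map neg xs)"
    if "set xs \<subseteq> X" for xs
    using that
    by (induction xs) (auto simp: P.inv_mult P.list_sum_closed tensor_closed neg subset_iff)
  have "\<exists>xs. set xs \<subseteq> X \<and> N #>\<^bsub>free_Abelian_group X\<^esub> c = list_sum P (tensor P) xs"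
    if "Poly_Mapping.keys c \<subseteq> X" for c
    using that
  proof (rule free_Abelian_group_induct)
    show "\<exists>xs. set xs \<subseteq> X \<and> N #>\<^bsub>free_Abelian_group X\<^esub> 0 = list_sum P (tensor P) xs"
      by (rule exI[of _ "[]"]) (use N.hom_one in simp)
  next
    fix x y
    assume keys: "Poly_Mapping.keys x \<subseteq> X" "Poly_Mapping.keys y \<subseteq> X"
      and "\<exists>xs. set xs \<subseteq> X \<and> N #>\<^bsub>free_Abelian_group X\<^esub> x = list_sum P (tensor P) xs"
      and "\<exists>xs. set xs \<subseteq> X \<and> N #>\<^bsub>free_Abelian_group X\<^esub> y = list_sum P (tensor P) xs"
    then obtain xs ys where xs: "set xs \<subseteq> X" "N #>\<^bsub>free_Abelian_group X\<^esub> x = list_sum P (tensor P) xs"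
      and ys: "set ys \<subseteq> X" "N #>\<^bsub>free_Abelian_group X\<^esub> y = list_sum P (tensor P) ys"
      by blast
    have "N #>\<^bsub>free_Abelian_group X\<^esub> (x - y) =
        (N #>\<^bsub>free_Abelian_group X\<^esub> x) \<otimes>\<^bsub>P\<^esub> inv\<^bsub>P\<^esub> (N #>\<^bsub>free_Abelian_group X\<^esub> y)"
      using N.hom_mult[of x "- y"] N.hom_inv[of y] keys by simp
    also have "\<dots> = list_sum P (tensor P) (xs @ map neg ys)"
      using xs ys neg
      by (subst P.list_sum_append) (auto simp: inv_sum tensor_closed subset_iff)
    finally show "\<exists>xs. set xs \<subseteq> X \<and> N #>\<^bsub>free_Abelian_group X\<^esub> (x - y) = list_sum P (tensor P) xs"
      using xs(1) ys(1) neg by (intro exI[of _ "xs @ map neg ys"]) auto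
  next
    fix a
    assume "a \<in> X"
    then show "\<exists>xs. set xs \<subseteq> X \<and> N #>\<^bsub>free_Abelian_group X\<^esub> frag_of a = list_sum P (tensor P) xs"
      by (intro exI[of _ "[a]"]) (simp add: tensor_eq_coset[symmetric] tensor_closed)
  qed
  then show ?thesis
    using assms(2) by (auto simp: presented_group_def carrier_FactGroup)
qed

end

lemma (in comm_group) hom_frag_diff:
  assumes "h \<in> hom (free_Abelian_group X) G" "c \<in> carrier (free_Abelian_group X)"
    "d \<in> carrier (free_Abelian_group X)"
  shows "h (c - d) = h c \<otimes> inv h d"
proof -
  interpret h: group_hom "free_Abelian_group X" G h
    using assms(1) by (intro group_hom.intro group_hom_axioms.intro) (simp_all add: is_group)
  show ?thesis
    using h.hom_mult[of c "- d"] h.hom_inv[of d] assms(2,3) by simp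
qed

lemma (in comm_group) mult_inv_inv_eq_one_iff:
  assumes "x \<in> carrier G" "y \<in> carrier G" "z \<in> carrier G"
  shows "x \<otimes> inv y \<otimes> inv z = \<one> \<longleftrightarrow> x = y \<otimes> z"
proof -
  have "x \<otimes> inv y \<otimes> inv z = \<one> \<longleftrightarrow> x \<otimes> inv y = z"
    using assms inv_solve_right'[of \<one> "x \<otimes> inv y" z] by simp
  also have "\<dots> \<longleftrightarrow> x = y \<otimes> z"
    using assms inv_solve_right'[of z x y] m_comm[of y z] by simp
  finally show ?thesis .
qed

context presentation
begin

lemma relator_coset:
  assumes "c \<in> rels"
  shows "N #>\<^bsub>free_Abelian_group X\<^esub> c = \<one>\<^bsub>P\<^esub>"
proof -
  have "c \<in> N"
    using assms by (rule generate.incl)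
  then show ?thesis
    using free.coset_join2[of c N] free.generate_is_subgroup[OF rels_carrier] assms rels_carrier
    unfolding presented_group_def by auto
qed

lemma tensor_eq_tensor:
  assumes "frag_of x - frag_of y \<in> rels" "x \<in> X" "y \<in> X"
  shows "tensor P x = tensor P y"
proof -
  interpret P: comm_group P
    by (rule comm_group_presented_group)
  have "tensor P x \<otimes>\<^bsub>P\<^esub> inv\<^bsub>P\<^esub> tensor P y = \<one>\<^bsub>P\<^esub>"
    using P.hom_frag_diff[OF coset_hom, of "frag_of x" "frag_of y"] relator_coset[OF assms(1)] assms(2,3)
    by (simp add: tensor_eq_coset)
  then show ?thesis
    using P.inv_solve_right'[of "\<one>\<^bsub>P\<^esub>" "tensor P x" "tensor P y"] assms(2,3) tensor_closed by simp
qed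

lemma tensor_eq_tensor_mult:
  assumes "frag_of x - frag_of y - frag_of z \<in> rels" "x \<in> X" "y \<in> X" "z \<in> X"
  shows "tensor P x = tensor P y \<otimes>\<^bsub>P\<^esub> tensor P z"
proof -
  interpret P: comm_group P
    by (rule comm_group_presented_group)
  have "tensor P x \<otimes>\<^bsub>P\<^esub> inv\<^bsub>P\<^esub> tensor P y \<otimes>\<^bsub>P\<^esub> inv\<^bsub>P\<^esub> tensor P z = \<one>\<^bsub>P\<^esub>"
    using P.hom_frag_diff[OF coset_hom, of "frag_of x - frag_of y" "frag_of z"]
      P.hom_frag_diff[OF coset_hom, of "frag_of x" "frag_of y"] relator_coset[OF assms(1)] assms(2-4)
      keys_diff[of "frag_of x" "frag_of y"]
    by (auto simp: tensor_eq_coset keys_frag_of)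
  then show ?thesis
    using P.mult_inv_inv_eq_one_iff assms(2-4) tensor_closed by simp
qed

text \<open>Relators of tensor products have only two shapes: two generators for a balancing
  condition, three for additivity. Each is reduced to an equation between values of
  \<open>f\<close>.\<close>

lemma lift_respects:
  assumes "comm_group G" "h \<in> hom (free_Abelian_group X) G" "\<And>x. x \<in> X \<Longrightarrow> h (frag_of x) = f x"
    "f \<in> X \<rightarrow> carrier G"
  shows "\<lbrakk>x \<in> X; y \<in> X; f x = f y\<rbrakk> \<Longrightarrow> h (frag_of x - frag_of y) = \<one>\<^bsub>G\<^esub>"
    and "\<lbrakk>x \<in> X; y \<in> X; z \<in> X; f x = f y \<otimes>\<^bsub>G\<^esub> f z\<rbrakk>
      \<Longrightarrow> h (frag_of x - frag_of y - frag_of z) = \<one>\<^bsub>G\<^esub>"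
proof -
  interpret G: comm_group G by fact
  note diff = G.hom_frag_diff[OF assms(2)]
  show "h (frag_of x - frag_of y) = \<one>\<^bsub>G\<^esub>" if "x \<in> X" "y \<in> X" "f x = f y"
    using that assms(3,4) diff[of "frag_of x" "frag_of y"] by (auto simp: Pi_iff)
  show "h (frag_of x - frag_of y - frag_of z) = \<one>\<^bsub>G\<^esub>"
    if xyz: "x \<in> X" "y \<in> X" "z \<in> X" and "f x = f y \<otimes>\<^bsub>G\<^esub> f z"
  proof -
    have "frag_of x - frag_of y \<in> carrier (free_Abelian_group X)"
      using xyz keys_diff[of "frag_of x" "frag_of y"] by (auto simp: keys_frag_of)
    moreover have "f x \<in> carrier G" "f y \<in> carrier G" "f z \<in> carrier G"
      using xyz assms(4) by auto
    ultimately show ?thesis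
      using that assms(3) diff[of "frag_of x - frag_of y" "frag_of z"] diff[of "frag_of x" "frag_of y"]
        G.mult_inv_inv_eq_one_iff by simp
  qed
qed

end

section \<open>Balanced maps and tensor products\<close>

text \<open>The target is written multiplicatively because it may be a tensor product, which is a
  \<open>monoid\<close> record, as well as the \<open>add_monoid\<close> of a ring or module.
  Currying makes it possible to freeze one argument of a threefold map.\<close>

definition balanced ::
    "('c, 'z) monoid_scheme \<Rightarrow> ('m, 'x) ring_scheme \<Rightarrow> ('n, 'y) ring_scheme \<Rightarrow>
     'b set \<Rightarrow> ('b \<Rightarrow> 'm \<Rightarrow> 'm) \<Rightarrow> ('b \<Rightarrow> 'n \<Rightarrow> 'n) \<Rightarrow> ('m \<Rightarrow> 'n \<Rightarrow> 'c) \<Rightarrow> bool"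
  where "balanced G M N B \<rho> \<sigma> f \<longleftrightarrow>
    (\<forall>x\<in>carrier M. \<forall>y\<in>carrier N. f x y \<in> carrier G) \<and>
    (\<forall>x\<in>carrier M. \<forall>x'\<in>carrier M. \<forall>y\<in>carrier N. f (x \<oplus>\<^bsub>M\<^esub> x') y = f x y \<otimes>\<^bsub>G\<^esub> f x' y) \<and>
    (\<forall>x\<in>carrier M. \<forall>y\<in>carrier N. \<forall>y'\<in>carrier N. f x (y \<oplus>\<^bsub>N\<^esub> y') = f x y \<otimes>\<^bsub>G\<^esub> f x y') \<and>
    (\<forall>b\<in>B. \<forall>x\<in>carrier M. \<forall>y\<in>carrier N. f (\<rho> b x) y = f x (\<sigma> b y))"

lemma balancedI:
  assumes "\<And>x y. \<lbrakk>x \<in> carrier M; y \<in> carrier N\<rbrakk> \<Longrightarrow> f x y \<in> carrier G"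
    "\<And>x x' y. \<lbrakk>x \<in> carrier M; x' \<in> carrier M; y \<in> carrier N\<rbrakk>
      \<Longrightarrow> f (x \<oplus>\<^bsub>M\<^esub> x') y = f x y \<otimes>\<^bsub>G\<^esub> f x' y"
    "\<And>x y y'. \<lbrakk>x \<in> carrier M; y \<in> carrier N; y' \<in> carrier N\<rbrakk>
      \<Longrightarrow> f x (y \<oplus>\<^bsub>N\<^esub> y') = f x y \<otimes>\<^bsub>G\<^esub> f x y'"
    "\<And>b x y. \<lbrakk>b \<in> B; x \<in> carrier M; y \<in> carrier N\<rbrakk> \<Longrightarrow> f (\<rho> b x) y = f x (\<sigma> b y)"
  shows "balanced G M N B \<rho> \<sigma> f"
  using assms by (auto simp: balanced_def)

lemma balancedD:
  assumes "balanced G M N B \<rho> \<sigma> f"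
  shows "\<lbrakk>x \<in> carrier M; y \<in> carrier N\<rbrakk> \<Longrightarrow> f x y \<in> carrier G"
    "\<lbrakk>x \<in> carrier M; x' \<in> carrier M; y \<in> carrier N\<rbrakk> \<Longrightarrow> f (x \<oplus>\<^bsub>M\<^esub> x') y = f x y \<otimes>\<^bsub>G\<^esub> f x' y"
    "\<lbrakk>x \<in> carrier M; y \<in> carrier N; y' \<in> carrier N\<rbrakk> \<Longrightarrow> f x (y \<oplus>\<^bsub>N\<^esub> y') = f x y \<otimes>\<^bsub>G\<^esub> f x y'"
    "\<lbrakk>b \<in> B; x \<in> carrier M; y \<in> carrier N\<rbrakk> \<Longrightarrow> f (\<rho> b x) y = f x (\<sigma> b y)"
  using assms by (auto simp: balanced_def)

locale tensor_factors = M: abelian_group M + N: abelian_group N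
  for M :: "('m, 'x) ring_scheme" and N :: "('n, 'y) ring_scheme" +
  fixes B :: "'b set" and \<rho> :: "'b \<Rightarrow> 'm \<Rightarrow> 'm" and \<sigma> :: "'b \<Rightarrow> 'n \<Rightarrow> 'n"
  assumes left_closed: "\<lbrakk>b \<in> B; x \<in> carrier M\<rbrakk> \<Longrightarrow> \<rho> b x \<in> carrier M"
    and right_closed: "\<lbrakk>b \<in> B; y \<in> carrier N\<rbrakk> \<Longrightarrow> \<sigma> b y \<in> carrier N"
begin

definition relators :: "('m \<times> 'n \<Rightarrow>\<^sub>0 int) set" where
  "relators =
     {frag_of (x \<oplus>\<^bsub>M\<^esub> x', y) - frag_of (x, y) - frag_of (x', y) | x x' y.
        x \<in> carrier M \<and> x' \<in> carrier M \<and> y \<in> carrier N} \<union>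
     {frag_of (x, y \<oplus>\<^bsub>N\<^esub> y') - frag_of (x, y) - frag_of (x, y') | x y y'.
        x \<in> carrier M \<and> y \<in> carrier N \<and> y' \<in> carrier N} \<union>
     {frag_of (\<rho> b x, y) - frag_of (x, \<sigma> b y) | b x y.
        b \<in> B \<and> x \<in> carrier M \<and> y \<in> carrier N}"

lemma relators_cases:
  assumes "c \<in> relators"
  obtains x x' y where "x \<in> carrier M" "x' \<in> carrier M" "y \<in> carrier N"
      "c = frag_of (x \<oplus>\<^bsub>M\<^esub> x', y) - frag_of (x, y) - frag_of (x', y)"
    | x y y' where "x \<in> carrier M" "y \<in> carrier N" "y' \<in> carrier N"
      "c = frag_of (x, y \<oplus>\<^bsub>N\<^esub> y') - frag_of (x, y) - frag_of (x, y')"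
    | b x y where "b \<in> B" "x \<in> carrier M" "y \<in> carrier N"
      "c = frag_of (\<rho> b x, y) - frag_of (x, \<sigma> b y)"
  using assms unfolding relators_def
  apply (elim UnE CollectE exE conjE)
    apply (rule that(1); assumption)
   apply (rule that(2); assumption)
  apply (rule that(3); assumption)
  done

lemma relatorsI:
  shows "\<lbrakk>x \<in> carrier M; x' \<in> carrier M; y \<in> carrier N\<rbrakk>
      \<Longrightarrow> frag_of (x \<oplus>\<^bsub>M\<^esub> x', y) - frag_of (x, y) - frag_of (x', y) \<in> relators"
    and "\<lbrakk>x \<in> carrier M; y \<in> carrier N; y' \<in> carrier N\<rbrakk>
      \<Longrightarrow> frag_of (x, y \<oplus>\<^bsub>N\<^esub> y') - frag_of (x, y) - frag_of (x, y') \<in> relators"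
    and "\<lbrakk>b \<in> B; x \<in> carrier M; y \<in> carrier N\<rbrakk>
      \<Longrightarrow> frag_of (\<rho> b x, y) - frag_of (x, \<sigma> b y) \<in> relators"
  unfolding relators_def
    apply (intro UnI1 CollectI exI conjI; (rule refl | assumption))
   apply (rule UnI1, intro UnI2 CollectI exI conjI; (rule refl | assumption))
  apply (intro UnI2 CollectI exI conjI; (rule refl | assumption))
  done

sublocale presentation "carrier M \<times> carrier N" relators
proof
  have diff: "c - d \<in> carrier (free_Abelian_group (carrier M \<times> carrier N))"
    if "c \<in> carrier (free_Abelian_group (carrier M \<times> carrier N))"
      "d \<in> carrier (free_Abelian_group (carrier M \<times> carrier N))" for c d
    using that keys_diff[of c d] by auto
  show "relators \<subseteq> carrier (free_Abelian_group (carrier M \<times> carrier N))"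
  proof
    fix c
    assume "c \<in> relators"
    then show "c \<in> carrier (free_Abelian_group (carrier M \<times> carrier N))"
      by (cases rule: relators_cases; hypsubst; intro diff)
        (simp_all add: left_closed right_closed del: carrier_free_Abelian_group_iff)
  qed
qed

abbreviation (input) T where "T \<equiv> tensor_product M N B \<rho> \<sigma>"

lemma tensor_product_eq: "T = presented_group (carrier M \<times> carrier N) relators"
  by (simp add: tensor_product_def relators_def)

lemma comm_group_tensor_product: "comm_group T"
  unfolding tensor_product_eq by (rule comm_group_presented_group)

lemma balanced_tensor: "balanced T M N B \<rho> \<sigma> (\<lambda>x y. tensor T (x, y))"
  unfolding tensor_product_eq
proof (rule balancedI)
  fix x y
  assume "x \<in> carrier M" "y \<in> carrier N"
  then show "tensor (presented_group (carrier M \<times> carrier N) relators) (x, y)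
      \<in> carrier (presented_group (carrier M \<times> carrier N) relators)"
    by (intro tensor_closed) simp
qed (rule tensor_eq_tensor_mult[OF relatorsI(1)] tensor_eq_tensor_mult[OF relatorsI(2)]
    tensor_eq_tensor[OF relatorsI(3)]; simp add: left_closed right_closed)+

lemma balanced_lift:
  fixes G :: "('c, 'z) monoid_scheme"
  assumes G: "comm_group G" and f: "balanced G M N B \<rho> \<sigma> f"
  shows lift_balanced_hom: "lift G (\<lambda>(x, y). f x y) \<in> hom T G"
    and lift_balanced_tensor:
      "\<lbrakk>x \<in> carrier M; y \<in> carrier N\<rbrakk> \<Longrightarrow> lift G (\<lambda>(x, y). f x y) (tensor T (x, y)) = f x y"
proof -
  note f_simps = balancedD[OF f]
  have closed: "(\<lambda>(x, y). f x y) \<in> carrier M \<times> carrier N \<rightarrow> carrier G"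
    using f_simps(1) by auto
  have rel: "h c = \<one>\<^bsub>G\<^esub>"
    if h: "h \<in> hom (free_Abelian_group (carrier M \<times> carrier N)) G"
      "\<And>p. p \<in> carrier M \<times> carrier N \<Longrightarrow> h (frag_of p) = (\<lambda>(x, y). f x y) p" and "c \<in> relators" for h c
    using \<open>c \<in> relators\<close>
    by (cases rule: relators_cases; hypsubst; intro lift_respects[OF G h closed])
      (auto simp: f_simps left_closed right_closed)
  show "lift G (\<lambda>(x, y). f x y) \<in> hom T G"
    unfolding tensor_product_eq by (rule lift_hom[OF G closed]) (rule rel)
  show "\<lbrakk>x \<in> carrier M; y \<in> carrier N\<rbrakk> \<Longrightarrow> lift G (\<lambda>(x, y). f x y) (tensor T (x, y)) = f x y"
    unfolding tensor_product_eq by (subst lift_tensor[OF G closed]) (rule rel, auto)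
qed

lemma lift_balanced_list_sum:
  assumes G: "comm_group G" and f: "balanced G M N B \<rho> \<sigma> f"
    and xs: "set xs \<subseteq> carrier M \<times> carrier N"
  shows "lift G (\<lambda>(x, y). f x y) (list_sum T (tensor T) xs) = list_sum G (\<lambda>(x, y). f x y) xs"
proof -
  interpret T: comm_group T
    by (rule comm_group_tensor_product)
  have "lift G (\<lambda>(x, y). f x y) (list_sum T (tensor T) xs) =
      list_sum G (\<lambda>p. lift G (\<lambda>(x, y). f x y) (tensor T p)) xs"
    using xs tensor_closed
    by (intro hom_list_sum[OF lift_balanced_hom[OF G f] T.is_group comm_group.axioms(2)[OF G]])
      (auto simp: tensor_product_eq)
  also have "\<dots> = list_sum G (\<lambda>(x, y). f x y) xs"
    using xs by (intro list_sum_cong) (auto simp: lift_balanced_tensor[OF G f])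
  finally show ?thesis .
qed

text \<open>The basic inference of the Sweedler calculus: two lists that represent the same tensor
  give the same sum under every balanced map, however different their entries are.\<close>

lemma list_sum_balanced_eq:
  assumes "comm_group G" "balanced G M N B \<rho> \<sigma> f"
    "set xs \<subseteq> carrier M \<times> carrier N" "set ys \<subseteq> carrier M \<times> carrier N"
    "list_sum T (tensor T) xs = list_sum T (tensor T) ys"
  shows "list_sum G (\<lambda>(x, y). f x y) xs = list_sum G (\<lambda>(x, y). f x y) ys"
  using assms lift_balanced_list_sum by metis

lemma tensor_product_list_sum:
  assumes "C \<in> carrier T"
  shows "\<exists>xs. set xs \<subseteq> carrier M \<times> carrier N \<and> C = list_sum T (tensor T) xs"
proof -
  interpret T: comm_group T
    by (rule comm_group_tensor_product)
  note bal = balancedD[OF balanced_tensor]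
  have zero: "tensor T (\<zero>\<^bsub>M\<^esub>, y) = \<one>\<^bsub>T\<^esub>" if "y \<in> carrier N" for y
  proof -
    \<comment> \<open>In a group, an element equal to its own square is the unit.\<close>
    have "tensor T (\<zero>\<^bsub>M\<^esub>, y) \<otimes>\<^bsub>T\<^esub> tensor T (\<zero>\<^bsub>M\<^esub>, y) = tensor T (\<zero>\<^bsub>M\<^esub>, y)"
      using bal(2)[of "\<zero>\<^bsub>M\<^esub>" "\<zero>\<^bsub>M\<^esub>" y] that by simp
    then show ?thesis
      using bal(1)[of "\<zero>\<^bsub>M\<^esub>" y] that by simp
  qed
  have neg: "tensor T (\<ominus>\<^bsub>M\<^esub> x, y) = inv\<^bsub>T\<^esub> tensor T (x, y)"
    if "x \<in> carrier M" "y \<in> carrier N" for x y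
  proof (rule T.inv_equality[symmetric])
    show "tensor T (\<ominus>\<^bsub>M\<^esub> x, y) \<otimes>\<^bsub>T\<^esub> tensor T (x, y) = \<one>\<^bsub>T\<^esub>"
      using bal(2)[of "\<ominus>\<^bsub>M\<^esub> x" x y] that zero[of y] by (simp add: M.l_neg)
  qed (use bal(1) that in simp_all)
  show ?thesis
    unfolding tensor_product_eq
  proof (rule presented_group_generators)
    fix p
    assume "p \<in> carrier M \<times> carrier N"
    then show "(case p of (x, y) \<Rightarrow> (\<ominus>\<^bsub>M\<^esub> x, y)) \<in> carrier M \<times> carrier N \<and>
        tensor (presented_group (carrier M \<times> carrier N) relators) (case p of (x, y) \<Rightarrow> (\<ominus>\<^bsub>M\<^esub> x, y)) =
        inv\<^bsub>presented_group (carrier M \<times> carrier N) relators\<^esub>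
          tensor (presented_group (carrier M \<times> carrier N) relators) p"
      using neg unfolding tensor_product_eq by auto
  qed (use assms in \<open>simp add: tensor_product_eq\<close>)
qed

end

text \<open>Freezing either outer argument leaves a twofold balanced map, so all rules for
  \<open>balanced\<close> remain usable; the clauses about the middle argument alone occur
  twice.\<close>

definition balanced3 ::
    "('c, 'z) monoid_scheme \<Rightarrow> ('m, 'x) ring_scheme \<Rightarrow> ('n, 'y) ring_scheme \<Rightarrow> ('p, 'w) ring_scheme \<Rightarrow>
     'b set \<Rightarrow> ('b \<Rightarrow> 'm \<Rightarrow> 'm) \<Rightarrow> ('b \<Rightarrow> 'n \<Rightarrow> 'n) \<Rightarrow>
     'd set \<Rightarrow> ('d \<Rightarrow> 'n \<Rightarrow> 'n) \<Rightarrow> ('d \<Rightarrow> 'p \<Rightarrow> 'p) \<Rightarrow> ('m \<Rightarrow> 'n \<Rightarrow> 'p \<Rightarrow> 'c) \<Rightarrow> bool"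
  where "balanced3 G M N Q B \<rho> \<sigma> C \<rho>' \<sigma>' f \<longleftrightarrow>
    (\<forall>x\<in>carrier M. balanced G N Q C \<rho>' \<sigma>' (f x)) \<and>
    (\<forall>z\<in>carrier Q. balanced G M N B \<rho> \<sigma> (\<lambda>x y. f x y z))"

locale tensor_factors3 = M: abelian_group M + N: abelian_group N + Q: abelian_group Q
  for M :: "('m, 'x) ring_scheme" and N :: "('n, 'y) ring_scheme" and Q :: "('p, 'z) ring_scheme" +
  fixes B :: "'b set" and \<rho> :: "'b \<Rightarrow> 'm \<Rightarrow> 'm" and \<sigma> :: "'b \<Rightarrow> 'n \<Rightarrow> 'n"
    and C :: "'c set" and \<rho>' :: "'c \<Rightarrow> 'n \<Rightarrow> 'n" and \<sigma>' :: "'c \<Rightarrow> 'p \<Rightarrow> 'p"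
  assumes left_closed: "\<lbrakk>b \<in> B; x \<in> carrier M\<rbrakk> \<Longrightarrow> \<rho> b x \<in> carrier M"
    and middle_closed: "\<lbrakk>b \<in> B; y \<in> carrier N\<rbrakk> \<Longrightarrow> \<sigma> b y \<in> carrier N"
      "\<lbrakk>c \<in> C; y \<in> carrier N\<rbrakk> \<Longrightarrow> \<rho>' c y \<in> carrier N"
    and right_closed: "\<lbrakk>c \<in> C; z \<in> carrier Q\<rbrakk> \<Longrightarrow> \<sigma>' c z \<in> carrier Q"
begin

definition relators :: "('m \<times> 'n \<times> 'p \<Rightarrow>\<^sub>0 int) set" where
  "relators =
     {frag_of (x \<oplus>\<^bsub>M\<^esub> x', y, z) - frag_of (x, y, z) - frag_of (x', y, z) | x x' y z.
        x \<in> carrier M \<and> x' \<in> carrier M \<and> y \<in> carrier N \<and> z \<in> carrier Q} \<union>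
     {frag_of (x, y \<oplus>\<^bsub>N\<^esub> y', z) - frag_of (x, y, z) - frag_of (x, y', z) | x y y' z.
        x \<in> carrier M \<and> y \<in> carrier N \<and> y' \<in> carrier N \<and> z \<in> carrier Q} \<union>
     {frag_of (x, y, z \<oplus>\<^bsub>Q\<^esub> z') - frag_of (x, y, z) - frag_of (x, y, z') | x y z z'.
        x \<in> carrier M \<and> y \<in> carrier N \<and> z \<in> carrier Q \<and> z' \<in> carrier Q} \<union>
     {frag_of (\<rho> b x, y, z) - frag_of (x, \<sigma> b y, z) | b x y z.
        b \<in> B \<and> x \<in> carrier M \<and> y \<in> carrier N \<and> z \<in> carrier Q} \<union>
     {frag_of (x, \<rho>' c y, z) - frag_of (x, y, \<sigma>' c z) | c x y z.
        c \<in> C \<and> x \<in> carrier M \<and> y \<in> carrier N \<and> z \<in> carrier Q}"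

lemma relators_cases:
  assumes "r \<in> relators"
  obtains x x' y z where "x \<in> carrier M" "x' \<in> carrier M" "y \<in> carrier N" "z \<in> carrier Q"
      "r = frag_of (x \<oplus>\<^bsub>M\<^esub> x', y, z) - frag_of (x, y, z) - frag_of (x', y, z)"
    | x y y' z where "x \<in> carrier M" "y \<in> carrier N" "y' \<in> carrier N" "z \<in> carrier Q"
      "r = frag_of (x, y \<oplus>\<^bsub>N\<^esub> y', z) - frag_of (x, y, z) - frag_of (x, y', z)"
    | x y z z' where "x \<in> carrier M" "y \<in> carrier N" "z \<in> carrier Q" "z' \<in> carrier Q"
      "r = frag_of (x, y, z \<oplus>\<^bsub>Q\<^esub> z') - frag_of (x, y, z) - frag_of (x, y, z')"
    | b x y z where "b \<in> B" "x \<in> carrier M" "y \<in> carrier N" "z \<in> carrier Q"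
      "r = frag_of (\<rho> b x, y, z) - frag_of (x, \<sigma> b y, z)"
    | c x y z where "c \<in> C" "x \<in> carrier M" "y \<in> carrier N" "z \<in> carrier Q"
      "r = frag_of (x, \<rho>' c y, z) - frag_of (x, y, \<sigma>' c z)"
  using assms unfolding relators_def
  apply (elim UnE CollectE exE conjE)
      apply (rule that(1); assumption)
     apply (rule that(2); assumption)
    apply (rule that(3); assumption)
   apply (rule that(4); assumption)
  apply (rule that(5); assumption)
  done

lemma relatorsI:
  shows "\<lbrakk>x \<in> carrier M; x' \<in> carrier M; y \<in> carrier N; z \<in> carrier Q\<rbrakk>
      \<Longrightarrow> frag_of (x \<oplus>\<^bsub>M\<^esub> x', y, z) - frag_of (x, y, z) - frag_of (x', y, z) \<in> relators"
    and "\<lbrakk>x \<in> carrier M; y \<in> carrier N; y' \<in> carrier N; z \<in> carrier Q\<rbrakk>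
      \<Longrightarrow> frag_of (x, y \<oplus>\<^bsub>N\<^esub> y', z) - frag_of (x, y, z) - frag_of (x, y', z) \<in> relators"
    and "\<lbrakk>x \<in> carrier M; y \<in> carrier N; z \<in> carrier Q; z' \<in> carrier Q\<rbrakk>
      \<Longrightarrow> frag_of (x, y, z \<oplus>\<^bsub>Q\<^esub> z') - frag_of (x, y, z) - frag_of (x, y, z') \<in> relators"
    and "\<lbrakk>b \<in> B; x \<in> carrier M; y \<in> carrier N; z \<in> carrier Q\<rbrakk>
      \<Longrightarrow> frag_of (\<rho> b x, y, z) - frag_of (x, \<sigma> b y, z) \<in> relators"
    and "\<lbrakk>c \<in> C; x \<in> carrier M; y \<in> carrier N; z \<in> carrier Q\<rbrakk>
      \<Longrightarrow> frag_of (x, \<rho>' c y, z) - frag_of (x, y, \<sigma>' c z) \<in> relators"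
  unfolding relators_def
      apply (intro UnI1 CollectI exI conjI; (rule refl | assumption))
     apply (rule UnI1, rule UnI1, rule UnI1, intro UnI2 CollectI exI conjI; (rule refl | assumption))
    apply (rule UnI1, rule UnI1, intro UnI2 CollectI exI conjI; (rule refl | assumption))
   apply (rule UnI1, intro UnI2 CollectI exI conjI; (rule refl | assumption))
  apply (intro UnI2 CollectI exI conjI; (rule refl | assumption))
  done

sublocale presentation "carrier M \<times> carrier N \<times> carrier Q" relators
proof
  have diff: "c - d \<in> carrier (free_Abelian_group (carrier M \<times> carrier N \<times> carrier Q))"
    if "c \<in> carrier (free_Abelian_group (carrier M \<times> carrier N \<times> carrier Q))"
      "d \<in> carrier (free_Abelian_group (carrier M \<times> carrier N \<times> carrier Q))" for c d
    using that keys_diff[of c d] by auto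
  show "relators \<subseteq> carrier (free_Abelian_group (carrier M \<times> carrier N \<times> carrier Q))"
  proof
    fix c
    assume "c \<in> relators"
    then show "c \<in> carrier (free_Abelian_group (carrier M \<times> carrier N \<times> carrier Q))"
      by (cases rule: relators_cases; hypsubst; intro diff)
        (simp_all add: left_closed middle_closed right_closed del: carrier_free_Abelian_group_iff)
  qed
qed

abbreviation (input) T where "T \<equiv> tensor_product3 M N Q B \<rho> \<sigma> C \<rho>' \<sigma>'"

lemma tensor_product3_eq: "T = presented_group (carrier M \<times> carrier N \<times> carrier Q) relators"
  by (simp add: tensor_product3_def relators_def)

lemma comm_group_tensor_product3: "comm_group T"
  unfolding tensor_product3_eq by (rule comm_group_presented_group)

lemma balanced3_tensor: "balanced3 T M N Q B \<rho> \<sigma> C \<rho>' \<sigma>' (\<lambda>x y z. tensor T (x, y, z))"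
  unfolding tensor_product3_eq balanced3_def
proof (intro conjI ballI balancedI)
  fix x y z
  assume "x \<in> carrier M" "y \<in> carrier N" "z \<in> carrier Q"
  then show "tensor (presented_group (carrier M \<times> carrier N \<times> carrier Q) relators) (x, y, z)
      \<in> carrier (presented_group (carrier M \<times> carrier N \<times> carrier Q) relators)"
    and "tensor (presented_group (carrier M \<times> carrier N \<times> carrier Q) relators) (x, y, z)
      \<in> carrier (presented_group (carrier M \<times> carrier N \<times> carrier Q) relators)"
    by (intro tensor_closed, simp)+
qed (rule tensor_eq_tensor_mult[OF relatorsI(1)] tensor_eq_tensor_mult[OF relatorsI(2)]
    tensor_eq_tensor_mult[OF relatorsI(3)] tensor_eq_tensor[OF relatorsI(4)]
    tensor_eq_tensor[OF relatorsI(5)];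
    simp add: left_closed middle_closed right_closed)+

lemma balanced3_lift:
  fixes G :: "('g, 'v) monoid_scheme"
  assumes G: "comm_group G" and f: "balanced3 G M N Q B \<rho> \<sigma> C \<rho>' \<sigma>' f"
  shows lift_balanced3_hom: "lift G (\<lambda>(x, y, z). f x y z) \<in> hom T G"
    and lift_balanced3_tensor: "\<lbrakk>x \<in> carrier M; y \<in> carrier N; z \<in> carrier Q\<rbrakk>
      \<Longrightarrow> lift G (\<lambda>(x, y, z). f x y z) (tensor T (x, y, z)) = f x y z"
proof -
  have right: "x \<in> carrier M \<Longrightarrow> balanced G N Q C \<rho>' \<sigma>' (f x)"
    and left: "z \<in> carrier Q \<Longrightarrow> balanced G M N B \<rho> \<sigma> (\<lambda>x y. f x y z)" for x z
    using f by (auto simp: balanced3_def)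
  have closed: "(\<lambda>(x, y, z). f x y z) \<in> carrier M \<times> carrier N \<times> carrier Q \<rightarrow> carrier G"
    using balancedD(1)[OF right] by auto
  have rel: "h c = \<one>\<^bsub>G\<^esub>"
    if h: "h \<in> hom (free_Abelian_group (carrier M \<times> carrier N \<times> carrier Q)) G"
      "\<And>p. p \<in> carrier M \<times> carrier N \<times> carrier Q
        \<Longrightarrow> h (frag_of p) = (\<lambda>(x, y, z). f x y z) p" and "c \<in> relators" for h c
    using \<open>c \<in> relators\<close>
    by (cases rule: relators_cases; hypsubst; intro lift_respects[OF G h closed])
      (simp_all add: balancedD(2,3,4)[OF left] balancedD(3,4)[OF right]
        left_closed middle_closed right_closed)
  show "lift G (\<lambda>(x, y, z). f x y z) \<in> hom T G"
    unfolding tensor_product3_eq by (rule lift_hom[OF G closed]) (rule rel)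
  show "\<lbrakk>x \<in> carrier M; y \<in> carrier N; z \<in> carrier Q\<rbrakk> \<Longrightarrow> lift G (\<lambda>(x, y, z). f x y z) (tensor T (x, y, z)) = f x y z"
    unfolding tensor_product3_eq by (subst lift_tensor[OF G closed]) (rule rel, auto)
qed

lemma list_sum_balanced3_eq:
  assumes G: "comm_group G" and f: "balanced3 G M N Q B \<rho> \<sigma> C \<rho>' \<sigma>' f"
    and xs: "set xs \<subseteq> carrier M \<times> carrier N \<times> carrier Q"
    and ys: "set ys \<subseteq> carrier M \<times> carrier N \<times> carrier Q"
    and eq: "list_sum T (tensor T) xs = list_sum T (tensor T) ys"
  shows "list_sum G (\<lambda>(x, y, z). f x y z) xs = list_sum G (\<lambda>(x, y, z). f x y z) ys"
proof -
  interpret T: comm_group T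
    by (rule comm_group_tensor_product3)
  have "lift G (\<lambda>(x, y, z). f x y z) (list_sum T (tensor T) us) = list_sum G (\<lambda>(x, y, z). f x y z) us"
    if us: "set us \<subseteq> carrier M \<times> carrier N \<times> carrier Q" for us
  proof -
    have "lift G (\<lambda>(x, y, z). f x y z) (list_sum T (tensor T) us) =
        list_sum G (\<lambda>p. lift G (\<lambda>(x, y, z). f x y z) (tensor T p)) us"
      using us tensor_closed
      by (intro hom_list_sum[OF lift_balanced3_hom[OF G f] T.is_group comm_group.axioms(2)[OF G]])
        (auto simp: tensor_product3_eq)
    also have "\<dots> = list_sum G (\<lambda>(x, y, z). f x y z) us"
      using us by (intro list_sum_cong) (auto simp: lift_balanced3_tensor[OF G f])
    finally show ?thesis .
  qed
  from this[OF xs] this[OF ys] eq show ?thesis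
    by simp
qed

end

section \<open>Opposite rings\<close>

lemma opposite_simps [simp]:
  "carrier (opposite A) = carrier A" "add (opposite A) = add A" "\<zero>\<^bsub>opposite A\<^esub> = \<zero>\<^bsub>A\<^esub>"
  "\<one>\<^bsub>opposite A\<^esub> = \<one>\<^bsub>A\<^esub>" "x \<otimes>\<^bsub>opposite A\<^esub> y = y \<otimes>\<^bsub>A\<^esub> x" "opposite (opposite A) = A"
  by (simp_all add: opposite_def)

lemma add_monoid_opposite [simp]: "add_monoid (opposite A) = add_monoid A"
  by (simp add: opposite_def)

lemma ring_opposite:
  assumes "ring A"
  shows "ring (opposite A)"
proof -
  interpret ring A by fact
  have "abelian_group (opposite A)"
    by (rule abelian_groupI) (use add.l_inv_ex in \<open>auto simp: a_ac\<close>)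
  moreover have "monoid (opposite A)"
    by (rule monoidI) (auto simp: m_assoc)
  ultimately show ?thesis
    by (rule ringI) (auto simp: l_distr r_distr)
qed

section \<open>Separable extensions\<close>

text \<open>A representative of the value at 1 of a bimodule splitting. The two equations are
  centrality and normalization of a separability idempotent.\<close>

definition casimir_list ::
    "('b, 'x) ring_scheme \<Rightarrow> ('a, 'y) ring_scheme \<Rightarrow> ('b \<Rightarrow> 'a) \<Rightarrow> ('a \<times> 'a) list \<Rightarrow> bool"
  where "casimir_list B A \<iota> es \<longleftrightarrow> set es \<subseteq> carrier A \<times> carrier A \<and>
    (\<forall>a\<in>carrier A.
      list_sum (extension_tensor B A \<iota>) (\<lambda>(u, v). tensor (extension_tensor B A \<iota>) (a \<otimes>\<^bsub>A\<^esub> u, v)) es =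
      list_sum (extension_tensor B A \<iota>) (\<lambda>(u, v). tensor (extension_tensor B A \<iota>) (u, v \<otimes>\<^bsub>A\<^esub> a)) es) \<and>
    list_sum (add_monoid A) (\<lambda>(u, v). u \<otimes>\<^bsub>A\<^esub> v) es = \<one>\<^bsub>A\<^esub>"

lemma (in ring) tensor_factors_extension:
  assumes "\<iota> \<in> carrier B \<rightarrow> carrier R"
  shows "tensor_factors R R (carrier B) (\<lambda>b x. x \<otimes> \<iota> b) (\<lambda>b y. \<iota> b \<otimes> y)"
  by unfold_locales (use assms in auto)

lemma (in ring) list_sum_r_distr:
  assumes "a \<in> carrier R" "\<And>x. x \<in> set xs \<Longrightarrow> f x \<in> carrier R"
  shows "a \<otimes> list_sum (add_monoid R) f xs = list_sum (add_monoid R) (\<lambda>x. a \<otimes> f x) xs"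
  using assms(2) by (induction xs) (auto simp: assms(1) r_distr add.list_sum_closed)

lemma (in ring) list_sum_l_distr:
  assumes "a \<in> carrier R" "\<And>x. x \<in> set xs \<Longrightarrow> f x \<in> carrier R"
  shows "list_sum (add_monoid R) f xs \<otimes> a = list_sum (add_monoid R) (\<lambda>x. f x \<otimes> a) xs"
  using assms(2) by (induction xs) (auto simp: assms(1) l_distr add.list_sum_closed)

locale ring_extension = ring A for A :: "('a, 'y) ring_scheme" (structure) +
  fixes B :: "('b, 'x) ring_scheme" and \<iota> :: "'b \<Rightarrow> 'a"
  assumes structure_closed: "b \<in> carrier B \<Longrightarrow> \<iota> b \<in> carrier A"
begin

sublocale ext: tensor_factors A A "carrier B" "\<lambda>b x. x \<otimes> \<iota> b" "\<lambda>b y. \<iota> b \<otimes> y"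
  by (rule tensor_factors_extension) (use structure_closed in auto)

abbreviation (input) E where "E \<equiv> extension_tensor B A \<iota>"

lemma comm_group_E: "comm_group E"
  unfolding extension_tensor_def by (rule ext.comm_group_tensor_product)

sublocale E: comm_group E
  by (rule comm_group_E)

lemma balanced_E:
  "balanced E A A (carrier B) (\<lambda>b x. x \<otimes> \<iota> b) (\<lambda>b y. \<iota> b \<otimes> y) (\<lambda>x y. tensor E (x, y))"
  unfolding extension_tensor_def by (rule ext.balanced_tensor)

lemma tensor_E:
  "\<lbrakk>x \<in> carrier A; y \<in> carrier A\<rbrakk> \<Longrightarrow> tensor E (x, y) \<in> carrier E"
  "\<lbrakk>x \<in> carrier A; x' \<in> carrier A; y \<in> carrier A\<rbrakk>
    \<Longrightarrow> tensor E (x \<oplus> x', y) = tensor E (x, y) \<otimes>\<^bsub>E\<^esub> tensor E (x', y)"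
  "\<lbrakk>x \<in> carrier A; y \<in> carrier A; y' \<in> carrier A\<rbrakk>
    \<Longrightarrow> tensor E (x, y \<oplus> y') = tensor E (x, y) \<otimes>\<^bsub>E\<^esub> tensor E (x, y')"
  "\<lbrakk>b \<in> carrier B; x \<in> carrier A; y \<in> carrier A\<rbrakk>
    \<Longrightarrow> tensor E (x \<otimes> \<iota> b, y) = tensor E (x, \<iota> b \<otimes> y)"
  using balancedD[OF balanced_E] by auto

lemmas lift_list_sum_E = ext.lift_balanced_list_sum[folded extension_tensor_def]
lemmas list_sum_eq_E = ext.list_sum_balanced_eq[folded extension_tensor_def]
lemmas list_sum_ex_E = ext.tensor_product_list_sum[folded extension_tensor_def]

lemma balanced_two_sided:
  assumes "a \<in> carrier A" "a' \<in> carrier A"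
  shows "balanced E A A (carrier B) (\<lambda>b x. x \<otimes> \<iota> b) (\<lambda>b y. \<iota> b \<otimes> y) (\<lambda>u v. tensor E (a \<otimes> u, v \<otimes> a'))"
proof (rule balancedI)
  fix b x y
  assume "b \<in> carrier B" "x \<in> carrier A" "y \<in> carrier A"
  then show "tensor E (a \<otimes> (x \<otimes> \<iota> b), y \<otimes> a') = tensor E (a \<otimes> x, \<iota> b \<otimes> y \<otimes> a')"
    using assms structure_closed tensor_E(4)[of b "a \<otimes> x" "y \<otimes> a'"] by (simp add: m_assoc)
qed (use assms in \<open>auto simp: tensor_E l_distr r_distr\<close>)

lemma balanced_mult:
  "balanced (add_monoid A) A A (carrier B) (\<lambda>b x. x \<otimes> \<iota> b) (\<lambda>b y. \<iota> b \<otimes> y) (\<lambda>u v. u \<otimes> v)"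
  by (rule balancedI) (auto simp: l_distr r_distr m_assoc structure_closed)

text \<open>A bimodule map on \<open>A\<close> is determined by its value e at 1, and a e = e a
  because both are the value at a. Conversely a \<mapsto> a e is left linear by construction and
  right linear by centrality of e.\<close>

lemma separable_extension_iff_casimir:
  "separable_extension B A \<iota> \<longleftrightarrow> (\<exists>es. casimir_list B A \<iota> es)"
proof
  assume "separable_extension B A \<iota>"
  then obtain \<sigma> where \<sigma>: "\<sigma> \<in> hom (add_monoid A) E"
    and bimod: "\<And>a x a'. \<lbrakk>a \<in> carrier A; x \<in> carrier A; a' \<in> carrier A\<rbrakk>
      \<Longrightarrow> \<sigma> (a \<otimes> x \<otimes> a') = lift E (\<lambda>(u, v). tensor E (a \<otimes> u, v \<otimes> a')) (\<sigma> x)"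
    and split: "\<And>x. x \<in> carrier A \<Longrightarrow> lift (add_monoid A) (\<lambda>(u, v). u \<otimes> v) (\<sigma> x) = x"
    unfolding separable_extension_def by blast
  have "\<sigma> \<one> \<in> carrier E"
    using \<sigma> by (auto simp: hom_def)
  then obtain es where es: "set es \<subseteq> carrier A \<times> carrier A" "\<sigma> \<one> = list_sum E (tensor E) es"
    using list_sum_ex_E by blast
  have \<sigma>_eq: "\<sigma> (a \<otimes> a') = list_sum E (\<lambda>(u, v). tensor E (a \<otimes> u, v \<otimes> a')) es"
    if "a \<in> carrier A" "a' \<in> carrier A" for a a'
    using bimod[of a \<one> a'] that es lift_list_sum_E[OF comm_group_E balanced_two_sided[OF that] es(1)]
    by simp
  have "list_sum E (\<lambda>(u, v). tensor E (a \<otimes> u, v)) es = list_sum E (\<lambda>(u, v). tensor E (u, v \<otimes> a)) es"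
    if a: "a \<in> carrier A" for a
  proof -
    have "list_sum E (\<lambda>(u, v). tensor E (a \<otimes> u, v)) es = \<sigma> (a \<otimes> \<one>)"
      unfolding \<sigma>_eq[OF a one_closed] by (rule list_sum_cong) (use es in auto)
    also have "\<sigma> (a \<otimes> \<one>) = \<sigma> (\<one> \<otimes> a)"
      using a by simp
    also have "\<dots> = list_sum E (\<lambda>(u, v). tensor E (u, v \<otimes> a)) es"
      unfolding \<sigma>_eq[OF one_closed a] by (rule list_sum_cong) (use es in auto)
    finally show ?thesis .
  qed
  moreover have "list_sum (add_monoid A) (\<lambda>(u, v). u \<otimes> v) es = \<one>"
    using split[of \<one>] lift_list_sum_E[OF a_comm_group balanced_mult es(1)] es(2) by simp
  ultimately show "\<exists>es. casimir_list B A \<iota> es"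
    using es(1) unfolding casimir_list_def by blast
next
  assume "\<exists>es. casimir_list B A \<iota> es"
  then obtain es where es: "set es \<subseteq> carrier A \<times> carrier A"
    and casimir: "\<And>a. a \<in> carrier A \<Longrightarrow>
      list_sum E (\<lambda>(u, v). tensor E (a \<otimes> u, v)) es = list_sum E (\<lambda>(u, v). tensor E (u, v \<otimes> a)) es"
    and one: "list_sum (add_monoid A) (\<lambda>(u, v). u \<otimes> v) es = \<one>"
    unfolding casimir_list_def by blast
  define \<sigma> where "\<sigma> a = list_sum E (tensor E) (map (\<lambda>(u, v). (a \<otimes> u, v)) es)" for a
  have set_es: "set (map (\<lambda>(u, v). (a \<otimes> u, v)) es) \<subseteq> carrier A \<times> carrier A" if "a \<in> carrier A" for a
    using es that by auto
  have "\<sigma> \<in> hom (add_monoid A) E"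
  proof (rule homI)
    fix a a'
    assume "a \<in> carrier (add_monoid A)" "a' \<in> carrier (add_monoid A)"
    then have a: "a \<in> carrier A" "a' \<in> carrier A"
      by auto
    show "\<sigma> a \<in> carrier E"
      using set_es[OF a(1)] unfolding \<sigma>_def by (intro E.list_sum_closed) (auto intro: tensor_E)
    have "\<sigma> (a \<oplus> a') = list_sum E
        (\<lambda>p. (case p of (u, v) \<Rightarrow> tensor E (a \<otimes> u, v)) \<otimes>\<^bsub>E\<^esub> (case p of (u, v) \<Rightarrow> tensor E (a' \<otimes> u, v))) es"
      unfolding \<sigma>_def list_sum_map using es a by (intro list_sum_cong) (auto simp: l_distr tensor_E)
    also have "\<dots> = \<sigma> a \<otimes>\<^bsub>E\<^esub> \<sigma> a'"
      unfolding \<sigma>_def list_sum_map using es a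
      by (subst E.list_sum_mult) (auto intro!: tensor_E arg_cong2[where f = "\<lambda>x y. x \<otimes>\<^bsub>E\<^esub> y"] list_sum_cong)
    finally show "\<sigma> (a \<otimes>\<^bsub>add_monoid A\<^esub> a') = \<sigma> a \<otimes>\<^bsub>E\<^esub> \<sigma> a'"
      by simp
  qed
  moreover have "\<sigma> (a \<otimes> x \<otimes> a') = lift E (\<lambda>(u, v). tensor E (a \<otimes> u, v \<otimes> a')) (\<sigma> x)"
    if a: "a \<in> carrier A" "x \<in> carrier A" "a' \<in> carrier A" for a x a'
  proof -
    have "lift E (\<lambda>(u, v). tensor E (a \<otimes> u, v \<otimes> a')) (\<sigma> x) =
        list_sum E (\<lambda>(u, v). tensor E (a \<otimes> x \<otimes> u, v \<otimes> \<one>)) (map (\<lambda>(u, v). (u, v \<otimes> a')) es)"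
      unfolding \<sigma>_def lift_list_sum_E[OF comm_group_E balanced_two_sided[OF a(1,3)] set_es[OF a(2)]]
      unfolding list_sum_map
      using es a by (intro list_sum_cong) (auto simp: m_assoc)
    \<comment> \<open>Centrality for \<open>a'\<close>, evaluated under the balanced map u \<otimes>
      v \<mapsto> axu \<otimes> v: the factor \<open>a'\<close> moves from the right end into the
      middle of the product \<open>a x a' u\<close>.\<close>
    also have "\<dots> = list_sum E (\<lambda>(u, v). tensor E (a \<otimes> x \<otimes> u, v \<otimes> \<one>)) (map (\<lambda>(u, v). (a' \<otimes> u, v)) es)"
    proof (rule list_sum_eq_E[OF comm_group_E balanced_two_sided])
      show "list_sum E (tensor E) (map (\<lambda>(u, v). (u, v \<otimes> a')) es) =
          list_sum E (tensor E) (map (\<lambda>(u, v). (a' \<otimes> u, v)) es)"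
        using casimir[OF a(3)] by (simp add: list_sum_map case_prod_unfold)
    qed (use a es in auto)
    also have "\<dots> = \<sigma> (a \<otimes> x \<otimes> a')"
      unfolding \<sigma>_def list_sum_map using es a by (intro list_sum_cong) (auto simp: m_assoc)
    finally show ?thesis
      by simp
  qed
  moreover have "lift (add_monoid A) (\<lambda>(u, v). u \<otimes> v) (\<sigma> x) = x" if x: "x \<in> carrier A" for x
  proof -
    have "lift (add_monoid A) (\<lambda>(u, v). u \<otimes> v) (\<sigma> x) =
        list_sum (add_monoid A) (\<lambda>p. x \<otimes> (case p of (u, v) \<Rightarrow> u \<otimes> v)) es"
      unfolding \<sigma>_def lift_list_sum_E[OF a_comm_group balanced_mult set_es[OF x]]
      unfolding list_sum_map
      using es x by (intro list_sum_cong) (auto simp: m_assoc)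
    also have "\<dots> = x"
      using es x one by (subst list_sum_r_distr[symmetric]) auto
    finally show ?thesis .
  qed
  ultimately show "separable_extension B A \<iota>"
    unfolding separable_extension_def by blast
qed

text \<open>The flip u \<otimes> v \<mapsto> v \<otimes> u interchanges the two sides of the
  centrality equation, and the opposite product of (v, u) is again uv.\<close>

lemma separable_extension_opposite:
  assumes "separable_extension B A \<iota>"
  shows "separable_extension (opposite B) (opposite A) \<iota>"
proof -
  interpret opp: ring_extension "opposite A" "opposite B" \<iota>
    by (intro ring_extension.intro ring_extension_axioms.intro ring_opposite ring_axioms)
      (simp add: structure_closed)
  obtain es where es: "set es \<subseteq> carrier A \<times> carrier A"
    and casimir: "\<And>a. a \<in> carrier A \<Longrightarrow>
      list_sum E (\<lambda>(u, v). tensor E (a \<otimes> u, v)) es = list_sum E (\<lambda>(u, v). tensor E (u, v \<otimes> a)) es"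
    and one: "list_sum (add_monoid A) (\<lambda>(u, v). u \<otimes> v) es = \<one>"
    using assms unfolding separable_extension_iff_casimir casimir_list_def by blast
  let ?E = "extension_tensor (opposite B) (opposite A) \<iota>"
  have swap: "balanced ?E A A (carrier B) (\<lambda>b x. x \<otimes> \<iota> b) (\<lambda>b y. \<iota> b \<otimes> y) (\<lambda>u v. tensor ?E (v, u))"
    using opp.tensor_E by (intro balancedI) auto
  have "list_sum ?E (\<lambda>(u, v). tensor ?E (v, u)) (map (\<lambda>(u, v). (u, v \<otimes> a)) es) =
      list_sum ?E (\<lambda>(u, v). tensor ?E (v, u)) (map (\<lambda>(u, v). (a \<otimes> u, v)) es)"
    if "a \<in> carrier A" for a
  proof (rule list_sum_eq_E[OF opp.comm_group_E swap])
    show "list_sum E (tensor E) (map (\<lambda>(u, v). (u, v \<otimes> a)) es) =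
        list_sum E (tensor E) (map (\<lambda>(u, v). (a \<otimes> u, v)) es)"
      using casimir[OF that] by (simp add: list_sum_map case_prod_unfold)
  qed (use that es in auto)
  then have "casimir_list (opposite B) (opposite A) \<iota> (map (\<lambda>(u, v). (v, u)) es)"
    using es one unfolding casimir_list_def by (auto simp: list_sum_map case_prod_unfold)
  then show ?thesis
    unfolding opp.separable_extension_iff_casimir by blast
qed

end

section \<open>Semisimple extensions\<close>

lemma with_action_simps [simp]:
  "carrier (with_action M act) = carrier M" "add (with_action M act) = add M"
  "\<zero>\<^bsub>with_action M act\<^esub> = \<zero>\<^bsub>M\<^esub>" "x \<odot>\<^bsub>with_action M act\<^esub> y = act x y"
  by (simp_all add: with_action_def)

lemma linear_mapsI:
  assumes "\<And>x. x \<in> carrier M \<Longrightarrow> f x \<in> carrier N"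
    "\<And>x y. \<lbrakk>x \<in> carrier M; y \<in> carrier M\<rbrakk> \<Longrightarrow> f (x \<oplus>\<^bsub>M\<^esub> y) = f x \<oplus>\<^bsub>N\<^esub> f y"
    "\<And>a x. \<lbrakk>a \<in> carrier A; x \<in> carrier M\<rbrakk> \<Longrightarrow> f (a \<odot>\<^bsub>M\<^esub> x) = a \<odot>\<^bsub>N\<^esub> f x"
  shows "f \<in> linear_maps A M N"
  using assms by (auto simp: linear_maps_def hom_def)

lemma linear_mapsD:
  assumes "f \<in> linear_maps A M N"
  shows "x \<in> carrier M \<Longrightarrow> f x \<in> carrier N"
    "\<lbrakk>x \<in> carrier M; y \<in> carrier M\<rbrakk> \<Longrightarrow> f (x \<oplus>\<^bsub>M\<^esub> y) = f x \<oplus>\<^bsub>N\<^esub> f y"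
    "\<lbrakk>a \<in> carrier A; x \<in> carrier M\<rbrakk> \<Longrightarrow> f (a \<odot>\<^bsub>M\<^esub> x) = a \<odot>\<^bsub>N\<^esub> f x"
  using assms by (auto simp: linear_maps_def hom_def Pi_iff)

lemma restrict_scalars_simps [simp]:
  "carrier (restrict_scalars \<iota> M) = carrier M" "add (restrict_scalars \<iota> M) = add M"
  "b \<odot>\<^bsub>restrict_scalars \<iota> M\<^esub> x = \<iota> b \<odot>\<^bsub>M\<^esub> x"
  by (simp_all add: restrict_scalars_def)

lemma linear_maps_list_sum:
  assumes "f \<in> linear_maps A M N" "abelian_group M" "abelian_group N"
    "\<And>x. x \<in> set xs \<Longrightarrow> g x \<in> carrier M"
  shows "f (list_sum (add_monoid M) g xs) = list_sum (add_monoid N) (\<lambda>x. f (g x)) xs"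
proof (rule hom_list_sum)
  show "f \<in> hom (add_monoid M) (add_monoid N)"
    using assms(1) by (simp add: linear_maps_def)
qed (use assms in \<open>auto simp: abelian_group.a_group\<close>)

lemma (in left_module) act_linear_map:
  assumes "a \<in> carrier A"
  shows "(\<lambda>x. a \<odot>\<^bsub>M\<^esub> x) \<in> hom (add_monoid M) (add_monoid M)"
  using assms by (auto simp: hom_def act_closed act_add_right)

lemma (in left_module) act_list_sum:
  assumes "a \<in> carrier A" "\<And>x. x \<in> set xs \<Longrightarrow> g x \<in> carrier M"
  shows "a \<odot>\<^bsub>M\<^esub> list_sum (add_monoid M) g xs = list_sum (add_monoid M) (\<lambda>x. a \<odot>\<^bsub>M\<^esub> g x) xs"
  by (rule hom_list_sum[OF act_linear_map[OF assms(1)] M.a_group M.a_group]) (use assms in auto)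

lemma (in left_module) list_sum_act:
  assumes "x \<in> carrier M" "\<And>p. p \<in> set ps \<Longrightarrow> g p \<in> carrier A"
  shows "list_sum (add_monoid A) g ps \<odot>\<^bsub>M\<^esub> x = list_sum (add_monoid M) (\<lambda>p. g p \<odot>\<^bsub>M\<^esub> x) ps"
proof (rule hom_list_sum)
  show "(\<lambda>a. a \<odot>\<^bsub>M\<^esub> x) \<in> hom (add_monoid A) (add_monoid M)"
    using assms(1) by (auto simp: hom_def act_closed act_add_left)
qed (use assms in \<open>auto simp: A.a_group M.a_group\<close>)

text \<open>A \<open>B\<close>-linear section \<open>g\<close> is averaged to the \<open>A\<close>-linear section \<open>x \<mapsto> \<Sum> u g(vx)\<close>.\<close>

lemma (in ring_extension) separable_imp_left_semisimple:
  assumes "separable_extension B A \<iota>"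
  shows "left_semisimple_extension TYPE('m) B A \<iota>"
  unfolding left_semisimple_extension_def relatively_projective_def
proof (intro allI impI)
  fix M N :: "('a, 'm) module" and f
  assume "left_module A M" "left_module A N" and f: "f \<in> linear_maps A N M"
    and "splits_over B (restrict_scalars \<iota> N) (restrict_scalars \<iota> M) f"
  then obtain g where g: "g \<in> linear_maps B (restrict_scalars \<iota> M) (restrict_scalars \<iota> N)"
    and fg: "\<And>x. x \<in> carrier M \<Longrightarrow> f (g x) = x"
    unfolding splits_over_def by auto
  interpret M: left_module A M by fact
  interpret N: left_module A N by fact
  note g_simps = linear_mapsD[OF g, simplified]
  obtain es where es: "set es \<subseteq> carrier A \<times> carrier A"
    and casimir: "\<And>a. a \<in> carrier A \<Longrightarrow>
      list_sum E (\<lambda>(u, v). tensor E (a \<otimes> u, v)) es = list_sum E (\<lambda>(u, v). tensor E (u, v \<otimes> a)) es"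
    and one: "list_sum (add_monoid A) (\<lambda>(u, v). u \<otimes> v) es = \<one>"
    using assms unfolding separable_extension_iff_casimir casimir_list_def by blast
  \<comment> \<open>This is where \<open>B\<close>-linearity of \<open>g\<close> is spent: it makes
    the summand u g(vx) depend only on the tensor u \<otimes> v over \<open>B\<close>, so that
    centrality can be applied to it.\<close>
  have bal: "balanced (add_monoid N) A A (carrier B) (\<lambda>b x. x \<otimes> \<iota> b) (\<lambda>b y. \<iota> b \<otimes> y)
      (\<lambda>u v. u \<odot>\<^bsub>N\<^esub> g (v \<odot>\<^bsub>M\<^esub> x))" if "x \<in> carrier M" for x
    using that
    by (intro balancedI)
      (auto simp: N.act_closed M.act_closed g_simps N.act_add_left M.act_add_left N.act_add_right
        N.act_assoc M.act_assoc structure_closed)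
  define g' where "g' x = list_sum (add_monoid N) (\<lambda>(u, v). u \<odot>\<^bsub>N\<^esub> g (v \<odot>\<^bsub>M\<^esub> x)) es" for x
  have "g' \<in> linear_maps A M N"
  proof (rule linear_mapsI)
    show "g' x \<in> carrier N" if "x \<in> carrier M" for x
      unfolding g'_def using es that
      by (auto intro!: N.add.list_sum_closed simp: N.act_closed M.act_closed g_simps)
    show "g' (x \<oplus>\<^bsub>M\<^esub> y) = g' x \<oplus>\<^bsub>N\<^esub> g' y" if "x \<in> carrier M" "y \<in> carrier M" for x y
    proof -
      have "g' (x \<oplus>\<^bsub>M\<^esub> y) = list_sum (add_monoid N)
          (\<lambda>p. (case p of (u, v) \<Rightarrow> u \<odot>\<^bsub>N\<^esub> g (v \<odot>\<^bsub>M\<^esub> x)) \<oplus>\<^bsub>N\<^esub>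
            (case p of (u, v) \<Rightarrow> u \<odot>\<^bsub>N\<^esub> g (v \<odot>\<^bsub>M\<^esub> y))) es"
        unfolding g'_def using es that
        by (intro list_sum_cong)
          (auto simp: M.act_add_right N.act_add_right g_simps M.act_closed N.act_closed)
      also have "\<dots> = g' x \<oplus>\<^bsub>N\<^esub> g' y"
        unfolding g'_def using es that
        by (subst N.add.list_sum_mult) (auto simp: g_simps M.act_closed N.act_closed)
      finally show ?thesis .
    qed
    show "g' (a \<odot>\<^bsub>M\<^esub> x) = a \<odot>\<^bsub>N\<^esub> g' x" if a: "a \<in> carrier A" "x \<in> carrier M" for a x
    proof -
      have "g' (a \<odot>\<^bsub>M\<^esub> x) =
          list_sum (add_monoid N) (\<lambda>(u, v). u \<odot>\<^bsub>N\<^esub> g (v \<odot>\<^bsub>M\<^esub> x)) (map (\<lambda>(u, v). (u, v \<otimes> a)) es)"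
        unfolding g'_def list_sum_map using es a by (intro list_sum_cong) (auto simp: M.act_assoc)
      \<comment> \<open>Centrality carries \<open>a\<close> from the second factor to the front of
        the first.\<close>
      also have "\<dots> =
          list_sum (add_monoid N) (\<lambda>(u, v). u \<odot>\<^bsub>N\<^esub> g (v \<odot>\<^bsub>M\<^esub> x)) (map (\<lambda>(u, v). (a \<otimes> u, v)) es)"
      proof (rule list_sum_eq_E[OF N.a_comm_group bal[OF a(2)]])
        show "list_sum E (tensor E) (map (\<lambda>(u, v). (u, v \<otimes> a)) es) =
            list_sum E (tensor E) (map (\<lambda>(u, v). (a \<otimes> u, v)) es)"
          using casimir[OF a(1)] by (simp add: list_sum_map case_prod_unfold)
      qed (use a es in auto)
      also have "\<dots> = list_sum (add_monoid N) (\<lambda>p. a \<odot>\<^bsub>N\<^esub> (case p of (u, v) \<Rightarrow> u \<odot>\<^bsub>N\<^esub> g (v \<odot>\<^bsub>M\<^esub> x))) es"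
        unfolding list_sum_map using es a
        by (intro list_sum_cong) (auto simp: N.act_assoc M.act_closed g_simps)
      also have "\<dots> = a \<odot>\<^bsub>N\<^esub> g' x"
        unfolding g'_def using es a
        by (intro N.act_list_sum[symmetric]) (auto simp: N.act_closed M.act_closed g_simps)
      finally show ?thesis .
    qed
  qed
  \<comment> \<open>Each summand becomes u f(g(vx)) = uvx because \<open>g\<close> is a section, and
    the products uv add up to 1.\<close>
  moreover have "f (g' x) = x" if x: "x \<in> carrier M" for x
  proof -
    have "f (g' x) = list_sum (add_monoid M) (\<lambda>p. f (case p of (u, v) \<Rightarrow> u \<odot>\<^bsub>N\<^esub> g (v \<odot>\<^bsub>M\<^esub> x))) es"
      unfolding g'_def using es x
      by (intro linear_maps_list_sum[OF f])
        (auto simp: N.act_closed M.act_closed g_simps N.abelian_group_axioms M.abelian_group_axioms)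
    also have "\<dots> = list_sum (add_monoid M) (\<lambda>p. (case p of (u, v) \<Rightarrow> u \<otimes> v) \<odot>\<^bsub>M\<^esub> x) es"
      using es x
      by (intro list_sum_cong) (auto simp: linear_mapsD[OF f] fg M.act_assoc M.act_closed g_simps)
    also have "\<dots> = x"
      using es x one by (subst M.list_sum_act[symmetric]) (auto simp: M.act_one)
    finally show ?thesis .
  qed
  ultimately show "splits_over A N M f"
    unfolding splits_over_def by blast
qed

section \<open>Sweedler calculus\<close>

text \<open>Representing lists are far from unique, so the coproduct axioms can hold for chosen
  representatives only up to this relation.\<close>

definition tensor_equiv :: "('x \<Rightarrow>\<^sub>0 int) set monoid \<Rightarrow> 'x list \<Rightarrow> 'x list \<Rightarrow> bool"
  where "tensor_equiv T xs ys \<longleftrightarrow> list_sum T (tensor T) xs = list_sum T (tensor T) ys"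

lemma tensor_equiv_sym: "tensor_equiv T xs ys \<Longrightarrow> tensor_equiv T ys xs"
  by (simp add: tensor_equiv_def)

section \<open>Sums indexed by lists of pairs\<close>

lemma list_sum_pair_cong:
  assumes "set xs \<subseteq> X \<times> Y" "\<And>x y. \<lbrakk>x \<in> X; y \<in> Y\<rbrakk> \<Longrightarrow> f x y = g x y"
  shows "list_sum G (\<lambda>(x, y). f x y) xs = list_sum G (\<lambda>(x, y). g x y) xs"
  using assms by (intro list_sum_cong) auto

lemma list_sum_map_pair:
  "list_sum G f (map (\<lambda>(x, y). g x y) xs) = list_sum G (\<lambda>(x, y). f (g x y)) xs"
  by (simp add: list_sum_map case_prod_unfold)

context monoid
begin

lemma list_sum_pair_closed:
  assumes "set xs \<subseteq> X \<times> Y" "\<And>x y. \<lbrakk>x \<in> X; y \<in> Y\<rbrakk> \<Longrightarrow> f x y \<in> carrier G"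
  shows "list_sum G (\<lambda>(x, y). f x y) xs \<in> carrier G"
  using assms by (intro list_sum_closed) auto

text \<open>An iterated coproduct is represented by a \<open>concat\<close> of lists whose inner
  list depends on the outer pair; evaluating it gives a double sum.\<close>

lemma list_sum_nested_pairs:
  assumes "set xs \<subseteq> X \<times> Y" "\<And>x y. \<lbrakk>x \<in> X; y \<in> Y\<rbrakk> \<Longrightarrow> set (D x y) \<subseteq> U \<times> V"
    "\<And>x y u v. \<lbrakk>x \<in> X; y \<in> Y; u \<in> U; v \<in> V\<rbrakk> \<Longrightarrow> f (g x y u v) \<in> carrier G"
  shows "list_sum G f (concat (map (\<lambda>(x, y). map (\<lambda>(u, v). g x y u v) (D x y)) xs)) =
    list_sum G (\<lambda>(x, y). list_sum G (\<lambda>(u, v). f (g x y u v)) (D x y)) xs"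
proof -
  have "list_sum G f (concat (map (\<lambda>(x, y). map (\<lambda>(u, v). g x y u v) (D x y)) xs)) =
      list_sum G (\<lambda>p. list_sum G f (case p of (x, y) \<Rightarrow> map (\<lambda>(u, v). g x y u v) (D x y))) xs"
    using assms by (intro list_sum_concat_map) fastforce
  also have "\<dots> = list_sum G (\<lambda>(x, y). list_sum G (\<lambda>(u, v). f (g x y u v)) (D x y)) xs"
    by (intro list_sum_cong) (auto simp: list_sum_map_pair)
  finally show ?thesis .
qed

end

lemma (in comm_monoid) list_sum_pair_mult:
  assumes "set xs \<subseteq> X \<times> Y" "\<And>x y. \<lbrakk>x \<in> X; y \<in> Y\<rbrakk> \<Longrightarrow> f x y \<in> carrier G"
    "\<And>x y. \<lbrakk>x \<in> X; y \<in> Y\<rbrakk> \<Longrightarrow> g x y \<in> carrier G"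
    "\<And>x y. \<lbrakk>x \<in> X; y \<in> Y\<rbrakk> \<Longrightarrow> h x y = f x y \<otimes> g x y"
  shows "list_sum G (\<lambda>(x, y). h x y) xs =
    list_sum G (\<lambda>(x, y). f x y) xs \<otimes> list_sum G (\<lambda>(x, y). g x y) xs"
proof -
  have "list_sum G (\<lambda>(x, y). h x y) xs =
      list_sum G (\<lambda>p. (case p of (x, y) \<Rightarrow> f x y) \<otimes> (case p of (x, y) \<Rightarrow> g x y)) xs"
    using assms(1,4) by (intro list_sum_cong) auto
  also have "\<dots> = list_sum G (\<lambda>(x, y). f x y) xs \<otimes> list_sum G (\<lambda>(x, y). g x y) xs"
    using assms(1-3) by (intro list_sum_mult) auto
  finally show ?thesis .
qed

lemma (in comm_monoid) list_sum_pair_swap: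
  assumes "set xs \<subseteq> X \<times> Y" "set us \<subseteq> U \<times> V"
    "\<And>x y u v. \<lbrakk>x \<in> X; y \<in> Y; u \<in> U; v \<in> V\<rbrakk> \<Longrightarrow> f x y u v \<in> carrier G"
  shows "list_sum G (\<lambda>(x, y). list_sum G (\<lambda>(u, v). f x y u v) us) xs =
    list_sum G (\<lambda>(u, v). list_sum G (\<lambda>(x, y). f x y u v) xs) us"
proof -
  have "list_sum G (\<lambda>p. list_sum G (\<lambda>q. f (fst p) (snd p) (fst q) (snd q)) us) xs =
      list_sum G (\<lambda>q. list_sum G (\<lambda>p. f (fst p) (snd p) (fst q) (snd q)) xs) us"
    using assms(1,2) by (intro list_sum_swap assms(3)) auto
  then show ?thesis
    by (simp add: case_prod_unfold)
qed

lemma hom_list_sum_pair: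
  assumes "h \<in> hom G H" "group G" "group H" "set xs \<subseteq> X \<times> Y"
    "\<And>x y. \<lbrakk>x \<in> X; y \<in> Y\<rbrakk> \<Longrightarrow> f x y \<in> carrier G"
  shows "h (list_sum G (\<lambda>(x, y). f x y) xs) = list_sum H (\<lambda>(x, y). h (f x y)) xs"
  using hom_list_sum[OF assms(1-3), of xs "\<lambda>(x, y). f x y"] assms(4,5)
  by (auto simp: case_prod_unfold subset_iff)

context ring
begin

lemma list_sum_pair_r_distr:
  assumes "a \<in> carrier R" "set xs \<subseteq> X \<times> Y" "\<And>x y. \<lbrakk>x \<in> X; y \<in> Y\<rbrakk> \<Longrightarrow> f x y \<in> carrier R"
  shows "a \<otimes> list_sum (add_monoid R) (\<lambda>(x, y). f x y) xs =
    list_sum (add_monoid R) (\<lambda>(x, y). a \<otimes> f x y) xs"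
  using list_sum_r_distr[of a xs "\<lambda>(x, y). f x y"] assms by (auto simp: case_prod_unfold subset_iff)

lemma list_sum_pair_l_distr:
  assumes "a \<in> carrier R" "set xs \<subseteq> X \<times> Y" "\<And>x y. \<lbrakk>x \<in> X; y \<in> Y\<rbrakk> \<Longrightarrow> f x y \<in> carrier R"
  shows "list_sum (add_monoid R) (\<lambda>(x, y). f x y) xs \<otimes> a =
    list_sum (add_monoid R) (\<lambda>(x, y). f x y \<otimes> a) xs"
  using list_sum_l_distr[of a xs "\<lambda>(x, y). f x y"] assms by (auto simp: case_prod_unfold subset_iff)

end

text \<open>
  In the following locale \<open>\<Delta>\<^sub>L a\<close> and \<open>\<Delta>\<^sub>R a\<close> list the pure tensors of a chosen representation of
  \<open>\<gamma>\<^sub>L a\<close> and \<open>\<gamma>\<^sub>R a\<close>. The assumptions are stable under passage to the opposite ring with the two sides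
  exchanged and all tensors reversed; this symmetry spares the mirror images of all arguments.
\<close>

locale sweedler_hopf = ring A for A :: "('a, 'y) ring_scheme" (structure) +
  fixes L :: "('l, 'z) ring_scheme" and s\<^sub>L t\<^sub>L :: "'l \<Rightarrow> 'a" and \<pi>\<^sub>L :: "'a \<Rightarrow> 'l"
    and \<Delta>\<^sub>L :: "'a \<Rightarrow> ('a \<times> 'a) list"
    and R :: "('r, 'w) ring_scheme" and s\<^sub>R t\<^sub>R :: "'r \<Rightarrow> 'a" and \<pi>\<^sub>R :: "'a \<Rightarrow> 'r"
    and \<Delta>\<^sub>R :: "'a \<Rightarrow> ('a \<times> 'a) list"
    and S :: "'a \<Rightarrow> 'a"
  assumes S_hom: "S \<in> hom (add_monoid A) (add_monoid A)"
    and sL_closed: "l \<in> carrier L \<Longrightarrow> s\<^sub>L l \<in> carrier A"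
    and tL_closed: "l \<in> carrier L \<Longrightarrow> t\<^sub>L l \<in> carrier A"
    and sR_closed: "r \<in> carrier R \<Longrightarrow> s\<^sub>R r \<in> carrier A"
    and tR_closed: "r \<in> carrier R \<Longrightarrow> t\<^sub>R r \<in> carrier A"
    and piL_closed: "a \<in> carrier A \<Longrightarrow> \<pi>\<^sub>L a \<in> carrier L"
    and piR_closed: "a \<in> carrier A \<Longrightarrow> \<pi>\<^sub>R a \<in> carrier R"
    and coproduct_L_closed: "a \<in> carrier A \<Longrightarrow> set (\<Delta>\<^sub>L a) \<subseteq> carrier A \<times> carrier A"
    and coproduct_R_closed: "a \<in> carrier A \<Longrightarrow> set (\<Delta>\<^sub>R a) \<subseteq> carrier A \<times> carrier A"
    and S_tL_mult: "\<lbrakk>l \<in> carrier L; a \<in> carrier A\<rbrakk> \<Longrightarrow> S (t\<^sub>L l \<otimes> a) = S a \<otimes> s\<^sub>L l"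
    and S_mult_tL: "\<lbrakk>l \<in> carrier L; a \<in> carrier A\<rbrakk> \<Longrightarrow> S (a \<otimes> t\<^sub>L l) = s\<^sub>L l \<otimes> S a"
    and S_tR_mult: "\<lbrakk>r \<in> carrier R; a \<in> carrier A\<rbrakk> \<Longrightarrow> S (t\<^sub>R r \<otimes> a) = S a \<otimes> s\<^sub>R r"
    and S_mult_tR: "\<lbrakk>r \<in> carrier R; a \<in> carrier A\<rbrakk> \<Longrightarrow> S (a \<otimes> t\<^sub>R r) = s\<^sub>R r \<otimes> S a"
    and antipode_L: "a \<in> carrier A
      \<Longrightarrow> list_sum (add_monoid A) (\<lambda>(x, y). S x \<otimes> y) (\<Delta>\<^sub>L a) = s\<^sub>R (\<pi>\<^sub>R a)"
    and antipode_R: "a \<in> carrier A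
      \<Longrightarrow> list_sum (add_monoid A) (\<lambda>(x, y). x \<otimes> S y) (\<Delta>\<^sub>R a) = s\<^sub>L (\<pi>\<^sub>L a)"
    and counit_L_source: "a \<in> carrier A
      \<Longrightarrow> list_sum (add_monoid A) (\<lambda>(x, y). s\<^sub>L (\<pi>\<^sub>L x) \<otimes> y) (\<Delta>\<^sub>L a) = a"
    and counit_L_target: "a \<in> carrier A
      \<Longrightarrow> list_sum (add_monoid A) (\<lambda>(x, y). t\<^sub>L (\<pi>\<^sub>L y) \<otimes> x) (\<Delta>\<^sub>L a) = a"
    and counit_R_source: "a \<in> carrier A
      \<Longrightarrow> list_sum (add_monoid A) (\<lambda>(x, y). x \<otimes> s\<^sub>R (\<pi>\<^sub>R y)) (\<Delta>\<^sub>R a) = a"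
    and counit_R_target: "a \<in> carrier A
      \<Longrightarrow> list_sum (add_monoid A) (\<lambda>(x, y). y \<otimes> t\<^sub>R (\<pi>\<^sub>R x)) (\<Delta>\<^sub>R a) = a"
    and piL_mult: "\<lbrakk>a \<in> carrier A; b \<in> carrier A\<rbrakk> \<Longrightarrow> \<pi>\<^sub>L (a \<otimes> s\<^sub>L (\<pi>\<^sub>L b)) = \<pi>\<^sub>L (a \<otimes> b)"
    and piR_mult: "\<lbrakk>a \<in> carrier A; b \<in> carrier A\<rbrakk> \<Longrightarrow> \<pi>\<^sub>R (s\<^sub>R (\<pi>\<^sub>R a) \<otimes> b) = \<pi>\<^sub>R (a \<otimes> b)"
    and takeuchi_L: "\<lbrakk>l \<in> carrier L; a \<in> carrier A\<rbrakk>
      \<Longrightarrow> tensor_equiv (tensor_product A A (carrier L) (\<lambda>l x. t\<^sub>L l \<otimes> x) (\<lambda>l y. s\<^sub>L l \<otimes> y))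
        (map (\<lambda>(x, y). (x \<otimes> t\<^sub>L l, y)) (\<Delta>\<^sub>L a)) (map (\<lambda>(x, y). (x, y \<otimes> s\<^sub>L l)) (\<Delta>\<^sub>L a))"
    and takeuchi_R: "\<lbrakk>r \<in> carrier R; a \<in> carrier A\<rbrakk>
      \<Longrightarrow> tensor_equiv (tensor_product A A (carrier R) (\<lambda>r x. x \<otimes> s\<^sub>R r) (\<lambda>r y. y \<otimes> t\<^sub>R r))
        (map (\<lambda>(x, y). (x, t\<^sub>R r \<otimes> y)) (\<Delta>\<^sub>R a)) (map (\<lambda>(x, y). (s\<^sub>R r \<otimes> x, y)) (\<Delta>\<^sub>R a))"
    and coproduct_L_mult: "\<lbrakk>a \<in> carrier A; b \<in> carrier A\<rbrakk>
      \<Longrightarrow> tensor_equiv (tensor_product A A (carrier L) (\<lambda>l x. t\<^sub>L l \<otimes> x) (\<lambda>l y. s\<^sub>L l \<otimes> y))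
        (\<Delta>\<^sub>L (a \<otimes> b))
        (concat (map (\<lambda>(u, v). map (\<lambda>(x, y). (x \<otimes> u, y \<otimes> v)) (\<Delta>\<^sub>L a)) (\<Delta>\<^sub>L b)))"
    and coproduct_R_mult: "\<lbrakk>a \<in> carrier A; b \<in> carrier A\<rbrakk>
      \<Longrightarrow> tensor_equiv (tensor_product A A (carrier R) (\<lambda>r x. x \<otimes> s\<^sub>R r) (\<lambda>r y. y \<otimes> t\<^sub>R r))
        (\<Delta>\<^sub>R (a \<otimes> b))
        (concat (map (\<lambda>(u, v). map (\<lambda>(x, y). (u \<otimes> x, v \<otimes> y)) (\<Delta>\<^sub>R b)) (\<Delta>\<^sub>R a)))"
    and coproduct_L_sR: "r \<in> carrier R
      \<Longrightarrow> tensor_equiv (tensor_product A A (carrier L) (\<lambda>l x. t\<^sub>L l \<otimes> x) (\<lambda>l y. s\<^sub>L l \<otimes> y))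
        (\<Delta>\<^sub>L (s\<^sub>R r)) [(\<one>, s\<^sub>R r)]"
    and coproduct_L_tR: "r \<in> carrier R
      \<Longrightarrow> tensor_equiv (tensor_product A A (carrier L) (\<lambda>l x. t\<^sub>L l \<otimes> x) (\<lambda>l y. s\<^sub>L l \<otimes> y))
        (\<Delta>\<^sub>L (t\<^sub>R r)) [(t\<^sub>R r, \<one>)]"
    and coproduct_R_sL: "l \<in> carrier L
      \<Longrightarrow> tensor_equiv (tensor_product A A (carrier R) (\<lambda>r x. x \<otimes> s\<^sub>R r) (\<lambda>r y. y \<otimes> t\<^sub>R r))
        (\<Delta>\<^sub>R (s\<^sub>L l)) [(s\<^sub>L l, \<one>)]"
    and coproduct_R_tL: "l \<in> carrier L
      \<Longrightarrow> tensor_equiv (tensor_product A A (carrier R) (\<lambda>r x. x \<otimes> s\<^sub>R r) (\<lambda>r y. y \<otimes> t\<^sub>R r))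
        (\<Delta>\<^sub>R (t\<^sub>L l)) [(\<one>, t\<^sub>L l)]"
    and coassoc_LR: "a \<in> carrier A
      \<Longrightarrow> tensor_equiv (mixed_tensor_LR A L s\<^sub>L t\<^sub>L R s\<^sub>R t\<^sub>R)
        (concat (map (\<lambda>(x, y). map (\<lambda>(u, v). (u, v, y)) (\<Delta>\<^sub>L x)) (\<Delta>\<^sub>R a)))
        (concat (map (\<lambda>(x, y). map (\<lambda>(u, v). (x, u, v)) (\<Delta>\<^sub>R y)) (\<Delta>\<^sub>L a)))"
    and coassoc_RL: "a \<in> carrier A
      \<Longrightarrow> tensor_equiv (mixed_tensor_RL A L s\<^sub>L t\<^sub>L R s\<^sub>R t\<^sub>R)
        (concat (map (\<lambda>(x, y). map (\<lambda>(u, v). (u, v, y)) (\<Delta>\<^sub>R x)) (\<Delta>\<^sub>L a)))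
        (concat (map (\<lambda>(x, y). map (\<lambda>(u, v). (x, u, v)) (\<Delta>\<^sub>L y)) (\<Delta>\<^sub>R a)))"
begin

sublocale TL: tensor_factors A A "carrier L" "\<lambda>l x. t\<^sub>L l \<otimes> x" "\<lambda>l y. s\<^sub>L l \<otimes> y"
  by unfold_locales (auto intro: sL_closed tL_closed)

sublocale TR: tensor_factors A A "carrier R" "\<lambda>r x. x \<otimes> s\<^sub>R r" "\<lambda>r y. y \<otimes> t\<^sub>R r"
  by unfold_locales (auto intro: sR_closed tR_closed)

sublocale LR: tensor_factors3 A A A "carrier L" "\<lambda>l x. t\<^sub>L l \<otimes> x" "\<lambda>l y. s\<^sub>L l \<otimes> y"
    "carrier R" "\<lambda>r y. y \<otimes> s\<^sub>R r" "\<lambda>r z. z \<otimes> t\<^sub>R r"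
  by unfold_locales (auto intro: sL_closed tL_closed sR_closed tR_closed)

sublocale RL: tensor_factors3 A A A "carrier R" "\<lambda>r x. x \<otimes> s\<^sub>R r" "\<lambda>r y. y \<otimes> t\<^sub>R r"
    "carrier L" "\<lambda>l y. t\<^sub>L l \<otimes> y" "\<lambda>l z. s\<^sub>L l \<otimes> z"
  by unfold_locales (auto intro: sL_closed tL_closed sR_closed tR_closed)

lemma S_closed: "a \<in> carrier A \<Longrightarrow> S a \<in> carrier A"
  using S_hom by (auto simp: hom_def)

lemma S_add: "\<lbrakk>a \<in> carrier A; b \<in> carrier A\<rbrakk> \<Longrightarrow> S (a \<oplus> b) = S a \<oplus> S b"
  using S_hom by (auto simp: hom_def)

lemmas closed = S_closed sL_closed tL_closed sR_closed tR_closed piL_closed piR_closed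

text \<open>To test an identity of Sweedler lists means to evaluate both sides under a balanced map.
  The suffix names the tensor product: the square over \<open>L\<close>, the square over
  \<open>R\<close>, and the two mixed threefold products.\<close>

lemmas test_L = TL.list_sum_balanced_eq[folded tensor_equiv_def]
lemmas test_R = TR.list_sum_balanced_eq[folded tensor_equiv_def]
lemmas test_LR = LR.list_sum_balanced3_eq[folded tensor_equiv_def mixed_tensor_LR_def]
lemmas test_RL = RL.list_sum_balanced3_eq[folded tensor_equiv_def mixed_tensor_RL_def]

lemma coproduct_mem:
  "\<lbrakk>(x, y) \<in> set (\<Delta>\<^sub>L a); a \<in> carrier A\<rbrakk> \<Longrightarrow> x \<in> carrier A \<and> y \<in> carrier A"
  "\<lbrakk>(x, y) \<in> set (\<Delta>\<^sub>R a); a \<in> carrier A\<rbrakk> \<Longrightarrow> x \<in> carrier A \<and> y \<in> carrier A"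
  using coproduct_L_closed coproduct_R_closed by blast+

lemma nested_coproducts_closed:
  assumes "a \<in> carrier A" "b \<in> carrier A"
  shows "set (concat (map (\<lambda>(x, y). map (\<lambda>(u, v). (u, v, y)) (\<Delta>\<^sub>L x)) (\<Delta>\<^sub>R a)))
      \<subseteq> carrier A \<times> carrier A \<times> carrier A"
    and "set (concat (map (\<lambda>(x, y). map (\<lambda>(u, v). (x, u, v)) (\<Delta>\<^sub>R y)) (\<Delta>\<^sub>L a)))
      \<subseteq> carrier A \<times> carrier A \<times> carrier A"
    and "set (concat (map (\<lambda>(x, y). map (\<lambda>(u, v). (u, v, y)) (\<Delta>\<^sub>R x)) (\<Delta>\<^sub>L a)))
      \<subseteq> carrier A \<times> carrier A \<times> carrier A"
    and "set (concat (map (\<lambda>(x, y). map (\<lambda>(u, v). (x, u, v)) (\<Delta>\<^sub>L y)) (\<Delta>\<^sub>R a)))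
      \<subseteq> carrier A \<times> carrier A \<times> carrier A"
    and "set (concat (map (\<lambda>(u, v). map (\<lambda>(x, y). (x \<otimes> u, y \<otimes> v)) (\<Delta>\<^sub>L a)) (\<Delta>\<^sub>L b)))
      \<subseteq> carrier A \<times> carrier A"
    and "set (concat (map (\<lambda>(u, v). map (\<lambda>(x, y). (u \<otimes> x, v \<otimes> y)) (\<Delta>\<^sub>R b)) (\<Delta>\<^sub>R a)))
      \<subseteq> carrier A \<times> carrier A"
  using assms by (auto dest!: coproduct_mem)

section \<open>The elements S(b_(1) u) b_(2)\<close>

definition twisted_antipode :: "'a \<Rightarrow> 'a \<Rightarrow> 'a" where
  "twisted_antipode b u = list_sum (add_monoid A) (\<lambda>(p, q). S (p \<otimes> u) \<otimes> q) (\<Delta>\<^sub>L b)"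

text \<open>Balancedness comes from \<open>S_tL_mult\<close>: a scalar \<open>t\<^sub>L l\<close> in
  front of the first leg leaves \<open>S\<close> on the right as \<open>s\<^sub>L l\<close>, in
  front of the second leg. Hence the value depends only on the tensor represented by the list of
  \<open>b\<close>.\<close>

lemma balanced_twisted_antipode:
  assumes "u \<in> carrier A"
  shows "balanced (add_monoid A) A A (carrier L) (\<lambda>l x. t\<^sub>L l \<otimes> x) (\<lambda>l y. s\<^sub>L l \<otimes> y)
    (\<lambda>p q. S (p \<otimes> u) \<otimes> q)"
  using assms
  by (intro balancedI) (auto simp: closed S_add l_distr r_distr m_assoc S_tL_mult)

lemma twisted_antipode_closed:
  "\<lbrakk>b \<in> carrier A; u \<in> carrier A\<rbrakk> \<Longrightarrow> twisted_antipode b u \<in> carrier A"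
  unfolding twisted_antipode_def
  by (rule add.list_sum_pair_closed[OF coproduct_L_closed]) (auto simp: closed)

lemma twisted_antipode_add:
  assumes "b \<in> carrier A" "u \<in> carrier A" "u' \<in> carrier A"
  shows "twisted_antipode b (u \<oplus> u') = twisted_antipode b u \<oplus> twisted_antipode b u'"
  unfolding twisted_antipode_def
  by (rule add.list_sum_pair_mult[OF coproduct_L_closed])
    (use assms in \<open>auto simp: closed S_add l_distr r_distr\<close>)

text \<open>The Takeuchi condition exchanges \<open>t\<^sub>L l\<close> to the right of b_(1) for
  \<open>s\<^sub>L l\<close> to the right of b_(2), where it can be pulled out of the sum.\<close>

lemma twisted_antipode_tL:
  assumes "b \<in> carrier A" "u \<in> carrier A" "l \<in> carrier L"
  shows "twisted_antipode b (t\<^sub>L l \<otimes> u) = twisted_antipode b u \<otimes> s\<^sub>L l"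
proof -
  have "twisted_antipode b (t\<^sub>L l \<otimes> u) =
      list_sum (add_monoid A) (\<lambda>(p, q). S (p \<otimes> u) \<otimes> q) (map (\<lambda>(x, y). (x \<otimes> t\<^sub>L l, y)) (\<Delta>\<^sub>L b))"
    unfolding twisted_antipode_def list_sum_map_pair
    using assms
    by (intro list_sum_pair_cong[OF coproduct_L_closed]) (auto simp: closed m_assoc)
  also have "\<dots> =
      list_sum (add_monoid A) (\<lambda>(p, q). S (p \<otimes> u) \<otimes> q) (map (\<lambda>(x, y). (x, y \<otimes> s\<^sub>L l)) (\<Delta>\<^sub>L b))"
    by (rule test_L[OF a_comm_group balanced_twisted_antipode _ _ takeuchi_L])
      (use assms in \<open>auto simp: closed dest: coproduct_mem\<close>)
  also have "\<dots> = list_sum (add_monoid A) (\<lambda>(p, q). S (p \<otimes> u) \<otimes> q \<otimes> s\<^sub>L l) (\<Delta>\<^sub>L b)"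
    unfolding list_sum_map_pair using assms
    by (intro list_sum_pair_cong[OF coproduct_L_closed]) (auto simp: closed m_assoc)
  also have "\<dots> = twisted_antipode b u \<otimes> s\<^sub>L l"
    unfolding twisted_antipode_def using assms
    by (intro list_sum_pair_l_distr[symmetric, OF _ coproduct_L_closed]) (auto simp: closed)
  finally show ?thesis .
qed

text \<open>By multiplicativity of the coproduct, S(b_(1) x_(1)) b_(2) x_(2) is the left antipode
  sum of the single element bx.\<close>

lemma twisted_antipode_coproduct:
  assumes "b \<in> carrier A" "x \<in> carrier A"
  shows "list_sum (add_monoid A) (\<lambda>(u, v). twisted_antipode b u \<otimes> v) (\<Delta>\<^sub>L x) = s\<^sub>R (\<pi>\<^sub>R (b \<otimes> x))"
proof -
  have bal: "balanced (add_monoid A) A A (carrier L) (\<lambda>l x. t\<^sub>L l \<otimes> x) (\<lambda>l y. s\<^sub>L l \<otimes> y)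
      (\<lambda>p q. S p \<otimes> q)"
    by (intro balancedI) (auto simp: closed S_add l_distr r_distr m_assoc S_tL_mult)
  have "s\<^sub>R (\<pi>\<^sub>R (b \<otimes> x)) = list_sum (add_monoid A) (\<lambda>(p, q). S p \<otimes> q) (\<Delta>\<^sub>L (b \<otimes> x))"
    using assms by (simp add: antipode_L)
  also have "\<dots> = list_sum (add_monoid A) (\<lambda>(p, q). S p \<otimes> q)
      (concat (map (\<lambda>(u, v). map (\<lambda>(x, y). (x \<otimes> u, y \<otimes> v)) (\<Delta>\<^sub>L b)) (\<Delta>\<^sub>L x)))"
    by (rule test_L[OF a_comm_group bal coproduct_L_closed nested_coproducts_closed(5) coproduct_L_mult])
      (use assms in auto)
  also have "\<dots> = list_sum (add_monoid A) (\<lambda>(u, v).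
      list_sum (add_monoid A) (\<lambda>(p, q). case (p \<otimes> u, q \<otimes> v) of (p, q) \<Rightarrow> S p \<otimes> q) (\<Delta>\<^sub>L b)) (\<Delta>\<^sub>L x)"
    using assms
    by (intro add.list_sum_nested_pairs[OF coproduct_L_closed coproduct_L_closed]) (auto simp: closed)
  also have "\<dots> = list_sum (add_monoid A) (\<lambda>(u, v). twisted_antipode b u \<otimes> v) (\<Delta>\<^sub>L x)"
  proof (rule list_sum_pair_cong[OF coproduct_L_closed])
    fix u v
    assume uv: "u \<in> carrier A" "v \<in> carrier A"
    have "twisted_antipode b u \<otimes> v = list_sum (add_monoid A) (\<lambda>(p, q). S (p \<otimes> u) \<otimes> q \<otimes> v) (\<Delta>\<^sub>L b)"
      unfolding twisted_antipode_def using assms uv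
      by (intro list_sum_pair_l_distr[OF _ coproduct_L_closed]) (auto simp: closed)
    then show "list_sum (add_monoid A)
          (\<lambda>(p, q). case (p \<otimes> u, q \<otimes> v) of (p, q) \<Rightarrow> S p \<otimes> q) (\<Delta>\<^sub>L b) = twisted_antipode b u \<otimes> v"
      using assms uv
      by (auto simp: closed m_assoc intro!: list_sum_pair_cong[OF coproduct_L_closed])
  qed (use assms in auto)
  finally show ?thesis
    by simp
qed

text \<open>This is the uniqueness argument for convolution inverses. Writing F for
  \<open>twisted_antipode b\<close>, one has \<open>F(y) = F(y_(1)) s\<^sub>L(\<pi>\<^sub>L y_(2)) =
  F(y_(1)) y_(2)^(1) S(y_(2)^(2)) = F(y^(1)_(1)) y^(1)_(2) S(y^(2)) = s\<^sub>R(\<pi>\<^sub>R(b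
  y^(1))) S(y^(2))\<close>. The third equality is mixed coassociativity, the last one
  \<open>twisted_antipode_coproduct\<close>.\<close>

lemma twisted_antipode_expand:
  assumes b: "b \<in> carrier A" and y: "y \<in> carrier A"
  shows "twisted_antipode b y = list_sum (add_monoid A) (\<lambda>(x, w). s\<^sub>R (\<pi>\<^sub>R (b \<otimes> x)) \<otimes> S w) (\<Delta>\<^sub>R y)"
proof -
  note closed = closed twisted_antipode_closed[OF b]
  \<comment> \<open>Over \<open>L\<close> the map is balanced by \<open>twisted_antipode_tL\<close>,
    over \<open>R\<close> by the rule \<open>S_mult_tR\<close>.\<close>
  have "balanced3 (add_monoid A) A A A (carrier L) (\<lambda>l x. t\<^sub>L l \<otimes> x) (\<lambda>l y. s\<^sub>L l \<otimes> y)
      (carrier R) (\<lambda>r y. y \<otimes> s\<^sub>R r) (\<lambda>r z. z \<otimes> t\<^sub>R r) (\<lambda>u v w. twisted_antipode b u \<otimes> v \<otimes> S w)"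
    unfolding balanced3_def
    by (intro conjI ballI balancedI)
      (auto simp: closed b S_add twisted_antipode_add twisted_antipode_tL S_mult_tR m_assoc l_distr r_distr)
  from test_LR[OF a_comm_group this nested_coproducts_closed(1,2)[OF y y] coassoc_LR[OF y]]
  have "list_sum (add_monoid A) (\<lambda>(x, w). list_sum (add_monoid A)
        (\<lambda>(u, v). twisted_antipode b u \<otimes> v \<otimes> S w) (\<Delta>\<^sub>L x)) (\<Delta>\<^sub>R y) =
      list_sum (add_monoid A) (\<lambda>(u, z). list_sum (add_monoid A)
        (\<lambda>(v, w). twisted_antipode b u \<otimes> v \<otimes> S w) (\<Delta>\<^sub>R z)) (\<Delta>\<^sub>L y)"
    by (subst (asm) add.list_sum_nested_pairs[OF coproduct_R_closed[OF y] coproduct_L_closed],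
        (auto simp: closed)[2],
        subst (asm) add.list_sum_nested_pairs[OF coproduct_L_closed[OF y] coproduct_R_closed])
      (auto simp: closed)
  also have "list_sum (add_monoid A) (\<lambda>(x, w). list_sum (add_monoid A)
        (\<lambda>(u, v). twisted_antipode b u \<otimes> v \<otimes> S w) (\<Delta>\<^sub>L x)) (\<Delta>\<^sub>R y) =
      list_sum (add_monoid A) (\<lambda>(x, w). s\<^sub>R (\<pi>\<^sub>R (b \<otimes> x)) \<otimes> S w) (\<Delta>\<^sub>R y)"
  proof (rule list_sum_pair_cong[OF coproduct_R_closed[OF y]])
    fix x w
    assume "x \<in> carrier A" "w \<in> carrier A"
    then show "list_sum (add_monoid A) (\<lambda>(u, v). twisted_antipode b u \<otimes> v \<otimes> S w) (\<Delta>\<^sub>L x) =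
        s\<^sub>R (\<pi>\<^sub>R (b \<otimes> x)) \<otimes> S w"
      unfolding twisted_antipode_coproduct[OF b \<open>x \<in> carrier A\<close>, symmetric]
      by (intro list_sum_pair_l_distr[symmetric, OF _ coproduct_L_closed]) (auto simp: closed)
  qed
  \<comment> \<open>On the other side of coassociativity the right antipode axiom contracts
    \<open>z\<close> to \<open>s\<^sub>L (\<pi>\<^sub>L z)\<close>, which F reabsorbs as
    \<open>t\<^sub>L (\<pi>\<^sub>L z)\<close> in front of its argument. The counit law can then be
    applied inside F.\<close>
  also have "list_sum (add_monoid A) (\<lambda>(u, z). list_sum (add_monoid A)
        (\<lambda>(v, w). twisted_antipode b u \<otimes> v \<otimes> S w) (\<Delta>\<^sub>R z)) (\<Delta>\<^sub>L y) =
      list_sum (add_monoid A) (\<lambda>(u, z). twisted_antipode b (t\<^sub>L (\<pi>\<^sub>L z) \<otimes> u)) (\<Delta>\<^sub>L y)"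
  proof (rule list_sum_pair_cong[OF coproduct_L_closed[OF y]])
    fix u z
    assume uz: "u \<in> carrier A" "z \<in> carrier A"
    have "list_sum (add_monoid A) (\<lambda>(v, w). twisted_antipode b u \<otimes> v \<otimes> S w) (\<Delta>\<^sub>R z) =
        list_sum (add_monoid A) (\<lambda>(v, w). twisted_antipode b u \<otimes> (v \<otimes> S w)) (\<Delta>\<^sub>R z)"
      using uz by (intro list_sum_pair_cong[OF coproduct_R_closed]) (auto simp: closed m_assoc)
    also have "\<dots> = twisted_antipode b u \<otimes> s\<^sub>L (\<pi>\<^sub>L z)"
      unfolding antipode_R[OF uz(2), symmetric] using uz
      by (intro list_sum_pair_r_distr[symmetric, OF _ coproduct_R_closed]) (auto simp: closed)
    also have "\<dots> = twisted_antipode b (t\<^sub>L (\<pi>\<^sub>L z) \<otimes> u)"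
      using uz b by (simp add: twisted_antipode_tL closed)
    finally show "list_sum (add_monoid A) (\<lambda>(v, w). twisted_antipode b u \<otimes> v \<otimes> S w) (\<Delta>\<^sub>R z) =
        twisted_antipode b (t\<^sub>L (\<pi>\<^sub>L z) \<otimes> u)" .
  qed
  also have "list_sum (add_monoid A) (\<lambda>(u, z). twisted_antipode b (t\<^sub>L (\<pi>\<^sub>L z) \<otimes> u)) (\<Delta>\<^sub>L y) =
      twisted_antipode b (list_sum (add_monoid A) (\<lambda>(u, z). t\<^sub>L (\<pi>\<^sub>L z) \<otimes> u) (\<Delta>\<^sub>L y))"
  proof (rule hom_list_sum_pair[symmetric, OF _ a_group a_group coproduct_L_closed[OF y]])
    show "twisted_antipode b \<in> hom (add_monoid A) (add_monoid A)"
      by (auto simp: hom_def closed twisted_antipode_add b)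
  qed (auto simp: closed)
  finally show ?thesis
    by (simp add: counit_L_target y)
qed

text \<open>
  The expansion above shows that the left-hand side depends on \<open>b\<close> only through \<open>\<pi>\<^sub>R b\<close>, so \<open>b\<close> may be
  replaced by \<open>s\<^sub>R (\<pi>\<^sub>R b)\<close>, whose coproduct is explicit. This replaces antimultiplicativity of \<open>S\<close>.
\<close>

lemma twisted_antipode_eq:
  assumes b: "b \<in> carrier A" and y: "y \<in> carrier A"
  shows "twisted_antipode b y = S y \<otimes> s\<^sub>R (\<pi>\<^sub>R b)"
proof -
  let ?b = "s\<^sub>R (\<pi>\<^sub>R b)"
  have b': "?b \<in> carrier A"
    by (simp add: closed b)
  have "twisted_antipode b y = twisted_antipode ?b y"
    unfolding twisted_antipode_expand[OF b y] twisted_antipode_expand[OF b' y]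
    using b by (intro list_sum_pair_cong[OF coproduct_R_closed[OF y]]) (simp add: piR_mult)
  also have "\<dots> = list_sum (add_monoid A) (\<lambda>(p, q). S (p \<otimes> y) \<otimes> q) [(\<one>, ?b)]"
    unfolding twisted_antipode_def
    by (rule test_L[OF a_comm_group balanced_twisted_antipode[OF y] _ _ coproduct_L_sR])
      (use b b' coproduct_L_closed in \<open>auto simp: closed\<close>)
  also have "\<dots> = S y \<otimes> ?b"
    using y b' by (simp add: closed)
  finally show ?thesis .
qed

end

section \<open>Centrality of the element i^(1) \<otimes> S(i^(2))\<close>

context sweedler_hopf
begin

sublocale sR: ring_extension A R s\<^sub>R
  by unfold_locales (rule sR_closed)

abbreviation (input) E where "E \<equiv> extension_tensor R A s\<^sub>R"

text \<open>The element u i^(1) \<otimes> S(v i^(2)) w. Its three parameters are the slots into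
  which the legs of an iterated coproduct of \<open>a\<close> are inserted; the two sides of
  centrality are the values at (a, 1, 1) and (1, 1, a).\<close>

definition twisted_coproduct :: "'a \<Rightarrow> 'a \<Rightarrow> 'a \<Rightarrow> 'a \<Rightarrow> ('a \<times> 'a \<Rightarrow>\<^sub>0 int) set" where
  "twisted_coproduct i u v w = list_sum E (\<lambda>(x, y). tensor E (u \<otimes> x, S (v \<otimes> y) \<otimes> w)) (\<Delta>\<^sub>R i)"

text \<open>A scalar \<open>t\<^sub>R r\<close> at the right end of the argument of \<open>S\<close>
  comes out on the left as \<open>s\<^sub>R r\<close>, and that is precisely what may cross the
  tensor sign over \<open>R\<close>.\<close>

lemma balanced_tensor_antipode:
  assumes "u \<in> carrier A" "v \<in> carrier A" "w \<in> carrier A"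
  shows "balanced E A A (carrier R) (\<lambda>r x. x \<otimes> s\<^sub>R r) (\<lambda>r y. y \<otimes> t\<^sub>R r)
    (\<lambda>x y. tensor E (u \<otimes> x, S (v \<otimes> y) \<otimes> w))"
proof (rule balancedI)
  fix r x y
  assume *: "r \<in> carrier R" "x \<in> carrier A" "y \<in> carrier A"
  have "S (v \<otimes> (y \<otimes> t\<^sub>R r)) \<otimes> w = s\<^sub>R r \<otimes> (S (v \<otimes> y) \<otimes> w)"
    using assms * S_mult_tR[of r "v \<otimes> y"] by (simp add: m_assoc closed)
  then show "tensor E (u \<otimes> (x \<otimes> s\<^sub>R r), S (v \<otimes> y) \<otimes> w) = tensor E (u \<otimes> x, S (v \<otimes> (y \<otimes> t\<^sub>R r)) \<otimes> w)"
    using assms * sR.tensor_E(4)[of r "u \<otimes> x" "S (v \<otimes> y) \<otimes> w"] by (simp add: m_assoc closed)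
qed (use assms in \<open>auto simp: closed sR.tensor_E S_add l_distr r_distr\<close>)

lemma twisted_coproduct_closed:
  assumes "i \<in> carrier A" "u \<in> carrier A" "v \<in> carrier A" "w \<in> carrier A"
  shows "twisted_coproduct i u v w \<in> carrier E"
  unfolding twisted_coproduct_def using assms
  by (intro sR.E.list_sum_pair_closed[OF coproduct_R_closed]) (auto simp: closed sR.tensor_E)

lemma twisted_coproduct_add:
  assumes "i \<in> carrier A" "u \<in> carrier A" "v \<in> carrier A" "w \<in> carrier A" "z \<in> carrier A"
  shows "twisted_coproduct i (u \<oplus> z) v w = twisted_coproduct i u v w \<otimes>\<^bsub>E\<^esub> twisted_coproduct i z v w"
    and "twisted_coproduct i u (v \<oplus> z) w = twisted_coproduct i u v w \<otimes>\<^bsub>E\<^esub> twisted_coproduct i u z w"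
    and "twisted_coproduct i u v (w \<oplus> z) = twisted_coproduct i u v w \<otimes>\<^bsub>E\<^esub> twisted_coproduct i u v z"
  unfolding twisted_coproduct_def
    by (rule sR.E.list_sum_pair_mult[OF coproduct_R_closed];
        use assms in \<open>simp add: closed sR.tensor_E S_add l_distr r_distr\<close>)+

text \<open>The scalar stands directly in front of a leg of \<open>i\<close>, so this is the
  Takeuchi condition for the right coproduct of \<open>i\<close>.\<close>

lemma twisted_coproduct_R:
  assumes "i \<in> carrier A" "u \<in> carrier A" "v \<in> carrier A" "w \<in> carrier A" "r \<in> carrier R"
  shows "twisted_coproduct i (u \<otimes> s\<^sub>R r) v w = twisted_coproduct i u (v \<otimes> t\<^sub>R r) w"
proof -
  have "twisted_coproduct i (u \<otimes> s\<^sub>R r) v w = list_sum E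
      (\<lambda>(x, y). tensor E (u \<otimes> x, S (v \<otimes> y) \<otimes> w)) (map (\<lambda>(x, y). (s\<^sub>R r \<otimes> x, y)) (\<Delta>\<^sub>R i))"
    unfolding twisted_coproduct_def list_sum_map_pair using assms
    by (intro list_sum_pair_cong[OF coproduct_R_closed]) (auto simp: closed m_assoc)
  also have "\<dots> = list_sum E
      (\<lambda>(x, y). tensor E (u \<otimes> x, S (v \<otimes> y) \<otimes> w)) (map (\<lambda>(x, y). (x, t\<^sub>R r \<otimes> y)) (\<Delta>\<^sub>R i))"
    by (rule test_R[symmetric, OF sR.comm_group_E balanced_tensor_antipode _ _ takeuchi_R])
      (use assms in \<open>auto simp: closed dest: coproduct_mem\<close>)
  also have "\<dots> = twisted_coproduct i u (v \<otimes> t\<^sub>R r) w"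
    unfolding twisted_coproduct_def list_sum_map_pair using assms
    by (intro list_sum_pair_cong[OF coproduct_R_closed]) (auto simp: closed m_assoc)
  finally show ?thesis .
qed

text \<open>Here the antipode alone does the work, by \<open>S_tL_mult\<close>. Together with
  \<open>twisted_coproduct_R\<close> this gives the balancing conditions under which
  \<open>coassoc_RL\<close> may be applied to the three slots.\<close>

lemma twisted_coproduct_L:
  assumes "i \<in> carrier A" "u \<in> carrier A" "v \<in> carrier A" "w \<in> carrier A" "l \<in> carrier L"
  shows "twisted_coproduct i u (t\<^sub>L l \<otimes> v) w = twisted_coproduct i u v (s\<^sub>L l \<otimes> w)"
  unfolding twisted_coproduct_def using assms
  by (intro list_sum_pair_cong[OF coproduct_R_closed]) (auto simp: closed m_assoc S_tL_mult)

text \<open>Filling the first two slots with the legs of \<open>a\<close> produces the product of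
  the coproducts of \<open>a\<close> and \<open>i\<close>, hence the coproduct of their product. An
  integral property of \<open>i\<close> thereby becomes applicable.\<close>

lemma twisted_coproduct_mult:
  assumes "i \<in> carrier A" "a \<in> carrier A" "w \<in> carrier A"
  shows "list_sum E (\<lambda>(u, v). twisted_coproduct i u v w) (\<Delta>\<^sub>R a) =
    twisted_coproduct (a \<otimes> i) \<one> \<one> w"
proof -
  have "twisted_coproduct (a \<otimes> i) \<one> \<one> w = list_sum E (\<lambda>(x, y). tensor E (\<one> \<otimes> x, S (\<one> \<otimes> y) \<otimes> w))
      (concat (map (\<lambda>(u, v). map (\<lambda>(x, y). (u \<otimes> x, v \<otimes> y)) (\<Delta>\<^sub>R i)) (\<Delta>\<^sub>R a)))"
    unfolding twisted_coproduct_def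
    by (rule test_R[OF sR.comm_group_E balanced_tensor_antipode coproduct_R_closed
          nested_coproducts_closed(6) coproduct_R_mult]) (use assms in auto)
  also have "\<dots> = list_sum E (\<lambda>(u, v). list_sum E
      (\<lambda>(x, y). case (u \<otimes> x, v \<otimes> y) of (x, y) \<Rightarrow> tensor E (\<one> \<otimes> x, S (\<one> \<otimes> y) \<otimes> w)) (\<Delta>\<^sub>R i)) (\<Delta>\<^sub>R a)"
    using assms
    by (intro sR.E.list_sum_nested_pairs[OF coproduct_R_closed coproduct_R_closed])
      (auto simp: closed sR.tensor_E)
  also have "\<dots> = list_sum E (\<lambda>(u, v). twisted_coproduct i u v w) (\<Delta>\<^sub>R a)"
    unfolding twisted_coproduct_def using assms
    by (intro list_sum_pair_cong[OF coproduct_R_closed]) auto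
  finally show ?thesis
    by simp
qed

text \<open>The substitute for antimultiplicativity enters: \<open>S(z_(1) i^(2)) z_(2) = S(i^(2))
  s\<^sub>R(\<pi>\<^sub>R z) = S(t\<^sub>R(\<pi>\<^sub>R z) i^(2))\<close>. The remaining scalar is
  then carried to the first tensor factor by \<open>twisted_coproduct_R\<close>.\<close>

lemma twisted_coproduct_antipode:
  assumes "i \<in> carrier A" "u \<in> carrier A" "z \<in> carrier A"
  shows "list_sum E (\<lambda>(v, w). twisted_coproduct i u v w) (\<Delta>\<^sub>L z) =
    twisted_coproduct i (u \<otimes> s\<^sub>R (\<pi>\<^sub>R z)) \<one> \<one>"
proof -
  have "list_sum E (\<lambda>(v, w). twisted_coproduct i u v w) (\<Delta>\<^sub>L z) = list_sum E (\<lambda>(x, y).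
      list_sum E (\<lambda>(v, w). tensor E (u \<otimes> x, S (v \<otimes> y) \<otimes> w)) (\<Delta>\<^sub>L z)) (\<Delta>\<^sub>R i)"
    unfolding twisted_coproduct_def using assms
    by (intro sR.E.list_sum_pair_swap[OF coproduct_L_closed coproduct_R_closed])
      (auto simp: closed sR.tensor_E)
  also have "\<dots> = list_sum E (\<lambda>(x, y). tensor E (u \<otimes> x, S (t\<^sub>R (\<pi>\<^sub>R z) \<otimes> y) \<otimes> \<one>)) (\<Delta>\<^sub>R i)"
  proof (rule list_sum_pair_cong[OF coproduct_R_closed])
    fix x y
    assume xy: "x \<in> carrier A" "y \<in> carrier A"
    have "(\<lambda>c. tensor E (u \<otimes> x, c)) \<in> hom (add_monoid A) E"
      using assms xy by (auto simp: hom_def sR.tensor_E)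
    from hom_list_sum_pair[OF this a_group sR.E.is_group coproduct_L_closed[OF assms(3)],
        of "\<lambda>v w. S (v \<otimes> y) \<otimes> w"]
    have "list_sum E (\<lambda>(v, w). tensor E (u \<otimes> x, S (v \<otimes> y) \<otimes> w)) (\<Delta>\<^sub>L z) =
        tensor E (u \<otimes> x, twisted_antipode z y)"
      using xy by (auto simp: closed twisted_antipode_def)
    then show "list_sum E (\<lambda>(v, w). tensor E (u \<otimes> x, S (v \<otimes> y) \<otimes> w)) (\<Delta>\<^sub>L z) =
        tensor E (u \<otimes> x, S (t\<^sub>R (\<pi>\<^sub>R z) \<otimes> y) \<otimes> \<one>)"
      using assms xy by (simp add: closed S_tR_mult twisted_antipode_eq)
  qed (use assms in auto)
  also have "\<dots> = twisted_coproduct i u (\<one> \<otimes> t\<^sub>R (\<pi>\<^sub>R z)) \<one>"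
    unfolding twisted_coproduct_def using assms by (simp add: closed)
  also have "\<dots> = twisted_coproduct i (u \<otimes> s\<^sub>R (\<pi>\<^sub>R z)) \<one> \<one>"
    using assms by (simp add: twisted_coproduct_R closed)
  finally show ?thesis .
qed

text \<open>The integral equation is used with \<open>t\<^sub>L\<close> instead of
  \<open>s\<^sub>L\<close> because the right coproduct of \<open>t\<^sub>L l\<close> is 1 \<otimes>
  \<open>t\<^sub>L l\<close>: the scalar lands next to i^(2), and \<open>S\<close> turns it into
  \<open>s\<^sub>L l\<close> on the far right, as the counit law for \<open>\<Delta>\<^sub>L\<close>
  requires. Normalization is stated inside \<open>A\<close> since i^(1) S(i^(2)) equals
  \<open>s\<^sub>L (\<pi>\<^sub>L i)\<close>.\<close>

theorem left_integral_casimir_list: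
  assumes i: "i \<in> carrier A" and integral: "\<And>a. a \<in> carrier A \<Longrightarrow> a \<otimes> i = t\<^sub>L (\<pi>\<^sub>L a) \<otimes> i"
    and normalized: "s\<^sub>L (\<pi>\<^sub>L i) = \<one>"
  shows "casimir_list R A s\<^sub>R (map (\<lambda>(x, y). (x, S y)) (\<Delta>\<^sub>R i))"
proof -
  have left: "list_sum E (\<lambda>(u, v). twisted_coproduct i u v w) (\<Delta>\<^sub>R a) =
      twisted_coproduct i \<one> \<one> (s\<^sub>L (\<pi>\<^sub>L a) \<otimes> w)" if a: "a \<in> carrier A" and w: "w \<in> carrier A" for a w
  proof -
    let ?l = "\<pi>\<^sub>L a"
    have l: "?l \<in> carrier L"
      by (simp add: closed a)
    \<comment> \<open>By \<open>twisted_coproduct_mult\<close> each side depends on its element only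
      through the product of that element with \<open>i\<close>, and the integral property makes
      these products equal.\<close>
    have "list_sum E (\<lambda>(u, v). twisted_coproduct i u v w) (\<Delta>\<^sub>R a) =
        list_sum E (\<lambda>(u, v). twisted_coproduct i u v w) (\<Delta>\<^sub>R (t\<^sub>L ?l))"
      using integral[OF a] a w l by (simp add: twisted_coproduct_mult i closed)
    also have "\<dots> = list_sum E (\<lambda>(u, v). twisted_coproduct i u v w) [(\<one>, t\<^sub>L ?l)]"
    proof (rule test_R[OF sR.comm_group_E _ _ _ coproduct_R_tL[OF l]])
      show "balanced E A A (carrier R) (\<lambda>r x. x \<otimes> s\<^sub>R r) (\<lambda>r y. y \<otimes> t\<^sub>R r)
          (\<lambda>u v. twisted_coproduct i u v w)"
        by (intro balancedI)
          (simp_all add: twisted_coproduct_closed twisted_coproduct_add twisted_coproduct_R i w)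
    qed (use l in \<open>auto simp: closed dest: coproduct_mem\<close>)
    also have "\<dots> = twisted_coproduct i \<one> (t\<^sub>L ?l \<otimes> \<one>) w"
      using l i w by (simp add: closed twisted_coproduct_closed)
    also have "\<dots> = twisted_coproduct i \<one> \<one> (s\<^sub>L ?l \<otimes> w)"
      using l i w by (simp only: twisted_coproduct_L one_closed)
    finally show ?thesis .
  qed
  \<comment> \<open>Mixed coassociativity equates a_(1)^(1) i^(1) \<otimes> S(a_(1)^(2) i^(2)) a_(2)
    with a^(1) i^(1) \<otimes> S(a^(2)_(1) i^(2)) a^(2)_(2). The former collapses by
    \<open>left\<close> and the counit over \<open>L\<close> to (1, 1, a), the latter by
    \<open>twisted_coproduct_antipode\<close> and the counit over \<open>R\<close> to (a, 1,
    1).\<close>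
  have main: "twisted_coproduct i \<one> \<one> a = twisted_coproduct i a \<one> \<one>" if a: "a \<in> carrier A" for a
  proof -
    have "balanced3 E A A A (carrier R) (\<lambda>r x. x \<otimes> s\<^sub>R r) (\<lambda>r y. y \<otimes> t\<^sub>R r)
        (carrier L) (\<lambda>l y. t\<^sub>L l \<otimes> y) (\<lambda>l z. s\<^sub>L l \<otimes> z) (twisted_coproduct i)"
      unfolding balanced3_def
      by (intro conjI ballI balancedI) (simp_all add: twisted_coproduct_closed twisted_coproduct_add
          twisted_coproduct_R twisted_coproduct_L i)
    from test_RL[OF sR.comm_group_E this nested_coproducts_closed(3,4)[OF a a] coassoc_RL[OF a]]
    have "list_sum E (\<lambda>(x, w). list_sum E (\<lambda>(u, v). twisted_coproduct i u v w) (\<Delta>\<^sub>R x)) (\<Delta>\<^sub>L a) =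
        list_sum E (\<lambda>(u, z). list_sum E (\<lambda>(v, w). twisted_coproduct i u v w) (\<Delta>\<^sub>L z)) (\<Delta>\<^sub>R a)"
      by (subst (asm) sR.E.list_sum_nested_pairs[OF coproduct_L_closed[OF a] coproduct_R_closed],
          (auto simp: twisted_coproduct_closed i)[2],
          subst (asm) sR.E.list_sum_nested_pairs[OF coproduct_R_closed[OF a] coproduct_L_closed])
        (auto simp: twisted_coproduct_closed i)
    also have "list_sum E (\<lambda>(x, w). list_sum E (\<lambda>(u, v). twisted_coproduct i u v w) (\<Delta>\<^sub>R x)) (\<Delta>\<^sub>L a) =
        list_sum E (\<lambda>(x, w). twisted_coproduct i \<one> \<one> (s\<^sub>L (\<pi>\<^sub>L x) \<otimes> w)) (\<Delta>\<^sub>L a)"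
      using left by (intro list_sum_pair_cong[OF coproduct_L_closed[OF a]])
    also have "\<dots> = twisted_coproduct i \<one> \<one>
        (list_sum (add_monoid A) (\<lambda>(x, w). s\<^sub>L (\<pi>\<^sub>L x) \<otimes> w) (\<Delta>\<^sub>L a))"
    proof (rule hom_list_sum_pair[symmetric, OF _ a_group sR.E.is_group coproduct_L_closed[OF a]])
      show "twisted_coproduct i \<one> \<one> \<in> hom (add_monoid A) E"
        using i by (auto simp: hom_def twisted_coproduct_closed twisted_coproduct_add)
    qed (auto simp: closed)
    also have "list_sum E (\<lambda>(u, z). list_sum E (\<lambda>(v, w). twisted_coproduct i u v w) (\<Delta>\<^sub>L z)) (\<Delta>\<^sub>R a) =
        list_sum E (\<lambda>(u, z). twisted_coproduct i (u \<otimes> s\<^sub>R (\<pi>\<^sub>R z)) \<one> \<one>) (\<Delta>\<^sub>R a)"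
      using twisted_coproduct_antipode[OF i] by (intro list_sum_pair_cong[OF coproduct_R_closed[OF a]])
    also have "\<dots> = twisted_coproduct i
        (list_sum (add_monoid A) (\<lambda>(u, z). u \<otimes> s\<^sub>R (\<pi>\<^sub>R z)) (\<Delta>\<^sub>R a)) \<one> \<one>"
    proof (rule hom_list_sum_pair[symmetric, OF _ a_group sR.E.is_group coproduct_R_closed[OF a]])
      show "(\<lambda>u. twisted_coproduct i u \<one> \<one>) \<in> hom (add_monoid A) E"
        using i by (auto simp: hom_def twisted_coproduct_closed twisted_coproduct_add)
    qed (auto simp: closed)
    finally show ?thesis
      by (simp add: counit_L_source counit_R_source a)
  qed
  have "list_sum E (\<lambda>(u, v). tensor E (a \<otimes> u, v)) (map (\<lambda>(x, y). (x, S y)) (\<Delta>\<^sub>R i)) =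
      twisted_coproduct i a \<one> \<one>" if "a \<in> carrier A" for a
    unfolding twisted_coproduct_def list_sum_map_pair using that i
    by (intro list_sum_pair_cong[OF coproduct_R_closed]) (auto simp: closed)
  moreover have "list_sum E (\<lambda>(u, v). tensor E (u, v \<otimes> a)) (map (\<lambda>(x, y). (x, S y)) (\<Delta>\<^sub>R i)) =
      twisted_coproduct i \<one> \<one> a" if "a \<in> carrier A" for a
    unfolding twisted_coproduct_def list_sum_map_pair using that i
    by (intro list_sum_pair_cong[OF coproduct_R_closed]) (auto simp: closed)
  moreover have "list_sum (add_monoid A) (\<lambda>(u, v). u \<otimes> v) (map (\<lambda>(x, y). (x, S y)) (\<Delta>\<^sub>R i)) = \<one>"
    using antipode_R[OF i] normalized unfolding list_sum_map_pair by simp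
  ultimately show ?thesis
    unfolding casimir_list_def using main i by (auto simp: closed dest: coproduct_mem)
qed

end

section \<open>Symmetry under passage to the opposite ring\<close>

lemma tensor_product_opposite:
  "tensor_product (opposite A) (opposite A) B \<rho> \<sigma> = tensor_product A A B \<rho> \<sigma>"
  by (simp add: tensor_product_def)

lemma (in tensor_factors) tensor_equiv_swap:
  assumes "tensor_equiv (tensor_product M N B \<rho> \<sigma>) xs ys"
    and "set xs \<subseteq> carrier M \<times> carrier N" "set ys \<subseteq> carrier M \<times> carrier N"
  shows "tensor_equiv (tensor_product N M B \<sigma> \<rho>) (map (\<lambda>(x, y). (y, x)) xs) (map (\<lambda>(x, y). (y, x)) ys)"
proof -
  interpret swap: tensor_factors N M B \<sigma> \<rho>
    by unfold_locales (auto intro: left_closed right_closed)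
  have "balanced (tensor_product N M B \<sigma> \<rho>) M N B \<rho> \<sigma> (\<lambda>x y. tensor (tensor_product N M B \<sigma> \<rho>) (y, x))"
    using balancedD[OF swap.balanced_tensor] by (intro balancedI) auto
  from list_sum_balanced_eq[OF swap.comm_group_tensor_product this assms(2,3)] assms(1)
  show ?thesis
    unfolding tensor_equiv_def list_sum_map_pair by simp
qed

lemma (in tensor_factors3) tensor_equiv_reverse:
  assumes "tensor_equiv (tensor_product3 M N Q B \<rho> \<sigma> C \<rho>' \<sigma>') xs ys"
    and "set xs \<subseteq> carrier M \<times> carrier N \<times> carrier Q" "set ys \<subseteq> carrier M \<times> carrier N \<times> carrier Q"
  shows "tensor_equiv (tensor_product3 Q N M C \<sigma>' \<rho>' B \<sigma> \<rho>)
    (map (\<lambda>(x, y, z). (z, y, x)) xs) (map (\<lambda>(x, y, z). (z, y, x)) ys)"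
proof -
  interpret rev: tensor_factors3 Q N M C \<sigma>' \<rho>' B \<sigma> \<rho>
    by unfold_locales (auto intro: left_closed middle_closed right_closed)
  let ?T = "tensor_product3 Q N M C \<sigma>' \<rho>' B \<sigma> \<rho>"
  have "balanced3 ?T M N Q B \<rho> \<sigma> C \<rho>' \<sigma>' (\<lambda>x y z. tensor ?T (z, y, x))"
    using rev.balanced3_tensor unfolding balanced3_def balanced_def by auto
  from list_sum_balanced3_eq[OF rev.comm_group_tensor_product3 this assms(2,3)] assms(1)
  show ?thesis
    unfolding tensor_equiv_def list_sum_map by (simp add: case_prod_unfold)
qed

text \<open>Reversing the legs together with the product keeps sources and targets in place, in
  contrast to \<open>right_bialgebroid\<close>, where only the product is reversed and the two
  change places. The map \<open>S\<close> is unchanged because its rules for scalars already reverse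
  the order of factors.\<close>

lemma (in sweedler_hopf) opposite_sweedler_hopf:
  "sweedler_hopf (opposite A) R s\<^sub>R t\<^sub>R \<pi>\<^sub>R (\<lambda>a. map (\<lambda>(x, y). (y, x)) (\<Delta>\<^sub>R a))
    L s\<^sub>L t\<^sub>L \<pi>\<^sub>L (\<lambda>a. map (\<lambda>(x, y). (y, x)) (\<Delta>\<^sub>L a)) S"
proof -
  interpret opp: ring "opposite A"
    by (rule ring_opposite) (rule ring_axioms)
  \<comment> \<open>The \<open>LR\<close> product of the opposite ring is the \<open>LR\<close>
    product of \<open>A\<close> with its three factors reversed, and likewise for \<open>RL\<close>.
    So each coassociativity law reproduces itself with its two sides interchanged.\<close>
  have LR: "mixed_tensor_LR (opposite A) R s\<^sub>R t\<^sub>R L s\<^sub>L t\<^sub>L = tensor_product3 A A A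
      (carrier R) (\<lambda>r z. z \<otimes> t\<^sub>R r) (\<lambda>r y. y \<otimes> s\<^sub>R r) (carrier L) (\<lambda>l y. s\<^sub>L l \<otimes> y) (\<lambda>l x. t\<^sub>L l \<otimes> x)"
    and RL: "mixed_tensor_RL (opposite A) R s\<^sub>R t\<^sub>R L s\<^sub>L t\<^sub>L = tensor_product3 A A A
      (carrier L) (\<lambda>l z. s\<^sub>L l \<otimes> z) (\<lambda>l y. t\<^sub>L l \<otimes> y) (carrier R) (\<lambda>r y. y \<otimes> t\<^sub>R r) (\<lambda>r x. x \<otimes> s\<^sub>R r)"
    by (simp_all add: mixed_tensor_LR_def mixed_tensor_RL_def tensor_product3_def)
  let ?swap = "map (\<lambda>(x, y). (y, x)) :: ('a \<times> 'a) list \<Rightarrow> ('a \<times> 'a) list"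
  let ?rev = "map (\<lambda>(x, y, z). (z, y, x)) :: ('a \<times> 'a \<times> 'a) list \<Rightarrow> ('a \<times> 'a \<times> 'a) list"
  let ?TR = "tensor_product A A (carrier R) (\<lambda>r y. y \<otimes> t\<^sub>R r) (\<lambda>r x. x \<otimes> s\<^sub>R r)"
  let ?TL = "tensor_product A A (carrier L) (\<lambda>l y. s\<^sub>L l \<otimes> y) (\<lambda>l x. t\<^sub>L l \<otimes> x)"
  have R1: "tensor_equiv ?TR (?swap (map (\<lambda>(x, y). (x, t\<^sub>R r \<otimes> y)) (\<Delta>\<^sub>R a)))
      (?swap (map (\<lambda>(x, y). (s\<^sub>R r \<otimes> x, y)) (\<Delta>\<^sub>R a)))" if "r \<in> carrier R" "a \<in> carrier A" for r a
    by (rule TR.tensor_equiv_swap[OF takeuchi_R[OF that]]) (use that in \<open>auto simp: closed dest: coproduct_mem\<close>)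
  have L1: "tensor_equiv ?TL (?swap (map (\<lambda>(x, y). (x \<otimes> t\<^sub>L l, y)) (\<Delta>\<^sub>L a)))
      (?swap (map (\<lambda>(x, y). (x, y \<otimes> s\<^sub>L l)) (\<Delta>\<^sub>L a)))" if "l \<in> carrier L" "a \<in> carrier A" for l a
    by (rule TL.tensor_equiv_swap[OF takeuchi_L[OF that]]) (use that in \<open>auto simp: closed dest: coproduct_mem\<close>)
  have R2: "tensor_equiv ?TR (?swap (\<Delta>\<^sub>R (a \<otimes> b)))
      (?swap (concat (map (\<lambda>(u, v). map (\<lambda>(x, y). (u \<otimes> x, v \<otimes> y)) (\<Delta>\<^sub>R b)) (\<Delta>\<^sub>R a))))"
    if "a \<in> carrier A" "b \<in> carrier A" for a b
    by (rule TR.tensor_equiv_swap[OF coproduct_R_mult[OF that] coproduct_R_closed nested_coproducts_closed(6)])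
      (use that in simp_all)
  have L2: "tensor_equiv ?TL (?swap (\<Delta>\<^sub>L (a \<otimes> b)))
      (?swap (concat (map (\<lambda>(u, v). map (\<lambda>(x, y). (x \<otimes> u, y \<otimes> v)) (\<Delta>\<^sub>L a)) (\<Delta>\<^sub>L b))))"
    if "a \<in> carrier A" "b \<in> carrier A" for a b
    by (rule TL.tensor_equiv_swap[OF coproduct_L_mult[OF that] coproduct_L_closed nested_coproducts_closed(5)])
      (use that in simp_all)
  have R3: "tensor_equiv ?TR (?swap (\<Delta>\<^sub>R (s\<^sub>L l))) (?swap [(s\<^sub>L l, \<one>)])"
    "tensor_equiv ?TR (?swap (\<Delta>\<^sub>R (t\<^sub>L l))) (?swap [(\<one>, t\<^sub>L l)])" if "l \<in> carrier L" for l
    by (rule TR.tensor_equiv_swap[OF coproduct_R_sL[OF that] coproduct_R_closed]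
        TR.tensor_equiv_swap[OF coproduct_R_tL[OF that] coproduct_R_closed]; use that in \<open>simp add: closed\<close>)+
  have L3: "tensor_equiv ?TL (?swap (\<Delta>\<^sub>L (s\<^sub>R r))) (?swap [(\<one>, s\<^sub>R r)])"
    "tensor_equiv ?TL (?swap (\<Delta>\<^sub>L (t\<^sub>R r))) (?swap [(t\<^sub>R r, \<one>)])" if "r \<in> carrier R" for r
    by (rule TL.tensor_equiv_swap[OF coproduct_L_sR[OF that] coproduct_L_closed]
        TL.tensor_equiv_swap[OF coproduct_L_tR[OF that] coproduct_L_closed]; use that in \<open>simp add: closed\<close>)+
  have LR': "tensor_equiv (mixed_tensor_LR (opposite A) R s\<^sub>R t\<^sub>R L s\<^sub>L t\<^sub>L)
      (?rev (concat (map (\<lambda>(x, y). map (\<lambda>(u, v). (x, u, v)) (\<Delta>\<^sub>R y)) (\<Delta>\<^sub>L a))))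
      (?rev (concat (map (\<lambda>(x, y). map (\<lambda>(u, v). (u, v, y)) (\<Delta>\<^sub>L x)) (\<Delta>\<^sub>R a))))"
    if "a \<in> carrier A" for a
    unfolding LR
    by (rule LR.tensor_equiv_reverse[OF tensor_equiv_sym[OF coassoc_LR[OF that, unfolded mixed_tensor_LR_def]]
          nested_coproducts_closed(2,1)[OF that that]])
  have RL': "tensor_equiv (mixed_tensor_RL (opposite A) R s\<^sub>R t\<^sub>R L s\<^sub>L t\<^sub>L)
      (?rev (concat (map (\<lambda>(x, y). map (\<lambda>(u, v). (x, u, v)) (\<Delta>\<^sub>L y)) (\<Delta>\<^sub>R a))))
      (?rev (concat (map (\<lambda>(x, y). map (\<lambda>(u, v). (u, v, y)) (\<Delta>\<^sub>R x)) (\<Delta>\<^sub>L a))))"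
    if "a \<in> carrier A" for a
    unfolding RL
    by (rule RL.tensor_equiv_reverse[OF tensor_equiv_sym[OF coassoc_RL[OF that, unfolded mixed_tensor_RL_def]]
          nested_coproducts_closed(4,3)[OF that that]])
  show ?thesis
  proof (intro sweedler_hopf.intro sweedler_hopf_axioms.intro opp.ring_axioms;
      unfold tensor_product_opposite opposite_simps add_monoid_opposite list_sum_map_pair)
    fix a
    assume a: "a \<in> carrier A"
    show "set (?swap (\<Delta>\<^sub>R a)) \<subseteq> carrier A \<times> carrier A" "set (?swap (\<Delta>\<^sub>L a)) \<subseteq> carrier A \<times> carrier A"
      using a by (auto dest: coproduct_mem)
  qed (use R1 L1 R2 L2 R3 L3 LR' RL' antipode_L antipode_R counit_L_source counit_L_target
      counit_R_source counit_R_target in \<open>simp_all add: closed S_hom S_tL_mult S_mult_tL S_tR_mult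
        S_mult_tR piL_mult piR_mult case_prod_unfold comp_def map_concat\<close>)
qed

section \<open>Transport of modules\<close>

text \<open>A copy of \<open>M\<close> on another type, needed because semisimplicity quantifies
  over modules on one fixed type. The fields \<open>mult\<close> and \<open>one\<close> are
  fillers.\<close>

definition transport_module :: "('m \<Rightarrow> 'n) \<Rightarrow> ('a, 'm, 'y) module_scheme \<Rightarrow> ('a, 'n) module"
  where "transport_module \<phi> M = \<lparr>carrier = \<phi> ` carrier M,
    monoid.mult = (\<lambda>x y. x), one = \<phi> \<zero>\<^bsub>M\<^esub>, ring.zero = \<phi> \<zero>\<^bsub>M\<^esub>,
    add = (\<lambda>x y. \<phi> (inv_into (carrier M) \<phi> x \<oplus>\<^bsub>M\<^esub> inv_into (carrier M) \<phi> y)),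
    smult = (\<lambda>a x. \<phi> (a \<odot>\<^bsub>M\<^esub> inv_into (carrier M) \<phi> x))\<rparr>"

lemma transport_module_simps [simp]:
  "carrier (transport_module \<phi> M) = \<phi> ` carrier M"
  "\<zero>\<^bsub>transport_module \<phi> M\<^esub> = \<phi> \<zero>\<^bsub>M\<^esub>"
  by (simp_all add: transport_module_def)

lemma transport_module_operations:
  assumes "inj_on \<phi> (carrier M)" "x \<in> carrier M"
  shows "y \<in> carrier M \<Longrightarrow> \<phi> x \<oplus>\<^bsub>transport_module \<phi> M\<^esub> \<phi> y = \<phi> (x \<oplus>\<^bsub>M\<^esub> y)"
    and "a \<odot>\<^bsub>transport_module \<phi> M\<^esub> \<phi> x = \<phi> (a \<odot>\<^bsub>M\<^esub> x)"
  using assms by (simp_all add: transport_module_def)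

lemma left_module_transport:
  assumes "left_module A M" and inj: "inj_on \<phi> (carrier M)"
  shows "left_module A (transport_module \<phi> M)"
proof -
  interpret left_module A M by fact
  have "abelian_group (transport_module \<phi> M)"
  proof (rule abelian_groupI)
    fix x
    assume "x \<in> carrier (transport_module \<phi> M)"
    then obtain x' where "x' \<in> carrier M" "x = \<phi> x'"
      by auto
    then show "\<exists>y\<in>carrier (transport_module \<phi> M).
        y \<oplus>\<^bsub>transport_module \<phi> M\<^esub> x = \<zero>\<^bsub>transport_module \<phi> M\<^esub>"
      by (intro bexI[of _ "\<phi> (\<ominus>\<^bsub>M\<^esub> x')"]) (auto simp: transport_module_operations[OF inj] M.l_neg)
  qed (auto simp: transport_module_operations[OF inj] M.a_ac)
  then show ?thesis
    by (intro left_module.intro left_module_axioms.intro A.ring_axioms)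
      (auto simp: transport_module_operations[OF inj] act_closed act_add_left act_add_right
        act_assoc act_one)
qed

text \<open>This frees the semisimplicity hypothesis from its universe: source and target may live
  on different types as long as both inject into it. The \<open>B\<close>-section is carried over,
  and the resulting \<open>A\<close>-section is carried back.\<close>

lemma left_semisimple_extension_splits:
  fixes \<phi> :: "'c \<Rightarrow> 'm" and \<psi> :: "'d \<Rightarrow> 'm"
    and M :: "('a, 'c, 'y) module_scheme" and N :: "('a, 'd, 'z) module_scheme"
  assumes semisimple: "left_semisimple_extension TYPE('m) B A \<iota>"
    and M: "left_module A M" "inj_on \<phi> (carrier M)"
    and N: "left_module A N" "inj_on \<psi> (carrier N)"
    and f: "f \<in> linear_maps A N M" "f ` carrier N = carrier M"
    and split: "splits_over B (restrict_scalars \<iota> N) (restrict_scalars \<iota> M) f"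
    and \<iota>: "\<And>b. b \<in> carrier B \<Longrightarrow> \<iota> b \<in> carrier A"
  shows "splits_over A N M f"
proof -
  interpret M: left_module A M by fact
  interpret N: left_module A N by fact
  let ?M = "transport_module \<phi> M" and ?N = "transport_module \<psi> N"
  let ?f = "\<lambda>x. \<phi> (f (inv_into (carrier N) \<psi> x))"
  note ops = transport_module_operations[OF M(2)] transport_module_operations[OF N(2)]
    inv_into_f_f[OF M(2)] inv_into_f_f[OF N(2)]
  note f_simps = linear_mapsD[OF f(1)]
  obtain g where g: "g \<in> linear_maps B (restrict_scalars \<iota> M) (restrict_scalars \<iota> N)"
    and fg: "\<And>x. x \<in> carrier M \<Longrightarrow> f (g x) = x"
    using split unfolding splits_over_def by auto
  note g_simps = linear_mapsD[OF g, simplified]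
  have "?f \<in> linear_maps A ?N ?M"
    by (rule linear_mapsI) (auto simp: ops f_simps N.act_closed)
  moreover have "?f ` carrier ?N = carrier ?M"
  proof -
    have "?f ` carrier ?N = \<phi> ` f ` carrier N"
      by (simp add: ops image_image)
    with f(2) show ?thesis
      by simp
  qed
  moreover have "splits_over B (restrict_scalars \<iota> ?N) (restrict_scalars \<iota> ?M) ?f"
    unfolding splits_over_def
  proof (rule bexI)
    show "(\<lambda>x. \<psi> (g (inv_into (carrier M) \<phi> x))) \<in>
        linear_maps B (restrict_scalars \<iota> ?M) (restrict_scalars \<iota> ?N)"
      by (rule linear_mapsI) (auto simp: ops g_simps \<iota> M.act_closed)
  qed (auto simp: ops g_simps fg)
  ultimately have "splits_over A ?N ?M ?f"
    using semisimple left_module_transport[OF M] left_module_transport[OF N]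
    unfolding left_semisimple_extension_def relatively_projective_def by blast
  then obtain h where h: "h \<in> linear_maps A ?M ?N" and fh: "\<And>x. x \<in> carrier ?M \<Longrightarrow> ?f (h x) = x"
    unfolding splits_over_def by blast
  \<comment> \<open>The inverse of \<psi> is harmless because \<open>h\<close> maps into the copy of
    \<open>N\<close>; this is recorded next, and injectivity of \<psi> then transfers
    linearity.\<close>
  define h' where "h' x = inv_into (carrier N) \<psi> (h (\<phi> x))" for x
  have h': "h' x \<in> carrier N" "h (\<phi> x) = \<psi> (h' x)" if "x \<in> carrier M" for x
  proof -
    have "h (\<phi> x) \<in> \<psi> ` carrier N"
      using linear_mapsD(1)[OF h, of "\<phi> x"] that by simp
    then show "h' x \<in> carrier N" "h (\<phi> x) = \<psi> (h' x)"
      by (auto simp: h'_def ops f_inv_into_f)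
  qed
  have "h' (x \<oplus>\<^bsub>M\<^esub> y) = h' x \<oplus>\<^bsub>N\<^esub> h' y" if "x \<in> carrier M" "y \<in> carrier M" for x y
    using linear_mapsD(2)[OF h, of "\<phi> x" "\<phi> y"] that h' inj_onD[OF N(2), of "h' (x \<oplus>\<^bsub>M\<^esub> y)" "h' x \<oplus>\<^bsub>N\<^esub> h' y"]
    by (simp add: ops)
  moreover have "h' (a \<odot>\<^bsub>M\<^esub> x) = a \<odot>\<^bsub>N\<^esub> h' x" if "a \<in> carrier A" "x \<in> carrier M" for a x
    using linear_mapsD(3)[OF h, of a "\<phi> x"] that h' inj_onD[OF N(2), of "h' (a \<odot>\<^bsub>M\<^esub> x)" "a \<odot>\<^bsub>N\<^esub> h' x"]
    by (simp add: ops M.act_closed N.act_closed)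
  moreover have "f (h' x) = x" if "x \<in> carrier M" for x
    using fh[of "\<phi> x"] h'[OF that] that inj_onD[OF M(2), of "f (h' x)" x] by (simp add: ops f_simps)
  ultimately show ?thesis
    unfolding splits_over_def using h' by (intro bexI[of _ h'] linear_mapsI) auto
qed

section \<open>Integrals and splittings of the counit\<close>

lemma regular_module_simps [simp]:
  "carrier (regular_module A) = carrier A" "add (regular_module A) = add A"
  "a \<odot>\<^bsub>regular_module A\<^esub> x = a \<otimes>\<^bsub>A\<^esub> x"
  by (simp_all add: regular_module_def)

lemma left_base_module_simps [simp]:
  "carrier (left_base_module A L s \<pi>) = carrier L" "add (left_base_module A L s \<pi>) = add L"
  "\<zero>\<^bsub>left_base_module A L s \<pi>\<^esub> = \<zero>\<^bsub>L\<^esub>"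
  "a \<odot>\<^bsub>left_base_module A L s \<pi>\<^esub> l = \<pi> (a \<otimes>\<^bsub>A\<^esub> s l)"
  by (simp_all add: left_base_module_def)

lemma abelian_group_cong:
  assumes "abelian_group M" "carrier N = carrier M" "add N = add M" "\<zero>\<^bsub>N\<^esub> = \<zero>\<^bsub>M\<^esub>"
  shows "abelian_group N"
proof -
  interpret abelian_group M by fact
  show ?thesis
    by (rule abelian_groupI) (use assms(2-4) add.l_inv_ex in \<open>auto simp: a_ac\<close>)
qed

lemma (in ring) left_module_regular: "left_module R (regular_module R)"
proof (intro left_module.intro left_module_axioms.intro ring_axioms)
  show "abelian_group (regular_module R)"
    by (rule abelian_group_cong[OF abelian_group_axioms]) (simp_all add: regular_module_def)
qed (simp_all add: l_distr r_distr m_assoc)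

context left_bialgebroid
begin

lemma ring_total: "ring A" and ring_base: "ring L"
  using total_algebra base_algebra by (auto simp: k_algebra_def)

sublocale A: ring A
  by (rule ring_total)

sublocale L: ring L
  by (rule ring_base)

lemma source_props:
  "l \<in> carrier L \<Longrightarrow> s l \<in> carrier A"
  "\<lbrakk>l \<in> carrier L; l' \<in> carrier L\<rbrakk> \<Longrightarrow> s (l \<oplus>\<^bsub>L\<^esub> l') = s l \<oplus>\<^bsub>A\<^esub> s l'"
  "\<lbrakk>l \<in> carrier L; l' \<in> carrier L\<rbrakk> \<Longrightarrow> s (l \<otimes>\<^bsub>L\<^esub> l') = s l \<otimes>\<^bsub>A\<^esub> s l'"
  "s \<one>\<^bsub>L\<^esub> = \<one>\<^bsub>A\<^esub>"
  using source_hom by (auto simp: algebra_homs_def ring_hom_def)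

lemma target_props:
  "l \<in> carrier L \<Longrightarrow> t l \<in> carrier A"
  "\<lbrakk>l \<in> carrier L; l' \<in> carrier L\<rbrakk> \<Longrightarrow> t (l \<oplus>\<^bsub>L\<^esub> l') = t l \<oplus>\<^bsub>A\<^esub> t l'"
  "\<lbrakk>l \<in> carrier L; l' \<in> carrier L\<rbrakk> \<Longrightarrow> t (l \<otimes>\<^bsub>L\<^esub> l') = t l' \<otimes>\<^bsub>A\<^esub> t l"
  "t \<one>\<^bsub>L\<^esub> = \<one>\<^bsub>A\<^esub>"
  using target_hom by (auto simp: algebra_homs_def ring_hom_def)

lemma counit_props:
  "a \<in> carrier A \<Longrightarrow> \<pi> a \<in> carrier L"
  "\<lbrakk>a \<in> carrier A; b \<in> carrier A\<rbrakk> \<Longrightarrow> \<pi> (a \<oplus>\<^bsub>A\<^esub> b) = \<pi> a \<oplus>\<^bsub>L\<^esub> \<pi> b"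
  using counit_additive by (auto simp: hom_def)

lemma counit_source_mult: "\<lbrakk>l \<in> carrier L; a \<in> carrier A\<rbrakk> \<Longrightarrow> \<pi> (s l \<otimes>\<^bsub>A\<^esub> a) = l \<otimes>\<^bsub>L\<^esub> \<pi> a"
  using counit_bimodule[of l "\<one>\<^bsub>L\<^esub>" a] by (simp add: source_props target_props counit_props)

lemma counit_target_mult: "\<lbrakk>l \<in> carrier L; a \<in> carrier A\<rbrakk> \<Longrightarrow> \<pi> (t l \<otimes>\<^bsub>A\<^esub> a) = \<pi> a \<otimes>\<^bsub>L\<^esub> l"
  using counit_bimodule[of "\<one>\<^bsub>L\<^esub>" l a] by (simp add: source_props target_props counit_props)

lemma counit_source_id: "l \<in> carrier L \<Longrightarrow> \<pi> (s l) = l"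
  using counit_source_mult[of l "\<one>\<^bsub>A\<^esub>"] by (simp add: counit_one source_props)

lemma counit_target_id: "l \<in> carrier L \<Longrightarrow> \<pi> (t l) = l"
  using counit_target_mult[of l "\<one>\<^bsub>A\<^esub>"] by (simp add: counit_one target_props)

lemma counit_mult_source_target:
  "\<lbrakk>a \<in> carrier A; l \<in> carrier L\<rbrakk> \<Longrightarrow> \<pi> (a \<otimes>\<^bsub>A\<^esub> s l) = \<pi> (a \<otimes>\<^bsub>A\<^esub> t l)"
  using counit_target[of a "s l"] by (simp add: counit_source_id source_props)

lemma left_module_base: "left_module A (left_base_module A L s \<pi>)"
proof (intro left_module.intro left_module_axioms.intro ring_total)
  show "abelian_group (left_base_module A L s \<pi>)"
    by (rule abelian_group_cong[OF L.abelian_group_axioms]) (simp_all add: left_base_module_def)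
qed (simp_all add: source_props counit_props A.l_distr A.r_distr counit_source A.m_assoc counit_source_id)

text \<open>Applying the integral equation to \<tau>(\<pi> a), whose counit is again \<pi> a, yields
  \<tau>(\<pi> a) i = \<sigma>(\<pi> a) i = a i. With source and target as \<sigma> and \<tau>, in
  either order, integrals may be described by either map.\<close>

lemma left_integrals_mono:
  assumes "\<And>l. l \<in> carrier L \<Longrightarrow> \<tau> l \<in> carrier A" "\<And>l. l \<in> carrier L \<Longrightarrow> \<pi> (\<tau> l) = l"
  shows "left_integrals A \<sigma> \<pi> \<subseteq> left_integrals A \<tau> \<pi>"
proof
  fix i
  assume "i \<in> left_integrals A \<sigma> \<pi>"
  then have i: "i \<in> carrier A" "\<And>a. a \<in> carrier A \<Longrightarrow> a \<otimes>\<^bsub>A\<^esub> i = \<sigma> (\<pi> a) \<otimes>\<^bsub>A\<^esub> i"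
    unfolding left_integrals_def by blast+
  have "a \<otimes>\<^bsub>A\<^esub> i = \<tau> (\<pi> a) \<otimes>\<^bsub>A\<^esub> i" if "a \<in> carrier A" for a
    using i(2)[OF that] i(2)[OF assms(1), of "\<pi> a"] assms(2) counit_props(1)[OF that] by simp
  with i(1) show "i \<in> left_integrals A \<tau> \<pi>"
    unfolding left_integrals_def by blast
qed

lemma left_integrals_source_target: "left_integrals A s \<pi> = left_integrals A t \<pi>"
  by (intro subset_antisym left_integrals_mono source_props target_props counit_source_id counit_target_id)

text \<open>The module structure on the base is the same for source and target. This matters for
  \<open>R\<close>: its standard module uses \<open>s\<^sub>R\<close>, which is the target of the
  bialgebroid on the opposite algebra.\<close>

lemma splits_over_base_source_target:
  "splits_over A (regular_module A) (left_base_module A L s \<pi>) \<pi> \<longleftrightarrow>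
    splits_over A (regular_module A) (left_base_module A L t \<pi>) \<pi>"
proof -
  have "linear_maps A (left_base_module A L s \<pi>) (regular_module A) =
      linear_maps A (left_base_module A L t \<pi>) (regular_module A)"
    unfolding linear_maps_def by (simp add: counit_mult_source_target)
  then show ?thesis
    unfolding splits_over_def by simp
qed

text \<open>In the base module, a acts on 1 with the same result as s(\<pi> a), namely \<pi> a. For
  a linear section \<open>g\<close> this says that g(1) is an integral. In the other direction l
  \<mapsto> s(l) i is linear by the integral equation for a s(l).\<close>

lemma normalized_integral_iff_splits:
  "(\<exists>i\<in>left_integrals A s \<pi>. \<pi> i = \<one>\<^bsub>L\<^esub>) \<longleftrightarrow>
    splits_over A (regular_module A) (left_base_module A L s \<pi>) \<pi>"
proof
  assume "\<exists>i\<in>left_integrals A s \<pi>. \<pi> i = \<one>\<^bsub>L\<^esub>"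
  then obtain i where i: "i \<in> carrier A" "\<And>a. a \<in> carrier A \<Longrightarrow> a \<otimes>\<^bsub>A\<^esub> i = s (\<pi> a) \<otimes>\<^bsub>A\<^esub> i"
    and "\<pi> i = \<one>\<^bsub>L\<^esub>"
    unfolding left_integrals_def by blast
  have "(\<lambda>l. s l \<otimes>\<^bsub>A\<^esub> i) \<in> linear_maps A (left_base_module A L s \<pi>) (regular_module A)"
  proof (rule linear_mapsI)
    fix a l
    assume "a \<in> carrier A" "l \<in> carrier (left_base_module A L s \<pi>)"
    then show "s (a \<odot>\<^bsub>left_base_module A L s \<pi>\<^esub> l) \<otimes>\<^bsub>A\<^esub> i = a \<odot>\<^bsub>regular_module A\<^esub> (s l \<otimes>\<^bsub>A\<^esub> i)"
      using i(1) i(2)[of "a \<otimes>\<^bsub>A\<^esub> s l"] by (simp add: source_props A.m_assoc)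
  qed (auto simp: i(1) source_props A.l_distr)
  moreover have "\<pi> (s l \<otimes>\<^bsub>A\<^esub> i) = l" if "l \<in> carrier L" for l
    using that by (simp add: counit_source_mult i(1) \<open>\<pi> i = \<one>\<^bsub>L\<^esub>\<close>)
  ultimately show "splits_over A (regular_module A) (left_base_module A L s \<pi>) \<pi>"
    unfolding splits_over_def by (intro bexI[of _ "\<lambda>l. s l \<otimes>\<^bsub>A\<^esub> i"]) simp_all
next
  assume "splits_over A (regular_module A) (left_base_module A L s \<pi>) \<pi>"
  then obtain g where g: "g \<in> linear_maps A (left_base_module A L s \<pi>) (regular_module A)"
    and \<pi>g: "\<And>l. l \<in> carrier L \<Longrightarrow> \<pi> (g l) = l"
    unfolding splits_over_def by auto
  note g_simps = linear_mapsD[OF g, simplified]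
  have "a \<otimes>\<^bsub>A\<^esub> g \<one>\<^bsub>L\<^esub> = s (\<pi> a) \<otimes>\<^bsub>A\<^esub> g \<one>\<^bsub>L\<^esub>" if "a \<in> carrier A" for a
    using g_simps(3)[of a "\<one>\<^bsub>L\<^esub>"] g_simps(3)[of "s (\<pi> a)" "\<one>\<^bsub>L\<^esub>"] that
    by (simp add: source_props counit_props counit_source_id)
  then show "\<exists>i\<in>left_integrals A s \<pi>. \<pi> i = \<one>\<^bsub>L\<^esub>"
    using g_simps(1) \<pi>g unfolding left_integrals_def by (intro bexI[of _ "g \<one>\<^bsub>L\<^esub>"]) auto
qed

text \<open>\<open>j\<close> is the \<open>B\<close>-linear section of the counit required by
  relative projectivity. It is \<open>s\<close> for the extension along the source and
  \<open>t\<close> for the one along the target, and the last assumption on \<open>j\<close> is its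
  \<open>B\<close>-linearity.\<close>

lemma semisimple_imp_splits:
  fixes B :: "('b, 'v) ring_scheme"
  assumes semisimple: "left_semisimple_extension TYPE('a + 'u) B A \<iota>"
    and \<iota>: "\<And>b. b \<in> carrier B \<Longrightarrow> \<iota> b \<in> carrier A"
    and j: "\<And>l. l \<in> carrier L \<Longrightarrow> j l \<in> carrier A" "\<And>l. l \<in> carrier L \<Longrightarrow> \<pi> (j l) = l"
      "\<And>l l'. \<lbrakk>l \<in> carrier L; l' \<in> carrier L\<rbrakk> \<Longrightarrow> j (l \<oplus>\<^bsub>L\<^esub> l') = j l \<oplus>\<^bsub>A\<^esub> j l'"
      "\<And>b l. \<lbrakk>b \<in> carrier B; l \<in> carrier L\<rbrakk> \<Longrightarrow> j (\<pi> (\<iota> b \<otimes>\<^bsub>A\<^esub> s l)) = \<iota> b \<otimes>\<^bsub>A\<^esub> j l"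
  shows "splits_over A (regular_module A) (left_base_module A L s \<pi>) \<pi>"
proof (rule left_semisimple_extension_splits[OF semisimple left_module_base _ A.left_module_regular])
  \<comment> \<open>The base sits in the universe through its image in \<open>A\<close>, since \<pi>
    is a left inverse of \<open>s\<close>; thus the summand \<open>'a\<close> accommodates both
    modules and \<open>'u\<close> may be arbitrary.\<close>
  show "inj_on (\<lambda>l. Inl (s l) :: 'a + 'u) (carrier (left_base_module A L s \<pi>))"
    by (rule inj_on_inverseI[of _ "\<lambda>x. \<pi> (projl x)"]) (simp add: counit_source_id)
  show "inj_on (Inl :: 'a \<Rightarrow> 'a + 'u) (carrier (regular_module A))"
    by simp
  show "\<pi> \<in> linear_maps A (regular_module A) (left_base_module A L s \<pi>)"
    by (rule linear_mapsI) (simp_all add: counit_props counit_source)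
  show "\<pi> ` carrier (regular_module A) = carrier (left_base_module A L s \<pi>)"
  proof
    show "carrier (left_base_module A L s \<pi>) \<subseteq> \<pi> ` carrier (regular_module A)"
      using j(1,2) by (metis image_eqI left_base_module_simps(1) regular_module_simps(1) subsetI)
  qed (auto simp: counit_props)
  show "splits_over B (restrict_scalars \<iota> (regular_module A))
      (restrict_scalars \<iota> (left_base_module A L s \<pi>)) \<pi>"
    unfolding splits_over_def
    by (intro bexI[of _ j] linear_mapsI) (simp_all add: j)
qed (rule \<iota>)

lemma source_semisimple_imp_splits:
  assumes "left_semisimple_extension TYPE('a + 'u) L A s"
  shows "splits_over A (regular_module A) (left_base_module A L s \<pi>) \<pi>"
  by (rule semisimple_imp_splits[OF assms, of s])
    (simp_all add: source_props counit_source_id counit_source_mult)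

lemma target_semisimple_imp_splits:
  assumes "left_semisimple_extension TYPE('a + 'u) (opposite L) A t"
  shows "splits_over A (regular_module A) (left_base_module A L s \<pi>) \<pi>"
  by (rule semisimple_imp_splits[OF assms, of t])
    (simp_all add: source_props target_props counit_source_id counit_target_id counit_target_mult)

end

section \<open>Representing coproducts by lists\<close>

context left_bialgebroid
begin

sublocale T: tensor_factors A A "carrier L" "\<lambda>l x. t l \<otimes>\<^bsub>A\<^esub> x" "\<lambda>l y. s l \<otimes>\<^bsub>A\<^esub> y"
  by unfold_locales (auto simp: source_props target_props)

abbreviation (input) T where "T \<equiv> bialgebroid_tensor A L s t"

lemmas comm_group_T = T.comm_group_tensor_product[folded bialgebroid_tensor_def]
lemmas balanced_tensor_T = T.balanced_tensor[folded bialgebroid_tensor_def]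
lemmas lift_list_sum_T = T.lift_balanced_list_sum[folded bialgebroid_tensor_def]
lemmas lift_tensor_T = T.lift_balanced_tensor[folded bialgebroid_tensor_def]
lemmas tensor_T = balancedD[OF balanced_tensor_T]

text \<open>The choice is made separately for each element and respects no structure, so additivity
  always has to be taken from \<gamma>.\<close>

definition coproduct_list :: "'a \<Rightarrow> ('a \<times> 'a) list" where
  "coproduct_list a = (SOME xs. set xs \<subseteq> carrier A \<times> carrier A \<and> \<gamma> a = list_sum T (tensor T) xs)"

lemma coproduct_list:
  assumes "a \<in> carrier A"
  shows coproduct_list_closed: "set (coproduct_list a) \<subseteq> carrier A \<times> carrier A"
    and coproduct_eq: "\<gamma> a = list_sum T (tensor T) (coproduct_list a)"
proof -
  have "\<gamma> a \<in> carrier T"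
    using coproduct_additive assms by (auto simp: hom_def)
  then have "\<exists>xs. set xs \<subseteq> carrier A \<times> carrier A \<and> \<gamma> a = list_sum T (tensor T) xs"
    using T.tensor_product_list_sum unfolding bialgebroid_tensor_def by blast
  from someI_ex[OF this] show "set (coproduct_list a) \<subseteq> carrier A \<times> carrier A"
    "\<gamma> a = list_sum T (tensor T) (coproduct_list a)"
    unfolding coproduct_list_def by blast+
qed

lemma lift_coproduct:
  assumes "comm_group G" "balanced G A A (carrier L) (\<lambda>l x. t l \<otimes>\<^bsub>A\<^esub> x) (\<lambda>l y. s l \<otimes>\<^bsub>A\<^esub> y) f"
    and "a \<in> carrier A"
  shows "lift G (\<lambda>(x, y). f x y) (\<gamma> a) = list_sum G (\<lambda>(x, y). f x y) (coproduct_list a)"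
  unfolding coproduct_eq[OF assms(3)]
  by (rule lift_list_sum_T[OF assms(1,2) coproduct_list_closed[OF assms(3)]])

lemma tensor_T_target:
  "\<lbrakk>x \<in> carrier A; y \<in> carrier A; l \<in> carrier L\<rbrakk> \<Longrightarrow> tensor T (t l \<otimes>\<^bsub>A\<^esub> x, y) = tensor T (x, s l \<otimes>\<^bsub>A\<^esub> y)"
  by (rule tensor_T(4))

lemma balanced_right_mult:
  assumes "u \<in> carrier A" "v \<in> carrier A"
  shows "balanced T A A (carrier L) (\<lambda>l x. t l \<otimes>\<^bsub>A\<^esub> x) (\<lambda>l y. s l \<otimes>\<^bsub>A\<^esub> y)
    (\<lambda>x y. tensor T (x \<otimes>\<^bsub>A\<^esub> u, y \<otimes>\<^bsub>A\<^esub> v))"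
  using assms
  by (intro balancedI)
    (simp_all add: tensor_T(1-3) A.l_distr A.m_assoc source_props target_props tensor_T_target)

lemma coproduct_list_takeuchi:
  assumes l: "l \<in> carrier L" and a: "a \<in> carrier A"
  shows "list_sum T (\<lambda>(x, y). tensor T (x \<otimes>\<^bsub>A\<^esub> t l, y)) (coproduct_list a) =
    list_sum T (\<lambda>(x, y). tensor T (x, y \<otimes>\<^bsub>A\<^esub> s l)) (coproduct_list a)"
proof -
  have "balanced T A A (carrier L) (\<lambda>l x. t l \<otimes>\<^bsub>A\<^esub> x) (\<lambda>l y. s l \<otimes>\<^bsub>A\<^esub> y)
      (\<lambda>x y. tensor T (x \<otimes>\<^bsub>A\<^esub> t l, y))"
    and "balanced T A A (carrier L) (\<lambda>l x. t l \<otimes>\<^bsub>A\<^esub> x) (\<lambda>l y. s l \<otimes>\<^bsub>A\<^esub> y)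
      (\<lambda>x y. tensor T (x, y \<otimes>\<^bsub>A\<^esub> s l))"
    by (rule balancedI; use l in \<open>simp add: tensor_T(1-3) A.l_distr A.m_assoc source_props
        target_props tensor_T_target\<close>)+
  then show ?thesis
    using coproduct_takeuchi[OF l a] lift_coproduct[OF comm_group_T _ a] by metis
qed

text \<open>This is the well-definedness of the factorwise product by \<gamma> a: a scalar in front
  of u or v stands behind a leg of \<open>a\<close>, where the Takeuchi condition moves it
  across.\<close>

lemma balanced_coproduct_mult:
  assumes a: "a \<in> carrier A"
  shows "balanced T A A (carrier L) (\<lambda>l x. t l \<otimes>\<^bsub>A\<^esub> x) (\<lambda>l y. s l \<otimes>\<^bsub>A\<^esub> y)
    (\<lambda>u v. list_sum T (\<lambda>(x, y). tensor T (x \<otimes>\<^bsub>A\<^esub> u, y \<otimes>\<^bsub>A\<^esub> v)) (coproduct_list a))"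
proof -
  interpret T: comm_group T
    by (rule comm_group_T)
  note sum_closed = T.list_sum_pair_closed[OF coproduct_list_closed[OF a]]
    and sum_mult = T.list_sum_pair_mult[OF coproduct_list_closed[OF a]]
  show ?thesis
  proof (rule balancedI)
    fix l u v
    assume *: "l \<in> carrier L" "u \<in> carrier A" "v \<in> carrier A"
    have bal: "balanced T A A (carrier L) (\<lambda>l x. t l \<otimes>\<^bsub>A\<^esub> x) (\<lambda>l y. s l \<otimes>\<^bsub>A\<^esub> y)
        (\<lambda>x y. tensor T (x \<otimes>\<^bsub>A\<^esub> u, y \<otimes>\<^bsub>A\<^esub> v))"
      using * by (simp add: balanced_right_mult)
    have "list_sum T (\<lambda>(x, y). tensor T (x \<otimes>\<^bsub>A\<^esub> u, y \<otimes>\<^bsub>A\<^esub> v))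
          (map (\<lambda>(x, y). (x \<otimes>\<^bsub>A\<^esub> t l, y)) (coproduct_list a)) =
        list_sum T (\<lambda>(x, y). tensor T (x \<otimes>\<^bsub>A\<^esub> u, y \<otimes>\<^bsub>A\<^esub> v))
          (map (\<lambda>(x, y). (x, y \<otimes>\<^bsub>A\<^esub> s l)) (coproduct_list a))"
      using coproduct_list_closed[OF a] coproduct_list_takeuchi[OF *(1) a] *
      by (intro T.list_sum_balanced_eq[folded bialgebroid_tensor_def, OF comm_group_T bal])
        (auto simp: list_sum_map_pair source_props target_props)
    then show "list_sum T (\<lambda>(x, y). tensor T (x \<otimes>\<^bsub>A\<^esub> (t l \<otimes>\<^bsub>A\<^esub> u), y \<otimes>\<^bsub>A\<^esub> v)) (coproduct_list a) =
        list_sum T (\<lambda>(x, y). tensor T (x \<otimes>\<^bsub>A\<^esub> u, y \<otimes>\<^bsub>A\<^esub> (s l \<otimes>\<^bsub>A\<^esub> v))) (coproduct_list a)"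
      using * unfolding list_sum_map_pair
      by (simp add: A.m_assoc source_props target_props prod.case
          cong: list_sum_pair_cong[OF coproduct_list_closed[OF a]])
  qed (rule sum_closed sum_mult; simp add: tensor_T(1-3) A.r_distr)+
qed

text \<open>The form with \<open>lift\<close> serves when \<gamma> b is a known pure tensor, as for
  sources and targets; the form with lists serves in general.\<close>

lemma coproduct_mult_list_sum:
  assumes a: "a \<in> carrier A" and b: "b \<in> carrier A"
  shows "\<gamma> (a \<otimes>\<^bsub>A\<^esub> b) = lift T
    (\<lambda>(u, v). list_sum T (\<lambda>(x, y). tensor T (x \<otimes>\<^bsub>A\<^esub> u, y \<otimes>\<^bsub>A\<^esub> v)) (coproduct_list a)) (\<gamma> b)"
    and "\<gamma> (a \<otimes>\<^bsub>A\<^esub> b) = list_sum T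
    (\<lambda>(u, v). list_sum T (\<lambda>(x, y). tensor T (x \<otimes>\<^bsub>A\<^esub> u, y \<otimes>\<^bsub>A\<^esub> v)) (coproduct_list a)) (coproduct_list b)"
proof -
  let ?f = "\<lambda>u v. lift T (\<lambda>(x, y). tensor T (x \<otimes>\<^bsub>A\<^esub> u, y \<otimes>\<^bsub>A\<^esub> v)) (\<gamma> a)"
  let ?g = "\<lambda>u v. list_sum T (\<lambda>(x, y). tensor T (x \<otimes>\<^bsub>A\<^esub> u, y \<otimes>\<^bsub>A\<^esub> v)) (coproduct_list a)"
  have fg: "?f u v = ?g u v" if "u \<in> carrier A" "v \<in> carrier A" for u v
    using lift_coproduct[OF comm_group_T balanced_right_mult[OF that] a] .
  note g = balanced_coproduct_mult[OF a]
  \<comment> \<open>The inner lift equals the list sum only for entries in the carrier, so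
    balancedness is transferred instead of rewriting under the outer \<open>lift\<close>.\<close>
  have f: "balanced T A A (carrier L) (\<lambda>l x. t l \<otimes>\<^bsub>A\<^esub> x) (\<lambda>l y. s l \<otimes>\<^bsub>A\<^esub> y) ?f"
    using balancedD[OF g] by (intro balancedI) (simp_all add: fg source_props target_props)
  have "\<gamma> (a \<otimes>\<^bsub>A\<^esub> b) = lift T (\<lambda>(u, v). ?f u v) (\<gamma> b)"
    using coproduct_mult[OF a b] by (simp add: tensor_mult_def)
  also have "\<dots> = list_sum T (\<lambda>(u, v). ?f u v) (coproduct_list b)"
    by (rule lift_coproduct[OF comm_group_T f b])
  also have "\<dots> = list_sum T (\<lambda>(u, v). ?g u v) (coproduct_list b)"
    by (rule list_sum_pair_cong[OF coproduct_list_closed[OF b] fg])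
  finally show "\<gamma> (a \<otimes>\<^bsub>A\<^esub> b) = list_sum T (\<lambda>(u, v). ?g u v) (coproduct_list b)" .
  then show "\<gamma> (a \<otimes>\<^bsub>A\<^esub> b) = lift T (\<lambda>(u, v). ?g u v) (\<gamma> b)"
    by (simp add: lift_coproduct[OF comm_group_T g b])
qed

text \<open>Bilinearity of \<gamma> applied to \<gamma>(1) = 1 \<otimes> 1. Commutation of the two
  ranges makes the two-sided action on the tensor square well defined.\<close>

lemma coproduct_source_target:
  assumes "l \<in> carrier L" "l' \<in> carrier L"
  shows "\<gamma> (s l \<otimes>\<^bsub>A\<^esub> t l') = tensor T (s l, t l')"
proof -
  have "balanced T A A (carrier L) (\<lambda>l x. t l \<otimes>\<^bsub>A\<^esub> x) (\<lambda>l y. s l \<otimes>\<^bsub>A\<^esub> y)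
      (\<lambda>x y. tensor T (s l \<otimes>\<^bsub>A\<^esub> x, t l' \<otimes>\<^bsub>A\<^esub> y))"
  proof (rule balancedI)
    fix m x y
    assume *: "m \<in> carrier L" "x \<in> carrier A" "y \<in> carrier A"
    have "tensor T (s l \<otimes>\<^bsub>A\<^esub> (t m \<otimes>\<^bsub>A\<^esub> x), t l' \<otimes>\<^bsub>A\<^esub> y) = tensor T (t m \<otimes>\<^bsub>A\<^esub> (s l \<otimes>\<^bsub>A\<^esub> x), t l' \<otimes>\<^bsub>A\<^esub> y)"
      using * assms by (simp add: A.m_assoc[symmetric] source_props target_props source_target_commute)
    also have "\<dots> = tensor T (s l \<otimes>\<^bsub>A\<^esub> x, s m \<otimes>\<^bsub>A\<^esub> (t l' \<otimes>\<^bsub>A\<^esub> y))"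
      using * assms by (simp add: tensor_T_target source_props target_props)
    also have "\<dots> = tensor T (s l \<otimes>\<^bsub>A\<^esub> x, t l' \<otimes>\<^bsub>A\<^esub> (s m \<otimes>\<^bsub>A\<^esub> y))"
      using * assms by (simp add: A.m_assoc[symmetric] source_props target_props source_target_commute)
    finally show "tensor T (s l \<otimes>\<^bsub>A\<^esub> (t m \<otimes>\<^bsub>A\<^esub> x), t l' \<otimes>\<^bsub>A\<^esub> y) =
        tensor T (s l \<otimes>\<^bsub>A\<^esub> x, t l' \<otimes>\<^bsub>A\<^esub> (s m \<otimes>\<^bsub>A\<^esub> y))" .
  qed (use assms in \<open>simp_all add: tensor_T(1-3) A.r_distr source_props target_props\<close>)
  from lift_tensor_T[OF comm_group_T this, of "\<one>\<^bsub>A\<^esub>" "\<one>\<^bsub>A\<^esub>"] show ?thesis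
    using coproduct_bimodule[OF assms A.one_closed] assms
    by (simp add: coproduct_one source_props target_props)
qed

lemma coproduct_source: "l \<in> carrier L \<Longrightarrow> \<gamma> (s l) = tensor T (s l, \<one>\<^bsub>A\<^esub>)"
  using coproduct_source_target[of l "\<one>\<^bsub>L\<^esub>"] by (simp add: source_props target_props)

lemma coproduct_target: "l \<in> carrier L \<Longrightarrow> \<gamma> (t l) = tensor T (\<one>\<^bsub>A\<^esub>, t l)"
  using coproduct_source_target[of "\<one>\<^bsub>L\<^esub>" l] by (simp add: source_props target_props)

text \<open>The coproduct of s(l) is pure with second leg 1, so multiplication affects one leg only.
  In a Hopf algebroid such elements are also scalars from the other base, and the formula becomes
  the linearity over that base which the mixed tensor products demand.\<close>

lemma coproduct_mult_source:
  assumes "a \<in> carrier A" "l \<in> carrier L"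
  shows "\<gamma> (a \<otimes>\<^bsub>A\<^esub> s l) =
    list_sum T (tensor T) (map (\<lambda>(x, y). (x \<otimes>\<^bsub>A\<^esub> s l, y)) (coproduct_list a))"
proof -
  have "\<gamma> (a \<otimes>\<^bsub>A\<^esub> s l) =
      list_sum T (\<lambda>(x, y). tensor T (x \<otimes>\<^bsub>A\<^esub> s l, y \<otimes>\<^bsub>A\<^esub> \<one>\<^bsub>A\<^esub>)) (coproduct_list a)"
    using assms lift_tensor_T[OF comm_group_T balanced_coproduct_mult[OF assms(1)]]
    by (simp add: coproduct_mult_list_sum(1) coproduct_source source_props)
  also have "\<dots> = list_sum T (\<lambda>(x, y). tensor T (x \<otimes>\<^bsub>A\<^esub> s l, y)) (coproduct_list a)"
    by (rule list_sum_pair_cong[OF coproduct_list_closed[OF assms(1)]]) simp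
  finally show ?thesis
    by (simp add: list_sum_map_pair)
qed

lemma coproduct_mult_target:
  assumes "a \<in> carrier A" "l \<in> carrier L"
  shows "\<gamma> (a \<otimes>\<^bsub>A\<^esub> t l) =
    list_sum T (tensor T) (map (\<lambda>(x, y). (x, y \<otimes>\<^bsub>A\<^esub> t l)) (coproduct_list a))"
proof -
  have "\<gamma> (a \<otimes>\<^bsub>A\<^esub> t l) =
      list_sum T (\<lambda>(x, y). tensor T (x \<otimes>\<^bsub>A\<^esub> \<one>\<^bsub>A\<^esub>, y \<otimes>\<^bsub>A\<^esub> t l)) (coproduct_list a)"
    using assms lift_tensor_T[OF comm_group_T balanced_coproduct_mult[OF assms(1)]]
    by (simp add: coproduct_mult_list_sum(1) coproduct_target target_props)
  also have "\<dots> = list_sum T (\<lambda>(x, y). tensor T (x, y \<otimes>\<^bsub>A\<^esub> t l)) (coproduct_list a)"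
    by (rule list_sum_pair_cong[OF coproduct_list_closed[OF assms(1)]]) simp
  finally show ?thesis
    by (simp add: list_sum_map_pair)
qed

lemma coproduct_list_mult:
  assumes "a \<in> carrier A" "b \<in> carrier A"
  shows "tensor_equiv T (coproduct_list (a \<otimes>\<^bsub>A\<^esub> b))
    (concat (map (\<lambda>(u, v). map (\<lambda>(x, y). (x \<otimes>\<^bsub>A\<^esub> u, y \<otimes>\<^bsub>A\<^esub> v)) (coproduct_list a)) (coproduct_list b)))"
proof -
  interpret T: comm_group T
    by (rule comm_group_T)
  have "list_sum T (tensor T) (concat (map (\<lambda>(u, v). map (\<lambda>(x, y). (x \<otimes>\<^bsub>A\<^esub> u, y \<otimes>\<^bsub>A\<^esub> v))
      (coproduct_list a)) (coproduct_list b))) = \<gamma> (a \<otimes>\<^bsub>A\<^esub> b)"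
    unfolding coproduct_mult_list_sum(2)[OF assms] using assms
    by (intro T.list_sum_nested_pairs[OF coproduct_list_closed coproduct_list_closed])
      (simp_all add: tensor_T(1))
  then show ?thesis
    using assms by (simp add: tensor_equiv_def coproduct_eq)
qed

lemma coproduct_list_source: "l \<in> carrier L \<Longrightarrow> tensor_equiv T (coproduct_list (s l)) [(s l, \<one>\<^bsub>A\<^esub>)]"
  and coproduct_list_target: "l \<in> carrier L \<Longrightarrow> tensor_equiv T (coproduct_list (t l)) [(\<one>\<^bsub>A\<^esub>, t l)]"
  using monoid.r_one[OF group.is_monoid[OF comm_group.axioms(2)[OF comm_group_T]]]
  by (simp_all add: tensor_equiv_def coproduct_eq[symmetric] coproduct_source coproduct_target
      source_props target_props tensor_T(1))

lemma counit_left_list: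
  assumes "a \<in> carrier A"
  shows "list_sum (add_monoid A) (\<lambda>(x, y). s (\<pi> x) \<otimes>\<^bsub>A\<^esub> y) (coproduct_list a) = a"
proof -
  have "balanced (add_monoid A) A A (carrier L) (\<lambda>l x. t l \<otimes>\<^bsub>A\<^esub> x) (\<lambda>l y. s l \<otimes>\<^bsub>A\<^esub> y)
      (\<lambda>x y. s (\<pi> x) \<otimes>\<^bsub>A\<^esub> y)"
    by (intro balancedI) (simp_all add: source_props target_props counit_props counit_target_mult
        A.l_distr A.r_distr A.m_assoc)
  from lift_coproduct[OF A.a_comm_group this assms] counit_left[OF assms] show ?thesis
    by simp
qed

lemma counit_right_list:
  assumes "a \<in> carrier A"
  shows "list_sum (add_monoid A) (\<lambda>(x, y). t (\<pi> y) \<otimes>\<^bsub>A\<^esub> x) (coproduct_list a) = a"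
proof -
  have "balanced (add_monoid A) A A (carrier L) (\<lambda>l x. t l \<otimes>\<^bsub>A\<^esub> x) (\<lambda>l y. s l \<otimes>\<^bsub>A\<^esub> y)
      (\<lambda>x y. t (\<pi> y) \<otimes>\<^bsub>A\<^esub> x)"
    by (intro balancedI) (simp_all add: source_props target_props counit_props counit_source_mult
        A.l_distr A.r_distr A.m_assoc)
  from lift_coproduct[OF A.a_comm_group this assms] counit_right[OF assms] show ?thesis
    by simp
qed

end

text \<open>The map \<gamma> \<otimes> A exists only if \<gamma> is compatible with the balancing
  over \<open>C\<close>, which involves the second leg of \<gamma>; this is the assumption on
  \<open>\<rho>'\<close>. In the mixed products \<open>C\<close> belongs to the other
  bialgebroid.\<close>

lemma apply_left_list_sum:
  fixes A :: "('a, 'z) ring_scheme"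
  assumes "tensor_factors3 A A A B \<rho> \<sigma> C \<rho>' \<sigma>'"
    and \<Delta>: "\<And>x. x \<in> carrier A \<Longrightarrow> set (\<Delta> x) \<subseteq> carrier A \<times> carrier A"
    and \<gamma>: "\<And>x. x \<in> carrier A
      \<Longrightarrow> \<gamma> x = list_sum (tensor_product A A B \<rho> \<sigma>) (tensor (tensor_product A A B \<rho> \<sigma>)) (\<Delta> x)"
    and \<gamma>_hom: "\<gamma> \<in> hom (add_monoid A) (tensor_product A A B \<rho> \<sigma>)"
    and \<gamma>_\<rho>': "\<And>c x. \<lbrakk>c \<in> C; x \<in> carrier A\<rbrakk> \<Longrightarrow> \<gamma> (\<rho>' c x) =
      list_sum (tensor_product A A B \<rho> \<sigma>) (tensor (tensor_product A A B \<rho> \<sigma>))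
        (map (\<lambda>(u, v). (u, \<rho>' c v)) (\<Delta> x))"
    and xs: "set xs \<subseteq> carrier A \<times> carrier A"
  defines "T \<equiv> tensor_product3 A A A B \<rho> \<sigma> C \<rho>' \<sigma>'"
  shows "apply_left T \<gamma> (list_sum (tensor_product A A C \<rho>' \<sigma>') (tensor (tensor_product A A C \<rho>' \<sigma>')) xs) =
    list_sum T (tensor T) (concat (map (\<lambda>(x, y). map (\<lambda>(u, v). (u, v, y)) (\<Delta> x)) xs))"
proof -
  interpret F: tensor_factors3 A A A B \<rho> \<sigma> C \<rho>' \<sigma>' by fact
  interpret T1: tensor_factors A A B \<rho> \<sigma>
    by unfold_locales (auto intro: F.left_closed F.middle_closed)
  interpret T2: tensor_factors A A C \<rho>' \<sigma>'
    by unfold_locales (auto intro: F.middle_closed F.right_closed)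
  interpret T: comm_group T
    unfolding T_def by (rule F.comm_group_tensor_product3)
  have bal: "balanced T A A B \<rho> \<sigma> (\<lambda>u v. tensor T (u, v, y))" if "y \<in> carrier A" for y
    using F.balanced3_tensor that unfolding balanced3_def T_def by blast
  have bal': "balanced T A A C \<rho>' \<sigma>' (\<lambda>v y. tensor T (u, v, y))" if "u \<in> carrier A" for u
    using F.balanced3_tensor that unfolding balanced3_def T_def by blast
  let ?h = "\<lambda>x y. lift T (\<lambda>(u, v). tensor T (u, v, y)) (\<gamma> x)"
  have h: "?h x y = list_sum T (\<lambda>(u, v). tensor T (u, v, y)) (\<Delta> x)"
    if "x \<in> carrier A" "y \<in> carrier A" for x y
    unfolding \<gamma>[OF that(1)] by (rule T1.lift_balanced_list_sum[OF T.comm_group_axioms bal \<Delta>]) fact+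
  note sum_closed = T.list_sum_pair_closed[OF \<Delta>] and sum_mult = T.list_sum_pair_mult[OF \<Delta>]
  have "balanced T A A C \<rho>' \<sigma>' ?h"
  proof (rule balancedI)
    fix x y
    assume "x \<in> carrier A" "y \<in> carrier A"
    then show "?h x y \<in> carrier T"
      unfolding h[OF \<open>x \<in> carrier A\<close> \<open>y \<in> carrier A\<close>] by (intro sum_closed) (auto simp: balancedD(1)[OF bal])
  next
    fix x x' y
    assume *: "x \<in> carrier A" "x' \<in> carrier A" "y \<in> carrier A"
    \<comment> \<open>The list of a sum is unrelated to the lists of its summands, so additivity in
      the first argument has to come from \<gamma> itself.\<close>
    then have "\<gamma> (x \<oplus>\<^bsub>A\<^esub> x') = \<gamma> x \<otimes>\<^bsub>tensor_product A A B \<rho> \<sigma>\<^esub> \<gamma> x'" "\<gamma> x \<in> carrier (tensor_product A A B \<rho> \<sigma>)"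
      "\<gamma> x' \<in> carrier (tensor_product A A B \<rho> \<sigma>)"
      using \<gamma>_hom by (auto simp: hom_def)
    then show "?h (x \<oplus>\<^bsub>A\<^esub> x') y = ?h x y \<otimes>\<^bsub>T\<^esub> ?h x' y"
      using hom_mult[OF T1.lift_balanced_hom[OF T.comm_group_axioms bal[OF *(3)]]] by simp
  next
    fix x y y'
    assume *: "x \<in> carrier A" "y \<in> carrier A" "y' \<in> carrier A"
    then have yy': "y \<oplus>\<^bsub>A\<^esub> y' \<in> carrier A"
      by simp
    show "?h x (y \<oplus>\<^bsub>A\<^esub> y') = ?h x y \<otimes>\<^bsub>T\<^esub> ?h x y'"
      unfolding h[OF *(1) yy'] h[OF *(1,2)] h[OF *(1,3)] using *
      by (intro sum_mult) (simp_all add: balancedD(1,3)[OF bal'])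
  next
    fix c x y
    assume *: "c \<in> C" "x \<in> carrier A" "y \<in> carrier A"
    have cy: "\<sigma>' c y \<in> carrier A"
      using * by (simp add: F.right_closed)
    \<comment> \<open>The scalar passes from \<open>x\<close> to the second leg of \<gamma> x, and
      from there across the outer tensor sign to \<open>y\<close>.\<close>
    have "?h (\<rho>' c x) y = list_sum T (\<lambda>(u, v). tensor T (u, v, y)) (map (\<lambda>(u, v). (u, \<rho>' c v)) (\<Delta> x))"
      unfolding \<gamma>_\<rho>'[OF *(1,2)] using \<Delta>[OF *(2)] *
      by (intro T1.lift_balanced_list_sum[OF T.comm_group_axioms bal]) (auto intro: F.middle_closed)
    also have "\<dots> = ?h x (\<sigma>' c y)"
      unfolding h[OF *(2) cy] list_sum_map_pair using *
      by (intro list_sum_pair_cong[OF \<Delta>]) (simp_all add: balancedD(4)[OF bal'])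
    finally show "?h (\<rho>' c x) y = ?h x (\<sigma>' c y)" .
  qed
  from T2.lift_balanced_list_sum[OF T.comm_group_axioms this xs]
  have "apply_left T \<gamma> (list_sum (tensor_product A A C \<rho>' \<sigma>') (tensor (tensor_product A A C \<rho>' \<sigma>')) xs) =
      list_sum T (\<lambda>(x, y). ?h x y) xs"
    by (simp add: apply_left_def)
  also have "\<dots> = list_sum T (\<lambda>(x, y). list_sum T (\<lambda>(u, v). tensor T (u, v, y)) (\<Delta> x)) xs"
    by (rule list_sum_pair_cong[OF xs h])
  also have "\<dots> = list_sum T (tensor T) (concat (map (\<lambda>(x, y). map (\<lambda>(u, v). (u, v, y)) (\<Delta> x)) xs))"
    by (rule T.list_sum_nested_pairs[symmetric, OF xs \<Delta>]) (simp_all add: balancedD(1)[OF bal])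
  finally show ?thesis .
qed

lemma apply_right_list_sum:
  fixes A :: "('a, 'z) ring_scheme"
  assumes "tensor_factors3 A A A B \<rho> \<sigma> C \<rho>' \<sigma>'"
    and \<Delta>: "\<And>x. x \<in> carrier A \<Longrightarrow> set (\<Delta> x) \<subseteq> carrier A \<times> carrier A"
    and \<gamma>: "\<And>x. x \<in> carrier A
      \<Longrightarrow> \<gamma> x = list_sum (tensor_product A A C \<rho>' \<sigma>') (tensor (tensor_product A A C \<rho>' \<sigma>')) (\<Delta> x)"
    and \<gamma>_hom: "\<gamma> \<in> hom (add_monoid A) (tensor_product A A C \<rho>' \<sigma>')"
    and \<gamma>_\<sigma>: "\<And>b y. \<lbrakk>b \<in> B; y \<in> carrier A\<rbrakk> \<Longrightarrow> \<gamma> (\<sigma> b y) =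
      list_sum (tensor_product A A C \<rho>' \<sigma>') (tensor (tensor_product A A C \<rho>' \<sigma>'))
        (map (\<lambda>(u, v). (\<sigma> b u, v)) (\<Delta> y))"
    and xs: "set xs \<subseteq> carrier A \<times> carrier A"
  defines "T \<equiv> tensor_product3 A A A B \<rho> \<sigma> C \<rho>' \<sigma>'"
  shows "apply_right T \<gamma> (list_sum (tensor_product A A B \<rho> \<sigma>) (tensor (tensor_product A A B \<rho> \<sigma>)) xs) =
    list_sum T (tensor T) (concat (map (\<lambda>(x, y). map (\<lambda>(u, v). (x, u, v)) (\<Delta> y)) xs))"
proof -
  interpret F: tensor_factors3 A A A B \<rho> \<sigma> C \<rho>' \<sigma>' by fact
  interpret T1: tensor_factors A A B \<rho> \<sigma>
    by unfold_locales (auto intro: F.left_closed F.middle_closed)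
  interpret T2: tensor_factors A A C \<rho>' \<sigma>'
    by unfold_locales (auto intro: F.middle_closed F.right_closed)
  interpret T: comm_group T
    unfolding T_def by (rule F.comm_group_tensor_product3)
  have bal: "balanced T A A B \<rho> \<sigma> (\<lambda>u v. tensor T (u, v, y))" if "y \<in> carrier A" for y
    using F.balanced3_tensor that unfolding balanced3_def T_def by blast
  have bal': "balanced T A A C \<rho>' \<sigma>' (\<lambda>v y. tensor T (u, v, y))" if "u \<in> carrier A" for u
    using F.balanced3_tensor that unfolding balanced3_def T_def by blast
  let ?h = "\<lambda>x y. lift T (\<lambda>(u, v). tensor T (x, u, v)) (\<gamma> y)"
  have h: "?h x y = list_sum T (\<lambda>(u, v). tensor T (x, u, v)) (\<Delta> y)"
    if "x \<in> carrier A" "y \<in> carrier A" for x y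
    unfolding \<gamma>[OF that(2)] by (rule T2.lift_balanced_list_sum[OF T.comm_group_axioms bal' \<Delta>]) fact+
  note sum_closed = T.list_sum_pair_closed[OF \<Delta>] and sum_mult = T.list_sum_pair_mult[OF \<Delta>]
  have "balanced T A A B \<rho> \<sigma> ?h"
  proof (rule balancedI)
    fix x y
    assume "x \<in> carrier A" "y \<in> carrier A"
    then show "?h x y \<in> carrier T"
      unfolding h[OF \<open>x \<in> carrier A\<close> \<open>y \<in> carrier A\<close>] by (intro sum_closed) (auto simp: balancedD(1)[OF bal])
  next
    fix x y y'
    assume *: "x \<in> carrier A" "y \<in> carrier A" "y' \<in> carrier A"
    then have "\<gamma> (y \<oplus>\<^bsub>A\<^esub> y') = \<gamma> y \<otimes>\<^bsub>tensor_product A A C \<rho>' \<sigma>'\<^esub> \<gamma> y'"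
      "\<gamma> y \<in> carrier (tensor_product A A C \<rho>' \<sigma>')" "\<gamma> y' \<in> carrier (tensor_product A A C \<rho>' \<sigma>')"
      using \<gamma>_hom by (auto simp: hom_def)
    then show "?h x (y \<oplus>\<^bsub>A\<^esub> y') = ?h x y \<otimes>\<^bsub>T\<^esub> ?h x y'"
      using hom_mult[OF T2.lift_balanced_hom[OF T.comm_group_axioms bal'[OF *(1)]]] by simp
  next
    fix x x' y
    assume *: "x \<in> carrier A" "x' \<in> carrier A" "y \<in> carrier A"
    then have xx': "x \<oplus>\<^bsub>A\<^esub> x' \<in> carrier A"
      by simp
    show "?h (x \<oplus>\<^bsub>A\<^esub> x') y = ?h x y \<otimes>\<^bsub>T\<^esub> ?h x' y"
      unfolding h[OF xx' *(3)] h[OF *(1,3)] h[OF *(2,3)] using *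
      by (intro sum_mult) (simp_all add: balancedD(1,2)[OF bal])
  next
    fix b x y
    assume *: "b \<in> B" "x \<in> carrier A" "y \<in> carrier A"
    have bx: "\<rho> b x \<in> carrier A"
      using * by (simp add: F.left_closed)
    have "?h x (\<sigma> b y) = list_sum T (\<lambda>(u, v). tensor T (x, u, v)) (map (\<lambda>(u, v). (\<sigma> b u, v)) (\<Delta> y))"
      unfolding \<gamma>_\<sigma>[OF *(1,3)] using \<Delta>[OF *(3)] *
      by (intro T2.lift_balanced_list_sum[OF T.comm_group_axioms bal']) (auto intro: F.middle_closed)
    also have "\<dots> = ?h (\<rho> b x) y"
      unfolding h[OF bx *(3)] list_sum_map_pair using *
      by (intro list_sum_pair_cong[OF \<Delta>]) (simp_all add: balancedD(4)[OF bal])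
    finally show "?h (\<rho> b x) y = ?h x (\<sigma> b y)"
      by simp
  qed
  from T1.lift_balanced_list_sum[OF T.comm_group_axioms this xs]
  have "apply_right T \<gamma> (list_sum (tensor_product A A B \<rho> \<sigma>) (tensor (tensor_product A A B \<rho> \<sigma>)) xs) =
      list_sum T (\<lambda>(x, y). ?h x y) xs"
    by (simp add: apply_right_def)
  also have "\<dots> = list_sum T (\<lambda>(x, y). list_sum T (\<lambda>(u, v). tensor T (x, u, v)) (\<Delta> y)) xs"
    by (rule list_sum_pair_cong[OF xs h])
  also have "\<dots> = list_sum T (tensor T) (concat (map (\<lambda>(x, y). map (\<lambda>(u, v). (x, u, v)) (\<Delta> y)) xs))"
    by (rule T.list_sum_nested_pairs[symmetric, OF xs \<Delta>]) (simp_all add: balancedD(1)[OF bal])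
  finally show ?thesis .
qed

section \<open>Hopf algebroids\<close>

lemma (in hopf_algebroid) opposite_right_bialgebroid:
  "left_bialgebroid K (opposite A) R t\<^sub>R s\<^sub>R \<gamma>\<^sub>R \<pi>\<^sub>R"
  using right_bialgebroid by (simp add: right_bialgebroid_def)

text \<open>Facts about the right coproduct are facts about the left bialgebroid on
  \<open>opposite A\<close>. Its tensor square keeps the order of the legs, so its lists can be used
  directly, with every product read backwards.\<close>

lemma (in hopf_algebroid) sweedler_hopf:
  "sweedler_hopf A L s\<^sub>L t\<^sub>L \<pi>\<^sub>L (left_bialgebroid.coproduct_list A L s\<^sub>L t\<^sub>L \<gamma>\<^sub>L)
    R s\<^sub>R t\<^sub>R \<pi>\<^sub>R (left_bialgebroid.coproduct_list (opposite A) R t\<^sub>R s\<^sub>R \<gamma>\<^sub>R) S"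
proof -
  interpret Lb: left_bialgebroid K A L s\<^sub>L t\<^sub>L \<gamma>\<^sub>L \<pi>\<^sub>L
    by (rule left_bialgebroid)
  interpret Rb: left_bialgebroid K "opposite A" R t\<^sub>R s\<^sub>R \<gamma>\<^sub>R \<pi>\<^sub>R
    by (rule opposite_right_bialgebroid)
  let ?\<Delta>\<^sub>L = "Lb.coproduct_list" and ?\<Delta>\<^sub>R = "Rb.coproduct_list"
  let ?TL = "tensor_product A A (carrier L) (\<lambda>l x. t\<^sub>L l \<otimes>\<^bsub>A\<^esub> x) (\<lambda>l y. s\<^sub>L l \<otimes>\<^bsub>A\<^esub> y)"
  let ?TR = "tensor_product A A (carrier R) (\<lambda>r x. x \<otimes>\<^bsub>A\<^esub> s\<^sub>R r) (\<lambda>r y. y \<otimes>\<^bsub>A\<^esub> t\<^sub>R r)"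
  have TL: "bialgebroid_tensor A L s\<^sub>L t\<^sub>L = ?TL"
    by (simp add: bialgebroid_tensor_def)
  have TR: "bialgebroid_tensor (opposite A) R t\<^sub>R s\<^sub>R = ?TR"
    by (simp add: bialgebroid_tensor_def tensor_product_opposite)
  note R_props = Rb.source_props[simplified] Rb.target_props[simplified] Rb.counit_props[simplified]
  note closed = Lb.source_props(1) Lb.target_props(1) Lb.counit_props(1) R_props(1,5,9)
  note \<Delta>L = Lb.coproduct_list_closed and \<Delta>R = Rb.coproduct_list_closed[simplified]
  note \<gamma>L = Lb.coproduct_eq[unfolded TL] and \<gamma>R = Rb.coproduct_eq[unfolded TR, simplified]
  have \<gamma>L_hom: "\<gamma>\<^sub>L \<in> hom (add_monoid A) ?TL"
    using Lb.coproduct_additive by (simp add: TL)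
  have \<gamma>R_hom: "\<gamma>\<^sub>R \<in> hom (add_monoid A) ?TR"
    using Rb.coproduct_additive by (simp add: TR)
  \<comment> \<open>Axiom (i) turns each scalar from one base into a scalar from the other, so that
    the one-leg formulas of either bialgebroid apply to the scalars of both.\<close>
  have tR: "t\<^sub>R r = s\<^sub>L (\<pi>\<^sub>L (t\<^sub>R r))" "\<pi>\<^sub>L (t\<^sub>R r) \<in> carrier L" if "r \<in> carrier R" for r
    using that by (simp_all add: sL_piL_tR closed)
  have sR: "s\<^sub>R r = t\<^sub>L (\<pi>\<^sub>L (s\<^sub>R r))" "\<pi>\<^sub>L (s\<^sub>R r) \<in> carrier L" if "r \<in> carrier R" for r
    using that by (simp_all add: tL_piL_sR closed)
  have tL: "t\<^sub>L l = s\<^sub>R (\<pi>\<^sub>R (t\<^sub>L l))" "\<pi>\<^sub>R (t\<^sub>L l) \<in> carrier R" if "l \<in> carrier L" for l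
    using that by (simp_all add: sR_piR_tL closed)
  have sL: "s\<^sub>L l = t\<^sub>R (\<pi>\<^sub>R (s\<^sub>L l))" "\<pi>\<^sub>R (s\<^sub>L l) \<in> carrier R" if "l \<in> carrier L" for l
    using that by (simp_all add: tR_piR_sL closed)
  have S_hom: "S \<in> hom (add_monoid A) (add_monoid A)"
    using antipode_linear by (simp add: linear_maps_def)
  have S: "S a \<in> carrier A" "S (a \<oplus>\<^bsub>A\<^esub> b) = S a \<oplus>\<^bsub>A\<^esub> S b" if "a \<in> carrier A" "b \<in> carrier A" for a b
    using S_hom that by (auto simp: hom_def)
  have S_tL: "S (t\<^sub>L l \<otimes>\<^bsub>A\<^esub> a) = S a \<otimes>\<^bsub>A\<^esub> s\<^sub>L l" "S (a \<otimes>\<^bsub>A\<^esub> t\<^sub>L l) = s\<^sub>L l \<otimes>\<^bsub>A\<^esub> S a"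
    if "l \<in> carrier L" "a \<in> carrier A" for l a
    using antipode_tL[of "\<one>\<^bsub>L\<^esub>" l a] antipode_tL[of l "\<one>\<^bsub>L\<^esub>" a] that
    by (simp_all add: Lb.source_props Lb.target_props S)
  have S_tR: "S (t\<^sub>R r \<otimes>\<^bsub>A\<^esub> a) = S a \<otimes>\<^bsub>A\<^esub> s\<^sub>R r" "S (a \<otimes>\<^bsub>A\<^esub> t\<^sub>R r) = s\<^sub>R r \<otimes>\<^bsub>A\<^esub> S a"
    if "r \<in> carrier R" "a \<in> carrier A" for r a
    using antipode_tR[of "\<one>\<^bsub>R\<^esub>" r a] antipode_tR[of r "\<one>\<^bsub>R\<^esub>" a] that
    by (simp_all add: R_props S)
  interpret FR: tensor_factors A A "carrier R" "\<lambda>r x. x \<otimes>\<^bsub>A\<^esub> s\<^sub>R r" "\<lambda>r y. y \<otimes>\<^bsub>A\<^esub> t\<^sub>R r"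
    by unfold_locales (simp_all add: closed)
  have F_LR: "tensor_factors3 A A A (carrier L) (\<lambda>l x. t\<^sub>L l \<otimes>\<^bsub>A\<^esub> x) (\<lambda>l y. s\<^sub>L l \<otimes>\<^bsub>A\<^esub> y)
      (carrier R) (\<lambda>r y. y \<otimes>\<^bsub>A\<^esub> s\<^sub>R r) (\<lambda>r z. z \<otimes>\<^bsub>A\<^esub> t\<^sub>R r)"
    by unfold_locales (simp_all add: closed)
  have F_RL: "tensor_factors3 A A A (carrier R) (\<lambda>r x. x \<otimes>\<^bsub>A\<^esub> s\<^sub>R r) (\<lambda>r y. y \<otimes>\<^bsub>A\<^esub> t\<^sub>R r)
      (carrier L) (\<lambda>l y. t\<^sub>L l \<otimes>\<^bsub>A\<^esub> y) (\<lambda>l z. s\<^sub>L l \<otimes>\<^bsub>A\<^esub> z)"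
    by unfold_locales (simp_all add: closed)
  \<comment> \<open>As \<open>s\<^sub>R r\<close> is a value of \<open>t\<^sub>L\<close>,
    multiplying by it on the right touches only the second leg of the left coproduct.\<close>
  have \<gamma>L_sR: "\<gamma>\<^sub>L (x \<otimes>\<^bsub>A\<^esub> s\<^sub>R r) = list_sum ?TL (tensor ?TL) (map (\<lambda>(u, v). (u, v \<otimes>\<^bsub>A\<^esub> s\<^sub>R r)) (?\<Delta>\<^sub>L x))"
    if "r \<in> carrier R" "x \<in> carrier A" for r x
    using Lb.coproduct_mult_target[of x "\<pi>\<^sub>L (s\<^sub>R r)"] that sR[OF that(1)] by (simp add: TL)
  have \<gamma>L_tR: "\<gamma>\<^sub>L (x \<otimes>\<^bsub>A\<^esub> t\<^sub>R r) = list_sum ?TL (tensor ?TL) (map (\<lambda>(u, v). (u \<otimes>\<^bsub>A\<^esub> t\<^sub>R r, v)) (?\<Delta>\<^sub>L x))"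
    if "r \<in> carrier R" "x \<in> carrier A" for r x
    using Lb.coproduct_mult_source[of x "\<pi>\<^sub>L (t\<^sub>R r)"] that tR[OF that(1)] by (simp add: TL)
  have \<gamma>R_tL: "\<gamma>\<^sub>R (t\<^sub>L l \<otimes>\<^bsub>A\<^esub> x) = list_sum ?TR (tensor ?TR) (map (\<lambda>(u, v). (u, t\<^sub>L l \<otimes>\<^bsub>A\<^esub> v)) (?\<Delta>\<^sub>R x))"
    if "l \<in> carrier L" "x \<in> carrier A" for l x
    using Rb.coproduct_mult_target[of x "\<pi>\<^sub>R (t\<^sub>L l)"] that tL[OF that(1)] by (simp add: TR)
  have \<gamma>R_sL: "\<gamma>\<^sub>R (s\<^sub>L l \<otimes>\<^bsub>A\<^esub> x) = list_sum ?TR (tensor ?TR) (map (\<lambda>(u, v). (s\<^sub>L l \<otimes>\<^bsub>A\<^esub> u, v)) (?\<Delta>\<^sub>R x))"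
    if "l \<in> carrier L" "x \<in> carrier A" for l x
    using Rb.coproduct_mult_source[of x "\<pi>\<^sub>R (s\<^sub>L l)"] that sL[OF that(1)] by (simp add: TR)
  show ?thesis
  proof (intro sweedler_hopf.intro sweedler_hopf_axioms.intro)
    fix a
    assume a: "a \<in> carrier A"
    have "balanced (add_monoid A) A A (carrier L) (\<lambda>l x. t\<^sub>L l \<otimes>\<^bsub>A\<^esub> x) (\<lambda>l y. s\<^sub>L l \<otimes>\<^bsub>A\<^esub> y)
        (\<lambda>x y. S x \<otimes>\<^bsub>A\<^esub> y)"
      by (intro balancedI) (simp_all add: S S_tL closed Lb.A.l_distr Lb.A.r_distr Lb.A.m_assoc)
    from Lb.lift_coproduct[OF Lb.A.a_comm_group this a] antipode_left[OF a]
    show "list_sum (add_monoid A) (\<lambda>(x, y). S x \<otimes>\<^bsub>A\<^esub> y) (?\<Delta>\<^sub>L a) = s\<^sub>R (\<pi>\<^sub>R a)"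
      by simp
    have "balanced (add_monoid A) A A (carrier R) (\<lambda>r x. x \<otimes>\<^bsub>A\<^esub> s\<^sub>R r) (\<lambda>r y. y \<otimes>\<^bsub>A\<^esub> t\<^sub>R r)
        (\<lambda>x y. x \<otimes>\<^bsub>A\<^esub> S y)"
      by (intro balancedI) (simp_all add: S S_tR closed Lb.A.l_distr Lb.A.r_distr Lb.A.m_assoc)
    from FR.lift_balanced_list_sum[OF Lb.A.a_comm_group this \<Delta>R[OF a]] antipode_right[OF a]
    show "list_sum (add_monoid A) (\<lambda>(x, y). x \<otimes>\<^bsub>A\<^esub> S y) (?\<Delta>\<^sub>R a) = s\<^sub>L (\<pi>\<^sub>L a)"
      by (simp add: \<gamma>R[OF a])
    show "tensor_equiv (mixed_tensor_LR A L s\<^sub>L t\<^sub>L R s\<^sub>R t\<^sub>R)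
        (concat (map (\<lambda>(x, y). map (\<lambda>(u, v). (u, v, y)) (?\<Delta>\<^sub>L x)) (?\<Delta>\<^sub>R a)))
        (concat (map (\<lambda>(x, y). map (\<lambda>(u, v). (x, u, v)) (?\<Delta>\<^sub>R y)) (?\<Delta>\<^sub>L a)))"
      using mixed_coassociative_LR[OF a]
        apply_left_list_sum[OF F_LR \<Delta>L \<gamma>L \<gamma>L_hom \<gamma>L_sR \<Delta>R[OF a]]
        apply_right_list_sum[OF F_LR \<Delta>R \<gamma>R \<gamma>R_hom \<gamma>R_sL \<Delta>L[OF a]]
      unfolding tensor_equiv_def mixed_tensor_LR_def \<gamma>L[OF a] \<gamma>R[OF a] by simp
    show "tensor_equiv (mixed_tensor_RL A L s\<^sub>L t\<^sub>L R s\<^sub>R t\<^sub>R)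
        (concat (map (\<lambda>(x, y). map (\<lambda>(u, v). (u, v, y)) (?\<Delta>\<^sub>R x)) (?\<Delta>\<^sub>L a)))
        (concat (map (\<lambda>(x, y). map (\<lambda>(u, v). (x, u, v)) (?\<Delta>\<^sub>L y)) (?\<Delta>\<^sub>R a)))"
      using mixed_coassociative_RL[OF a]
        apply_left_list_sum[OF F_RL \<Delta>R \<gamma>R \<gamma>R_hom \<gamma>R_tL \<Delta>L[OF a]]
        apply_right_list_sum[OF F_RL \<Delta>L \<gamma>L \<gamma>L_hom \<gamma>L_tR \<Delta>R[OF a]]
      unfolding tensor_equiv_def mixed_tensor_RL_def \<gamma>L[OF a] \<gamma>R[OF a] by simp
  next
    fix r
    assume r: "r \<in> carrier R"
    show "tensor_equiv ?TL (?\<Delta>\<^sub>L (s\<^sub>R r)) [(\<one>\<^bsub>A\<^esub>, s\<^sub>R r)]"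
      using Lb.coproduct_list_target[OF sR(2)[OF r]] sR(1)[OF r] by (simp add: TL)
    show "tensor_equiv ?TL (?\<Delta>\<^sub>L (t\<^sub>R r)) [(t\<^sub>R r, \<one>\<^bsub>A\<^esub>)]"
      using Lb.coproduct_list_source[OF tR(2)[OF r]] tR(1)[OF r] by (simp add: TL)
  next
    fix l
    assume l: "l \<in> carrier L"
    show "tensor_equiv ?TR (?\<Delta>\<^sub>R (s\<^sub>L l)) [(s\<^sub>L l, \<one>\<^bsub>A\<^esub>)]"
      using Rb.coproduct_list_source[OF sL(2)[OF l]] sL(1)[OF l] by (simp add: TR)
    show "tensor_equiv ?TR (?\<Delta>\<^sub>R (t\<^sub>L l)) [(\<one>\<^bsub>A\<^esub>, t\<^sub>L l)]"
      using Rb.coproduct_list_target[OF tL(2)[OF l]] tL(1)[OF l] by (simp add: TR)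
  next
    fix a b
    assume ab: "a \<in> carrier A" "b \<in> carrier A"
    show "tensor_equiv ?TL (?\<Delta>\<^sub>L (a \<otimes>\<^bsub>A\<^esub> b)) (concat (map (\<lambda>(u, v).
        map (\<lambda>(x, y). (x \<otimes>\<^bsub>A\<^esub> u, y \<otimes>\<^bsub>A\<^esub> v)) (?\<Delta>\<^sub>L a)) (?\<Delta>\<^sub>L b)))"
      using Lb.coproduct_list_mult[OF ab] by (simp add: TL)
    \<comment> \<open>In \<open>opposite A\<close> this is the product of \<open>b\<close> and
      \<open>a\<close>, whence the exchanged instantiation.\<close>
    show "tensor_equiv ?TR (?\<Delta>\<^sub>R (a \<otimes>\<^bsub>A\<^esub> b)) (concat (map (\<lambda>(u, v).
        map (\<lambda>(x, y). (u \<otimes>\<^bsub>A\<^esub> x, v \<otimes>\<^bsub>A\<^esub> y)) (?\<Delta>\<^sub>R b)) (?\<Delta>\<^sub>R a)))"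
      using Rb.coproduct_list_mult[of b a] ab by (simp add: TR)
    \<comment> \<open>On \<open>opposite A\<close> the map \<open>s\<^sub>R\<close> is the target,
      so this is the target axiom for the counit.\<close>
    show "\<pi>\<^sub>R (s\<^sub>R (\<pi>\<^sub>R a) \<otimes>\<^bsub>A\<^esub> b) = \<pi>\<^sub>R (a \<otimes>\<^bsub>A\<^esub> b)"
      using Rb.counit_target[of b a] ab by simp
  next
    fix l a
    assume la: "l \<in> carrier L" "a \<in> carrier A"
    show "tensor_equiv ?TL (map (\<lambda>(x, y). (x \<otimes>\<^bsub>A\<^esub> t\<^sub>L l, y)) (?\<Delta>\<^sub>L a))
        (map (\<lambda>(x, y). (x, y \<otimes>\<^bsub>A\<^esub> s\<^sub>L l)) (?\<Delta>\<^sub>L a))"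
      using Lb.coproduct_list_takeuchi[OF la] by (simp add: tensor_equiv_def list_sum_map_pair TL)
  next
    fix r a
    assume ra: "r \<in> carrier R" "a \<in> carrier A"
    show "tensor_equiv ?TR (map (\<lambda>(x, y). (x, t\<^sub>R r \<otimes>\<^bsub>A\<^esub> y)) (?\<Delta>\<^sub>R a))
        (map (\<lambda>(x, y). (s\<^sub>R r \<otimes>\<^bsub>A\<^esub> x, y)) (?\<Delta>\<^sub>R a))"
      using Rb.coproduct_list_takeuchi[of r a] ra by (simp add: tensor_equiv_def list_sum_map_pair TR)
  qed (use Rb.counit_left_list Rb.counit_right_list in \<open>simp_all add: Lb.A.ring_axioms S_hom closed
      \<Delta>L \<Delta>R S_tL S_tR Lb.counit_left_list Lb.counit_right_list Lb.counit_source\<close>)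
qed

text \<open>A relator contains a base element only through its image in \<open>A\<close>, so the
  base rings themselves, even their types, may differ.\<close>

lemma extension_tensor_cong:
  assumes "\<iota> ` carrier B = \<kappa> ` carrier C"
  shows "extension_tensor B A \<iota> = extension_tensor C A \<kappa>"
proof -
  \<comment> \<open>The parameter is replaced by its image, after which both sets of relators are
    indexed by the common range.\<close>
  have image: "{g (\<nu> d) x y | d x y. d \<in> D \<and> x \<in> X \<and> y \<in> X} = {g b x y | b x y. b \<in> \<nu> ` D \<and> x \<in> X \<and> y \<in> X}"
    for g :: "'p \<Rightarrow> 'q \<Rightarrow> 'q \<Rightarrow> 's" and \<nu> :: "'t \<Rightarrow> 'p" and D X
    by blast
  let ?g = "\<lambda>b x y. frag_of (x \<otimes>\<^bsub>A\<^esub> b, y) - frag_of (x, b \<otimes>\<^bsub>A\<^esub> y)"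
  have "{?g (\<iota> b) x y | b x y. b \<in> carrier B \<and> x \<in> carrier A \<and> y \<in> carrier A} =
      {?g (\<kappa> c) x y | c x y. c \<in> carrier C \<and> x \<in> carrier A \<and> y \<in> carrier A}"
    unfolding image[of ?g \<iota> "carrier B" "carrier A"] image[of ?g \<kappa> "carrier C" "carrier A"] assms ..
  then show ?thesis
    unfolding extension_tensor_def tensor_product_def by simp
qed

lemma separable_extension_cong:
  assumes "\<iota> ` carrier B = \<kappa> ` carrier C"
  shows "separable_extension B A \<iota> \<longleftrightarrow> separable_extension C A \<kappa>"
  unfolding separable_extension_def extension_tensor_cong[OF assms] ..

section \<open>From normalized integrals to separability\<close>

context hopf_algebroid
begin

lemma image_sL: "s\<^sub>L ` carrier L = t\<^sub>R ` carrier R" and image_tL: "t\<^sub>L ` carrier L = s\<^sub>R ` carrier R"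
proof -
  interpret Lb: left_bialgebroid K A L s\<^sub>L t\<^sub>L \<gamma>\<^sub>L \<pi>\<^sub>L
    by (rule left_bialgebroid)
  interpret Rb: left_bialgebroid K "opposite A" R t\<^sub>R s\<^sub>R \<gamma>\<^sub>R \<pi>\<^sub>R
    by (rule opposite_right_bialgebroid)
  note closed = Lb.source_props(1) Lb.target_props(1) Lb.counit_props(1)
    Rb.source_props(1) Rb.target_props(1) Rb.counit_props(1)
  show "s\<^sub>L ` carrier L = t\<^sub>R ` carrier R"
  proof (intro subset_antisym image_subsetI)
    show "s\<^sub>L l \<in> t\<^sub>R ` carrier R" if "l \<in> carrier L" for l
      using that closed by (intro image_eqI[of _ _ "\<pi>\<^sub>R (s\<^sub>L l)"]) (auto simp: tR_piR_sL)
    show "t\<^sub>R r \<in> s\<^sub>L ` carrier L" if "r \<in> carrier R" for r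
      using that closed by (intro image_eqI[of _ _ "\<pi>\<^sub>L (t\<^sub>R r)"]) (auto simp: sL_piL_tR)
  qed
  show "t\<^sub>L ` carrier L = s\<^sub>R ` carrier R"
  proof (intro subset_antisym image_subsetI)
    show "t\<^sub>L l \<in> s\<^sub>R ` carrier R" if "l \<in> carrier L" for l
      using that closed by (intro image_eqI[of _ _ "\<pi>\<^sub>R (t\<^sub>L l)"]) (auto simp: sR_piR_tL)
    show "s\<^sub>R r \<in> t\<^sub>L ` carrier L" if "r \<in> carrier R" for r
      using that closed by (intro image_eqI[of _ _ "\<pi>\<^sub>L (s\<^sub>R r)"]) (auto simp: tL_piL_sR)
  qed
qed

lemma left_integral_separable:
  assumes "i \<in> left_integrals A s\<^sub>L \<pi>\<^sub>L" "\<pi>\<^sub>L i = \<one>\<^bsub>L\<^esub>"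
  shows "separable_extension R A s\<^sub>R"
proof -
  interpret Lb: left_bialgebroid K A L s\<^sub>L t\<^sub>L \<gamma>\<^sub>L \<pi>\<^sub>L
    by (rule left_bialgebroid)
  interpret H: sweedler_hopf A L s\<^sub>L t\<^sub>L \<pi>\<^sub>L "left_bialgebroid.coproduct_list A L s\<^sub>L t\<^sub>L \<gamma>\<^sub>L"
    R s\<^sub>R t\<^sub>R \<pi>\<^sub>R "left_bialgebroid.coproduct_list (opposite A) R t\<^sub>R s\<^sub>R \<gamma>\<^sub>R" S
    by (rule sweedler_hopf)
  have "i \<in> left_integrals A t\<^sub>L \<pi>\<^sub>L"
    using assms(1) Lb.left_integrals_source_target by simp
  then have "casimir_list R A s\<^sub>R
      (map (\<lambda>(x, y). (x, S y)) (left_bialgebroid.coproduct_list (opposite A) R t\<^sub>R s\<^sub>R \<gamma>\<^sub>R i))"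
    using assms(2) by (intro H.left_integral_casimir_list) (auto simp: left_integrals_def Lb.source_props)
  then show ?thesis
    unfolding H.sR.separable_extension_iff_casimir by blast
qed

text \<open>A right integral is a left integral of the opposite algebra, where the roles of
  \<open>L\<close> and \<open>R\<close> are exchanged. The Casimir construction there concerns
  \<open>s\<^sub>L\<close>, and the flip returns the result to \<open>A\<close>.\<close>

lemma right_integral_separable:
  assumes "i \<in> right_integrals A s\<^sub>R \<pi>\<^sub>R" "\<pi>\<^sub>R i = \<one>\<^bsub>R\<^esub>"
  shows "separable_extension L A s\<^sub>L"
proof -
  interpret Rb: left_bialgebroid K "opposite A" R t\<^sub>R s\<^sub>R \<gamma>\<^sub>R \<pi>\<^sub>R
    by (rule opposite_right_bialgebroid)
  interpret H: sweedler_hopf "opposite A" R s\<^sub>R t\<^sub>R \<pi>\<^sub>R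
    "\<lambda>a. map (\<lambda>(x, y). (y, x)) (left_bialgebroid.coproduct_list (opposite A) R t\<^sub>R s\<^sub>R \<gamma>\<^sub>R a)"
    L s\<^sub>L t\<^sub>L \<pi>\<^sub>L "\<lambda>a. map (\<lambda>(x, y). (y, x)) (left_bialgebroid.coproduct_list A L s\<^sub>L t\<^sub>L \<gamma>\<^sub>L a)" S
    by (rule sweedler_hopf.opposite_sweedler_hopf[OF sweedler_hopf])
  \<comment> \<open>Reversing products in the definition of a right integral gives an equation with
    \<open>s\<^sub>R\<close>, whereas the Casimir construction expects the form with
    \<open>t\<^sub>R\<close>.\<close>
  have "i \<in> left_integrals (opposite A) t\<^sub>R \<pi>\<^sub>R"
    using assms(1) unfolding Rb.left_integrals_source_target
    by (simp add: left_integrals_def right_integrals_def)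
  then have "casimir_list L (opposite A) s\<^sub>L (map (\<lambda>(x, y). (x, S y))
      (map (\<lambda>(x, y). (y, x)) (left_bialgebroid.coproduct_list A L s\<^sub>L t\<^sub>L \<gamma>\<^sub>L i)))"
    using assms(2) Rb.target_props(4)
    by (intro H.left_integral_casimir_list) (auto simp: left_integrals_def)
  then have "separable_extension L (opposite A) s\<^sub>L"
    unfolding H.sR.separable_extension_iff_casimir by blast
  \<comment> \<open>Flipping replaces the base by \<open>opposite L\<close>; separability does not
    notice, as the range of \<open>s\<^sub>L\<close> stays the same.\<close>
  from H.sR.separable_extension_opposite[OF this] show ?thesis
    using separable_extension_cong[of s\<^sub>L "opposite L" s\<^sub>L L A] by simp
qed

end

theorem theorem3p1:
  fixes K :: "('k, 'x) ring_scheme"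
    and A :: "('k, 'a, 'y) module_scheme"
    and L :: "('k, 'l, 'z) module_scheme"
    and s\<^sub>L t\<^sub>L :: "'l \<Rightarrow> 'a"
    and \<gamma>\<^sub>L :: "'a \<Rightarrow> ('a \<times> 'a \<Rightarrow>\<^sub>0 int) set" and \<pi>\<^sub>L :: "'a \<Rightarrow> 'l"
    and R :: "('k, 'r, 'w) module_scheme"
    and s\<^sub>R t\<^sub>R :: "'r \<Rightarrow> 'a"
    and \<gamma>\<^sub>R :: "'a \<Rightarrow> ('a \<times> 'a \<Rightarrow>\<^sub>0 int) set" and \<pi>\<^sub>R :: "'a \<Rightarrow> 'r"
    and S :: "'a \<Rightarrow> 'a"
  assumes "hopf_algebroid K A L s\<^sub>L t\<^sub>L \<gamma>\<^sub>L \<pi>\<^sub>L R s\<^sub>R t\<^sub>R \<gamma>\<^sub>R \<pi>\<^sub>R S"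
  shows "let
      p1a = separable_extension R A s\<^sub>R;
      p1b = separable_extension (opposite R) A t\<^sub>R;
      p1c = separable_extension L A s\<^sub>L;
      p1d = separable_extension (opposite L) A t\<^sub>L;
      p2a = right_semisimple_extension TYPE('a + 'u) R A s\<^sub>R;
      p2b = right_semisimple_extension TYPE('a + 'u) (opposite R) A t\<^sub>R;
      p2c = left_semisimple_extension TYPE('a + 'u) L A s\<^sub>L;
      p2d = left_semisimple_extension TYPE('a + 'u) (opposite L) A t\<^sub>L;
      p3a = (\<exists>i \<in> left_integrals A s\<^sub>L \<pi>\<^sub>L. \<pi>\<^sub>L i = \<one>\<^bsub>L\<^esub>);
      p3b = (\<exists>p \<in> right_integrals A s\<^sub>R \<pi>\<^sub>R. \<pi>\<^sub>R p = \<one>\<^bsub>R\<^esub>);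
      p4a = splits_over (opposite A) (regular_module (opposite A)) (right_base_module A R s\<^sub>R \<pi>\<^sub>R) \<pi>\<^sub>R;
      p4b = splits_over A (regular_module A) (left_base_module A L s\<^sub>L \<pi>\<^sub>L) \<pi>\<^sub>L
    in (p1a \<longleftrightarrow> p1b) \<and> (p1b \<longleftrightarrow> p1c) \<and> (p1c \<longleftrightarrow> p1d) \<and>
       (p1d \<longleftrightarrow> p2a) \<and> (p2a \<longleftrightarrow> p2b) \<and> (p2b \<longleftrightarrow> p2c) \<and> (p2c \<longleftrightarrow> p2d) \<and>
       (p2d \<longleftrightarrow> p3a) \<and> (p3a \<longleftrightarrow> p3b) \<and> (p3b \<longleftrightarrow> p4a) \<and> (p4a \<longleftrightarrow> p4b)"
proof -
  interpret H: hopf_algebroid K A L s\<^sub>L t\<^sub>L \<gamma>\<^sub>L \<pi>\<^sub>L R s\<^sub>R t\<^sub>R \<gamma>\<^sub>R \<pi>\<^sub>R S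
    by (rule assms)
  interpret Lb: left_bialgebroid K A L s\<^sub>L t\<^sub>L \<gamma>\<^sub>L \<pi>\<^sub>L
    by (rule H.left_bialgebroid)
  interpret Rb: left_bialgebroid K "opposite A" R t\<^sub>R s\<^sub>R \<gamma>\<^sub>R \<pi>\<^sub>R
    by (rule H.opposite_right_bialgebroid)
  \<comment> \<open>Right modules are treated over \<open>opposite A\<close>, where the base of
    \<open>s\<^sub>R\<close> becomes \<open>opposite R\<close> and the base of
    \<open>t\<^sub>R\<close> becomes \<open>R\<close> again.\<close>
  have sR: "ring_extension A R s\<^sub>R" and tR: "ring_extension A (opposite R) t\<^sub>R"
    and sL: "ring_extension A L s\<^sub>L" and tL: "ring_extension A (opposite L) t\<^sub>L"
    and sR': "ring_extension (opposite A) (opposite R) s\<^sub>R" and tR': "ring_extension (opposite A) R t\<^sub>R"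
    using Lb.source_props(1) Lb.target_props(1) Rb.source_props(1) Rb.target_props(1)
      Lb.A.ring_axioms Rb.A.ring_axioms
    by (auto simp: ring_extension_def ring_extension_axioms_def)
  \<comment> \<open>Equality of ranges only groups the four separability conditions into two pairs;
    the pairs are connected later, through the integrals.\<close>
  have 1: "separable_extension R A s\<^sub>R \<longleftrightarrow> separable_extension (opposite L) A t\<^sub>L"
    "separable_extension (opposite R) A t\<^sub>R \<longleftrightarrow> separable_extension L A s\<^sub>L"
    by (rule separable_extension_cong; simp add: H.image_sL H.image_tL)+
  have 2: "right_semisimple_extension TYPE('a + 'u) R A s\<^sub>R"
    "left_semisimple_extension TYPE('a + 'u) (opposite L) A t\<^sub>L" if "separable_extension R A s\<^sub>R"
    using ring_extension.separable_extension_opposite[OF sR that] 1(1) that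
      ring_extension.separable_imp_left_semisimple[OF sR', where 'm = "'a + 'u"]
      ring_extension.separable_imp_left_semisimple[OF tL, where 'm = "'a + 'u"]
    unfolding right_semisimple_extension_def by blast+
  have 3: "right_semisimple_extension TYPE('a + 'u) (opposite R) A t\<^sub>R"
    "left_semisimple_extension TYPE('a + 'u) L A s\<^sub>L" if "separable_extension L A s\<^sub>L"
    using ring_extension.separable_extension_opposite[OF tR] 1(2) that
      ring_extension.separable_imp_left_semisimple[OF tR', where 'm = "'a + 'u"]
      ring_extension.separable_imp_left_semisimple[OF sL, where 'm = "'a + 'u"]
    unfolding right_semisimple_extension_def opposite_simps by blast+
  \<comment> \<open>The bialgebroid on \<open>opposite A\<close> has source
    \<open>t\<^sub>R\<close>, so this form with \<open>s\<^sub>R\<close> is its target version and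
    needs \<open>splits_over_base_source_target\<close>.\<close>
  have base: "right_base_module A R s\<^sub>R \<pi>\<^sub>R = left_base_module (opposite A) R s\<^sub>R \<pi>\<^sub>R"
    by (simp add: right_base_module_def left_base_module_def)
  let ?p4a = "splits_over (opposite A) (regular_module (opposite A)) (right_base_module A R s\<^sub>R \<pi>\<^sub>R) \<pi>\<^sub>R"
  let ?p4b = "splits_over A (regular_module A) (left_base_module A L s\<^sub>L \<pi>\<^sub>L) \<pi>\<^sub>L"
  have 4: ?p4a if "right_semisimple_extension TYPE('a + 'u) R A s\<^sub>R"
    using Rb.target_semisimple_imp_splits that unfolding base Rb.splits_over_base_source_target
      right_semisimple_extension_def by blast
  have 5: ?p4a if "right_semisimple_extension TYPE('a + 'u) (opposite R) A t\<^sub>R"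
    using Rb.source_semisimple_imp_splits that unfolding base Rb.splits_over_base_source_target
      right_semisimple_extension_def opposite_simps by blast
  have 6: ?p4b if "left_semisimple_extension TYPE('a + 'u) L A s\<^sub>L"
    using that by (rule Lb.source_semisimple_imp_splits)
  have 7: ?p4b if "left_semisimple_extension TYPE('a + 'u) (opposite L) A t\<^sub>L"
    using that by (rule Lb.target_semisimple_imp_splits)
  have "right_integrals A s\<^sub>R \<pi>\<^sub>R = left_integrals (opposite A) s\<^sub>R \<pi>\<^sub>R"
    by (simp add: right_integrals_def left_integrals_def)
  then have 8: "(\<exists>p \<in> right_integrals A s\<^sub>R \<pi>\<^sub>R. \<pi>\<^sub>R p = \<one>\<^bsub>R\<^esub>) \<longleftrightarrow> ?p4a"
    using Rb.normalized_integral_iff_splits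
    unfolding base Rb.splits_over_base_source_target Rb.left_integrals_source_target by simp
  have 9: "(\<exists>i \<in> left_integrals A s\<^sub>L \<pi>\<^sub>L. \<pi>\<^sub>L i = \<one>\<^bsub>L\<^esub>) \<longleftrightarrow> ?p4b"
    by (rule Lb.normalized_integral_iff_splits)
  have 10: "separable_extension R A s\<^sub>R" if "\<exists>i \<in> left_integrals A s\<^sub>L \<pi>\<^sub>L. \<pi>\<^sub>L i = \<one>\<^bsub>L\<^esub>"
    using that H.left_integral_separable by blast
  have 11: "separable_extension L A s\<^sub>L" if "\<exists>p \<in> right_integrals A s\<^sub>R \<pi>\<^sub>R. \<pi>\<^sub>R p = \<one>\<^bsub>R\<^esub>"
    using that H.right_integral_separable by blast
  \<comment> \<open>Separability of either pair gives semisimplicity both for right and for left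
    modules, hence splittings of both counits, hence both kinds of integrals. A left integral
    returns separability along \<open>s\<^sub>R\<close> and a right one along
    \<open>s\<^sub>L\<close>, which closes the cycle and joins the two pairs.\<close>
  show ?thesis
    unfolding Let_def using 1 2 3 4 5 6 7 8 9 10 11 by argo
qed

end
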